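(* Let $\mathcal{G}$ be a $3$-dimensional contact étale Lie groupoid. For an object $x\in\mathcal{G}_0$ let $\mathcal{G}_x$ be the isotropy group at $x$. Then: (1) the Cartan prolongation $\mathbb{P}(\mathcal{G})$ is a manifold if and only if $\mathcal{G}$ is proper, positive, and $|\mathcal{G}_x|$ is odd for all $x\in\mathcal{G}_0$; (2) the oriented Cartan prolongation $\mathbb{S}(\mathcal{G})$ is a manifold if and only if $\mathcal{G}$ is proper and positive.
   Context: A Lie groupoid $\mathcal{G}=(\mathcal{G}_0,\mathcal{G}_1,s,t,i,\operatorname{inv},\operatorname{comp})$ is a groupoid whose sets of objects $\mathcal{G}_0$ and arrows $\mathcal{G}_1$ are manifolds, whose structure maps (source $s$, target $t$, identities $i$, inversion, composition) are smooth, and whose source map is a submersion. It is étale if $s$ is a local diffeomorphism, proper if $s\times t:\mathcal{G}_1\to\mathcal{G}_0\times\mathcal{G}_0$ is a proper map, and free if $s\times t$ is injective (equivalently, all isotropy groups are trivial). The isotropy group is $\mathcal{G}_x=\{\sigma\in\mathcal{G}_1: s(\sigma)=t(\sigma)=x\}$. In an étale groupoid each arrow $\sigma:x\to y$ determines a germ of diffeomorphism $(\mathcal{G}_0,x)\to(\mathcal{G}_0,y)$, namely the germ of $t\circ(s|_W)^{-1}$ for a small neighbourhood $W$ of $\sigma$. A contact structure on a $3$-manifold is a rank $2$ distribution $\xi$ such that $\alpha\wedge d\alpha$ vanishes nowhere for any local $1$-form $\alpha$ with $\xi=\operatorname{Ker}\alpha$; a local contactomorphism is a local diffeomorphism whose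 differential maps one contact structure into the other. A ($3$-dimensional) contact étale Lie groupoid is an étale Lie groupoid such that $\mathcal{G}_0$ and $\mathcal{G}_1$ are contact ($3$-)manifolds and all structure maps are local contactomorphisms. Write $\xi$ for the contact structure on $\mathcal{G}_0$. The groupoid is positive if for every $x\in\mathcal{G}_0$ the linear action of $\mathcal{G}_x$ on the plane $\xi_x$ (by differentials of the associated germs) preserves the orientation of $\xi_x$. For a contact $3$-manifold $(M,\xi)$, $\mathbb{P}(M)=\coprod_{x\in M}\mathbb{P}(\xi_x)$ is the bundle of $1$-dimensional subspaces of the planes $\xi_x$, and $\mathbb{S}(M)=\coprod_{x\in M}(\xi_x\setminus\{0\})/\mathbb{R}_{>0}$ is the bundle of rays. An Engel structure on a $4$-manifold is a rank $2$ distribution $\mathcal{D}$ such that $\mathcal{D}^2=\mathcal{D}+[\mathcal{D},\mathcal{D}]$ has rank $3$ and $\mathcal{D}^2+[\mathcal{D}^2,\mathcal{D}^2]$ has rank $4$. $\mathbb{P}(M)$ carries the Engel structure $\mathcal{D}_{(l,x)}=d\pi_{(l,x)}^{-1}(l)$, where $\pi:\mathbb{P}(M)\to M$ is the projection, and $\mathbb{S}(M)$ carries its pull-back by the double cover $\mathbb{S}(M)\to\mathbb{P}(M)$. Both constructions are functorial for local contactomorphisms (via differentials). The Cartan prolongation $\mathbb{P}(\mathcal{G})$ of $\mathcal{G}$ is the Engel étale Lie groupoid (object and arrow manifolds are Engel manifolds and the structure maps are local diffeomorphisms preserving the Engel structures) with objects $\mathbb{P}(\mathcal{G}_0)$, arrows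 $\mathbb{P}(\mathcal{G}_1)$ and induced structure maps; the oriented Cartan prolongation $\mathbb{S}(\mathcal{G})$ is defined likewise with $\mathbb{S}(\mathcal{G}_0)$, $\mathbb{S}(\mathcal{G}_1)$. An étale Lie groupoid is a manifold if it is proper and free (equivalently, if it is weakly equivalent to the trivial groupoid of a manifold, which has only identity arrows).
   Formalization: The groupoid is additionally assumed effective (arrows are determined by their germs); without this the claim fails, e.g. for Z/3 acting trivially on a contact 3-manifold, which is proper, positive, of odd isotropy, but whose prolongations are not free. *)

theory Defs
  imports "HOL-Analysis.Analysis"
begin

section \<open>Smooth manifolds\<close>

text \<open>Used for open sets \<open>S\<close> only. In finite dimension, the existence and continuity of all
  iterated directional derivatives up to order \<open>k\<close> is the usual notion of class \<open>C^k\<close>.\<close>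

primrec Ck_on ::
  "nat \<Rightarrow> ('e::real_normed_vector \<Rightarrow> 'f::real_normed_vector) \<Rightarrow> 'e set \<Rightarrow> bool" where
  "Ck_on 0 f S \<longleftrightarrow> continuous_on S f"
| "Ck_on (Suc k) f S \<longleftrightarrow>
     (\<forall>x\<in>S. f differentiable (at x)) \<and> (\<forall>v. Ck_on k (\<lambda>x. frechet_derivative f (at x) v) S)"

definition smooth_on ::
  "'e set \<Rightarrow> ('e::real_normed_vector \<Rightarrow> 'f::real_normed_vector) \<Rightarrow> bool" where
  "smooth_on S f \<longleftrightarrow> (\<forall>k. Ck_on k f S)"

type_synonym ('a, 'e) chart = "'a set \<times> ('a \<Rightarrow> 'e)"

record ('a, 'e) mfd =
  points :: "'a set"
  charts :: "('a, 'e) chart set"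

definition chart_inv :: "('a, 'e) chart \<Rightarrow> 'e \<Rightarrow> 'a" where
  "chart_inv c = inv_into (fst c) (snd c)"

definition charts_at :: "('a, 'e) mfd \<Rightarrow> 'a \<Rightarrow> ('a, 'e) chart set" where
  "charts_at M x = {c \<in> charts M. x \<in> fst c}"

definition mtop :: "('a, 'e::euclidean_space) mfd \<Rightarrow> 'a topology" where
  "mtop M = topology (\<lambda>W. W \<subseteq> points M \<and> (\<forall>c\<in>charts M. open (snd c ` (W \<inter> fst c))))"

text \<open>The dimension is that of the model space \<open>'e\<close>.\<close>

definition manifold :: "('a, 'e::euclidean_space) mfd \<Rightarrow> bool" where
  "manifold M \<longleftrightarrow>
     (\<Union>c\<in>charts M. fst c) = points M \<and>
     (\<forall>c\<in>charts M. inj_on (snd c) (fst c) \<and> open (snd c ` fst c)) \<and>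
     (\<forall>c\<in>charts M. \<forall>d\<in>charts M.
        open (snd c ` (fst c \<inter> fst d)) \<and>
        smooth_on (snd c ` (fst c \<inter> fst d)) (snd d \<circ> chart_inv c)) \<and>
     Hausdorff_space (mtop M) \<and> second_countable (mtop M)"

definition open_submfd :: "('a, 'e) mfd \<Rightarrow> 'a set \<Rightarrow> ('a, 'e) mfd" where
  "open_submfd M W =
     \<lparr>points = points M \<inter> W, charts = (\<lambda>c. (fst c \<inter> W, snd c)) ` charts M\<rparr>"

definition smooth_map ::
  "('a, 'e::euclidean_space) mfd \<Rightarrow> ('b, 'f::euclidean_space) mfd \<Rightarrow> ('a \<Rightarrow> 'b) \<Rightarrow> bool" where
  "smooth_map M N f \<longleftrightarrow>
     continuous_map (mtop M) (mtop N) f \<and>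
     (\<forall>c\<in>charts M. \<forall>d\<in>charts N.
        smooth_on (snd c ` (fst c \<inter> f -` fst d)) (snd d \<circ> f \<circ> chart_inv c))"

definition diffeo ::
  "('a, 'e::euclidean_space) mfd \<Rightarrow> ('b, 'f::euclidean_space) mfd \<Rightarrow> ('a \<Rightarrow> 'b) \<Rightarrow> bool" where
  "diffeo M N f \<longleftrightarrow>
     bij_betw f (points M) (points N) \<and> smooth_map M N f \<and>
     smooth_map N M (inv_into (points M) f)"

definition local_diffeo ::
  "('a, 'e::euclidean_space) mfd \<Rightarrow> ('b, 'f::euclidean_space) mfd \<Rightarrow> ('a \<Rightarrow> 'b) \<Rightarrow> bool" where
  "local_diffeo M N f \<longleftrightarrow>
     (\<forall>x\<in>points M. \<exists>W. x \<in> W \<and> openin (mtop M) W \<and> openin (mtop N) (f ` W) \<and>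
        diffeo (open_submfd M W) (open_submfd N (f ` W)) f)"


section \<open>Tangent vectors and differentials\<close>

text \<open>A tangent vector at \<open>x\<close> is the family of its coordinate vectors in all charts around \<open>x\<close>,
  related by the derivatives of the coordinate changes (and \<open>0\<close> at all other charts, so that the
  family is determined by the vector). The base point has to be recorded separately.\<close>

type_synonym ('a, 'e) tvec = "('a, 'e) chart \<Rightarrow> 'e"

definition tangent_space :: "('a, 'e::euclidean_space) mfd \<Rightarrow> 'a \<Rightarrow> ('a, 'e) tvec set" where
  "tangent_space M x =
     {v. (\<forall>c\<in>charts_at M x. \<forall>d\<in>charts_at M x.
            v d = frechet_derivative (snd d \<circ> chart_inv c) (at (snd c x)) (v c)) \<and>
         (\<forall>c. c \<notin> charts_at M x \<longrightarrow> v c = 0)}"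

definition tv_zero :: "('a, 'e::euclidean_space) tvec" where
  "tv_zero = (\<lambda>c. 0)"

definition tv_add ::
  "('a, 'e::euclidean_space) tvec \<Rightarrow> ('a, 'e) tvec \<Rightarrow> ('a, 'e) tvec" where
  "tv_add v w = (\<lambda>c. v c + w c)"

definition tv_scale :: "real \<Rightarrow> ('a, 'e::euclidean_space) tvec \<Rightarrow> ('a, 'e) tvec" where
  "tv_scale a v = (\<lambda>c. a *\<^sub>R v c)"

text \<open>By the chain rule the choice of \<open>c\<close> is irrelevant for tangent vectors \<open>v\<close>. Only the germ of
  \<open>f\<close> at \<open>x\<close> matters, so \<open>f\<close> may be a map that is meaningful near \<open>x\<close> only.\<close>

definition differential ::
  "('a, 'e::euclidean_space) mfd \<Rightarrow> ('b, 'f::euclidean_space) mfd \<Rightarrow> ('a \<Rightarrow> 'b) \<Rightarrow> 'a \<Rightarrow>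
   ('a, 'e) tvec \<Rightarrow> ('b, 'f) tvec" where
  "differential M N f x v =
     (let c = (SOME c. c \<in> charts_at M x) in
      (\<lambda>d. if d \<in> charts_at N (f x)
           then frechet_derivative (snd d \<circ> f \<circ> chart_inv c) (at (snd c x)) (v c) else 0))"


section \<open>Contact structures\<close>

type_synonym ('a, 'e) distrib = "'a \<Rightarrow> ('a, 'e) tvec set"

text \<open>The distribution \<open>D\<close> in the coordinates \<open>c\<close>, at the coordinate point \<open>q\<close>.\<close>

definition coord_distrib :: "('a, 'e) chart \<Rightarrow> ('a, 'e) distrib \<Rightarrow> 'e \<Rightarrow> 'e set" where
  "coord_distrib c D q = (\<lambda>v. v c) ` D (chart_inv c q)"

definition distribution ::
  "('a, 'e::euclidean_space) mfd \<Rightarrow> nat \<Rightarrow> ('a, 'e) distrib \<Rightarrow> bool" where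
  "distribution M k D \<longleftrightarrow>
     (\<forall>x\<in>points M. D x \<subseteq> tangent_space M x) \<and>
     (\<forall>c\<in>charts M. \<forall>p\<in>snd c ` fst c. \<exists>V X. open V \<and> p \<in> V \<and> V \<subseteq> snd c ` fst c \<and>
        (\<forall>i<k. smooth_on V (X i)) \<and>
        (\<forall>q\<in>V. coord_distrib c D q = span {X i q |i. i < k} \<and> dim (coord_distrib c D q) = k))"

definition one_form_on :: "'e set \<Rightarrow> ('e::euclidean_space \<Rightarrow> 'e \<Rightarrow> real) \<Rightarrow> bool" where
  "one_form_on V \<alpha> \<longleftrightarrow> (\<forall>q\<in>V. linear (\<alpha> q)) \<and> (\<forall>u. smooth_on V (\<lambda>q. \<alpha> q u))"

definition ext_deriv ::
  "('e::euclidean_space \<Rightarrow> 'e \<Rightarrow> real) \<Rightarrow> 'e \<Rightarrow> 'e \<Rightarrow> 'e \<Rightarrow> real" where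
  "ext_deriv \<alpha> q u v =
     frechet_derivative (\<lambda>p. \<alpha> p v) (at q) u - frechet_derivative (\<lambda>p. \<alpha> p u) (at q) v"

definition wedge12 :: "('e \<Rightarrow> real) \<Rightarrow> ('e \<Rightarrow> 'e \<Rightarrow> real) \<Rightarrow> 'e \<Rightarrow> 'e \<Rightarrow> 'e \<Rightarrow> real" where
  "wedge12 a \<beta> u v w = a u * \<beta> v w - a v * \<beta> u w + a w * \<beta> u v"

text \<open>Local 1-forms are written in coordinates: the condition is pointwise, and every local 1-form
  is covered by its restrictions to chart domains.\<close>

definition contact_structure ::
  "('a, real^3) mfd \<Rightarrow> ('a, real^3) distrib \<Rightarrow> bool" where
  "contact_structure M \<xi> \<longleftrightarrow>
     distribution M 2 \<xi> \<and>
     (\<forall>c\<in>charts M. \<forall>V \<alpha>. open V \<and> V \<subseteq> snd c ` fst c \<and> one_form_on V \<alpha> \<and>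
        (\<forall>q\<in>V. coord_distrib c \<xi> q = {v. \<alpha> q v = 0}) \<longrightarrow>
        (\<forall>q\<in>V. \<exists>u v w. wedge12 (\<alpha> q) (ext_deriv \<alpha> q) u v w \<noteq> 0))"

definition local_contactomorphism ::
  "('a, real^3) mfd \<Rightarrow> ('a, real^3) distrib \<Rightarrow> ('b, real^3) mfd \<Rightarrow> ('b, real^3) distrib \<Rightarrow>
   ('a \<Rightarrow> 'b) \<Rightarrow> bool" where
  "local_contactomorphism M \<xi> N \<eta> f \<longleftrightarrow>
     local_diffeo M N f \<and> (\<forall>x\<in>points M. differential M N f x ` \<xi> x = \<eta> (f x))"


section \<open>Etale Lie groupoids\<close>

text \<open>\<open>gmult G \<sigma> \<tau>\<close> is the composite of \<open>\<sigma>\<close> after \<open>\<tau>\<close>, defined if \<open>src G \<sigma> = tgt G \<tau>\<close>.\<close>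

record ('a, 'b, 'e) groupoid =
  Obj :: "('a, 'e) mfd"
  Arr :: "('b, 'e) mfd"
  src :: "'b \<Rightarrow> 'a"
  tgt :: "'b \<Rightarrow> 'a"
  ident :: "'a \<Rightarrow> 'b"
  ginv :: "'b \<Rightarrow> 'b"
  gmult :: "'b \<Rightarrow> 'b \<Rightarrow> 'b"

definition composable_pairs :: "('a, 'b, 'e, 'm) groupoid_scheme \<Rightarrow> ('b \<times> 'b) set" where
  "composable_pairs G =
     {(\<sigma>, \<tau>). \<sigma> \<in> points (Arr G) \<and> \<tau> \<in> points (Arr G) \<and> src G \<sigma> = tgt G \<tau>}"

definition groupoid_axioms :: "('a, 'b, 'e, 'm) groupoid_scheme \<Rightarrow> bool" where
  "groupoid_axioms G \<longleftrightarrow>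
     (\<forall>\<sigma>\<in>points (Arr G). src G \<sigma> \<in> points (Obj G) \<and> tgt G \<sigma> \<in> points (Obj G)) \<and>
     (\<forall>x\<in>points (Obj G). ident G x \<in> points (Arr G) \<and>
        src G (ident G x) = x \<and> tgt G (ident G x) = x) \<and>
     (\<forall>(\<sigma>, \<tau>)\<in>composable_pairs G. gmult G \<sigma> \<tau> \<in> points (Arr G) \<and>
        src G (gmult G \<sigma> \<tau>) = src G \<tau> \<and> tgt G (gmult G \<sigma> \<tau>) = tgt G \<sigma>) \<and>
     (\<forall>\<rho> \<sigma> \<tau>. (\<rho>, \<sigma>) \<in> composable_pairs G \<and> (\<sigma>, \<tau>) \<in> composable_pairs G \<longrightarrow>
        gmult G (gmult G \<rho> \<sigma>) \<tau> = gmult G \<rho> (gmult G \<sigma> \<tau>)) \<and>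
     (\<forall>\<sigma>\<in>points (Arr G). gmult G \<sigma> (ident G (src G \<sigma>)) = \<sigma> \<and>
        gmult G (ident G (tgt G \<sigma>)) \<sigma> = \<sigma>) \<and>
     (\<forall>\<sigma>\<in>points (Arr G). ginv G \<sigma> \<in> points (Arr G) \<and>
        src G (ginv G \<sigma>) = tgt G \<sigma> \<and> tgt G (ginv G \<sigma>) = src G \<sigma> \<and>
        gmult G (ginv G \<sigma>) \<sigma> = ident G (src G \<sigma>) \<and>
        gmult G \<sigma> (ginv G \<sigma>) = ident G (tgt G \<sigma>))"

text \<open>The fibre product of the arrow manifold with itself over source and target. When the source
  is a local diffeomorphism, so is the second projection (a pull-back of the source), and the
  submanifold structure of the fibre product is the one lifted along this projection.\<close>

definition composable :: "('a, 'b, 'e::euclidean_space, 'm) groupoid_scheme \<Rightarrow> ('b \<times> 'b, 'e) mfd"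
  where
  "composable G =
     \<lparr>points = composable_pairs G,
      charts = {(W, snd c \<circ> snd) |W c. c \<in> charts (Arr G) \<and>
        openin (subtopology (prod_topology (mtop (Arr G)) (mtop (Arr G))) (composable_pairs G)) W \<and>
        inj_on snd W \<and> snd ` W \<subseteq> fst c}\<rparr>"

text \<open>A source map that is a local diffeomorphism is in particular a submersion, and it forces
  objects and arrows to have the same dimension.\<close>

definition etale_lie_groupoid :: "('a, 'b, 'e::euclidean_space, 'm) groupoid_scheme \<Rightarrow> bool" where
  "etale_lie_groupoid G \<longleftrightarrow>
     manifold (Obj G) \<and> manifold (Arr G) \<and> groupoid_axioms G \<and>
     smooth_map (Arr G) (Obj G) (src G) \<and>
     smooth_map (Arr G) (Obj G) (tgt G) \<and>
     smooth_map (Obj G) (Arr G) (ident G) \<and>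
     smooth_map (Arr G) (Arr G) (ginv G) \<and>
     smooth_map (composable G) (Arr G) (\<lambda>(\<sigma>, \<tau>). gmult G \<sigma> \<tau>) \<and>
     local_diffeo (Arr G) (Obj G) (src G)"

definition proper_groupoid :: "('a, 'b, 'e::euclidean_space, 'm) groupoid_scheme \<Rightarrow> bool" where
  "proper_groupoid G \<longleftrightarrow>
     proper_map (mtop (Arr G)) (prod_topology (mtop (Obj G)) (mtop (Obj G)))
       (\<lambda>\<sigma>. (src G \<sigma>, tgt G \<sigma>))"

definition free_groupoid :: "('a, 'b, 'e, 'm) groupoid_scheme \<Rightarrow> bool" where
  "free_groupoid G \<longleftrightarrow> inj_on (\<lambda>\<sigma>. (src G \<sigma>, tgt G \<sigma>)) (points (Arr G))"

text \<open>The property of an etale Lie groupoid to be a manifold.\<close>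

definition is_manifold :: "('a, 'b, 'e::euclidean_space, 'm) groupoid_scheme \<Rightarrow> bool" where
  "is_manifold G \<longleftrightarrow> proper_groupoid G \<and> free_groupoid G"

definition isotropy :: "('a, 'b, 'e, 'm) groupoid_scheme \<Rightarrow> 'a \<Rightarrow> 'b set" where
  "isotropy G x = {\<sigma> \<in> points (Arr G). src G \<sigma> = x \<and> tgt G \<sigma> = x}"

text \<open>For a neighbourhood \<open>W\<close> of \<open>\<sigma>\<close> on which the source is injective, \<open>germ_map G W\<close> represents the
  germ of diffeomorphism determined by \<open>\<sigma>\<close>; it is meaningful on \<open>src G ` W\<close> only.\<close>

definition arrow_nbhd ::
  "('a, 'b, 'e::euclidean_space, 'm) groupoid_scheme \<Rightarrow> 'b \<Rightarrow> 'b set \<Rightarrow> bool" where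
  "arrow_nbhd G \<sigma> W \<longleftrightarrow> openin (mtop (Arr G)) W \<and> \<sigma> \<in> W \<and> inj_on (src G) W"

definition germ_map :: "('a, 'b, 'e, 'm) groupoid_scheme \<Rightarrow> 'b set \<Rightarrow> 'a \<Rightarrow> 'a" where
  "germ_map G W = tgt G \<circ> inv_into W (src G)"

definition same_germ ::
  "('a, 'b, 'e::euclidean_space, 'm) groupoid_scheme \<Rightarrow> 'b \<Rightarrow> 'b \<Rightarrow> bool" where
  "same_germ G \<sigma> \<tau> \<longleftrightarrow>
     src G \<sigma> = src G \<tau> \<and>
     (\<exists>W W' N. arrow_nbhd G \<sigma> W \<and> arrow_nbhd G \<tau> W' \<and>
        openin (mtop (Obj G)) N \<and> src G \<sigma> \<in> N \<and> N \<subseteq> src G ` W \<inter> src G ` W' \<and>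
        (\<forall>y\<in>N. germ_map G W y = germ_map G W' y))"

text \<open>Effective: the assignment of germs to arrows is injective. Two arrows with the same germ have
  the same image under source and target also after prolongation, so that a prolongation can only
  be free if the groupoid is effective; a finite group of odd order acting trivially on a contact
  manifold gives a proper, positive groupoid that is not.\<close>

definition effective_groupoid :: "('a, 'b, 'e::euclidean_space, 'm) groupoid_scheme \<Rightarrow> bool" where
  "effective_groupoid G \<longleftrightarrow>
     (\<forall>\<sigma>\<in>points (Arr G). \<forall>\<tau>\<in>points (Arr G). same_germ G \<sigma> \<tau> \<longrightarrow> \<sigma> = \<tau>)"


section \<open>Contact groupoids\<close>

record ('a, 'b, 'e) dist_groupoid = "('a, 'b, 'e) groupoid" +
  Obj_dist :: "('a, 'e) distrib"
  Arr_dist :: "('b, 'e) distrib"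

text \<open>The contact structure on the fibre product is pulled back along the second projection. If
  source and target are local contactomorphisms, the first projection gives the same structure.\<close>

definition composable_dist :: "('a, 'b, 'e::euclidean_space) dist_groupoid \<Rightarrow> ('b \<times> 'b, 'e) distrib"
  where
  "composable_dist G p =
     {u \<in> tangent_space (composable G) p.
        differential (composable G) (Arr G) snd p u \<in> Arr_dist G (snd p)}"

definition contact_etale_lie_groupoid :: "('a, 'b, real^3) dist_groupoid \<Rightarrow> bool" where
  "contact_etale_lie_groupoid G \<longleftrightarrow>
     etale_lie_groupoid G \<and>
     contact_structure (Obj G) (Obj_dist G) \<and>
     contact_structure (Arr G) (Arr_dist G) \<and>
     local_contactomorphism (Arr G) (Arr_dist G) (Obj G) (Obj_dist G) (src G) \<and>
     local_contactomorphism (Arr G) (Arr_dist G) (Obj G) (Obj_dist G) (tgt G) \<and>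
     local_contactomorphism (Obj G) (Obj_dist G) (Arr G) (Arr_dist G) (ident G) \<and>
     local_contactomorphism (Arr G) (Arr_dist G) (Arr G) (Arr_dist G) (ginv G) \<and>
     local_contactomorphism (composable G) (composable_dist G) (Arr G) (Arr_dist G)
       (\<lambda>(\<sigma>, \<tau>). gmult G \<sigma> \<tau>)"

text \<open>For a plane \<open>E\<close> and a linear automorphism \<open>A\<close> of it: the change of basis from \<open>(u, v)\<close> to
  \<open>(A u, A v)\<close> has positive determinant.\<close>

definition preserves_orientation ::
  "('a, 'e::euclidean_space) tvec set \<Rightarrow> (('a, 'e) tvec \<Rightarrow> ('a, 'e) tvec) \<Rightarrow> bool" where
  "preserves_orientation E A \<longleftrightarrow>
     (\<forall>u\<in>E. \<forall>v\<in>E.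
        (\<forall>a b. tv_add (tv_scale a u) (tv_scale b v) = tv_zero \<longrightarrow> a = 0 \<and> b = 0) \<longrightarrow>
        (\<exists>a b c d. A u = tv_add (tv_scale a u) (tv_scale b v) \<and>
                   A v = tv_add (tv_scale c u) (tv_scale d v) \<and> a * d - b * c > 0))"

definition positive_groupoid :: "('a, 'b, 'e::euclidean_space) dist_groupoid \<Rightarrow> bool" where
  "positive_groupoid G \<longleftrightarrow>
     (\<forall>x\<in>points (Obj G). \<forall>\<sigma>\<in>isotropy G x. \<forall>W. arrow_nbhd G \<sigma> W \<longrightarrow>
        preserves_orientation (Obj_dist G x) (differential (Obj G) (Obj G) (germ_map G W) x))"


section \<open>Cartan prolongation\<close>

text \<open>Both prolongations are treated at once, with a set \<open>T\<close> of scalars: \<open>tv_orbit UNIV v\<close> is the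
  line and \<open>tv_orbit {0<..} v\<close> the ray through the nonzero vector \<open>v\<close>.\<close>

definition tv_orbit :: "real set \<Rightarrow> ('a, 'e::euclidean_space) tvec \<Rightarrow> ('a, 'e) tvec set" where
  "tv_orbit T v = {tv_scale a v |a. a \<in> T}"

type_synonym ('a, 'e) prol_point = "'a \<times> ('a, 'e) tvec set"

definition prol_points ::
  "real set \<Rightarrow> ('a, 'e::euclidean_space) mfd \<Rightarrow> ('a, 'e) distrib \<Rightarrow> ('a, 'e) prol_point set" where
  "prol_points T M \<xi> =
     {(x, l). x \<in> points M \<and> (\<exists>v\<in>\<xi> x. v \<noteq> tv_zero \<and> l = tv_orbit T v)}"

text \<open>The chart of the bundle of lines (rays) given by a chart \<open>c\<close> of the base and a smooth frame
  \<open>(X, Y)\<close> of the planes over the coordinate domain \<open>V\<close>: the line (ray) through \<open>X + r Y\<close> over the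
  point with coordinates \<open>q\<close> has coordinates \<open>(q, r)\<close>.\<close>

definition prol_chart ::
  "real set \<Rightarrow> ('a, 'e::euclidean_space) mfd \<Rightarrow> ('a, 'e) distrib \<Rightarrow>
   ('a, 'e) chart \<Rightarrow> 'e set \<Rightarrow> ('e \<Rightarrow> 'e) \<Rightarrow> ('e \<Rightarrow> 'e) \<Rightarrow> (('a, 'e) prol_point, 'e \<times> real) chart" where
  "prol_chart T M \<xi> c V X Y =
     ({(x, l) \<in> prol_points T M \<xi>. x \<in> fst c \<and> snd c x \<in> V \<and>
         (\<exists>r. \<exists>v\<in>l. v c = X (snd c x) + r *\<^sub>R Y (snd c x))},
      (\<lambda>(x, l). (snd c x, THE r. \<exists>v\<in>l. v c = X (snd c x) + r *\<^sub>R Y (snd c x))))"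

definition prolongation ::
  "real set \<Rightarrow> ('a, 'e::euclidean_space) mfd \<Rightarrow> ('a, 'e) distrib \<Rightarrow>
   (('a, 'e) prol_point, 'e \<times> real) mfd" where
  "prolongation T M \<xi> =
     \<lparr>points = prol_points T M \<xi>,
      charts = {prol_chart T M \<xi> c V X Y |c V X Y.
        c \<in> charts M \<and> open V \<and> V \<subseteq> snd c ` fst c \<and> smooth_on V X \<and> smooth_on V Y \<and>
        (\<forall>q\<in>V. coord_distrib c \<xi> q = span {X q, Y q} \<and> dim (coord_distrib c \<xi> q) = 2)}\<rparr>"

text \<open>The preimage under the differential of the bundle projection of the line \<open>l\<close>, respectively of
  the line spanned by the ray \<open>l\<close> (the latter is the pull-back along the double cover).\<close>

definition engel_dist ::
  "real set \<Rightarrow> ('a, 'e::euclidean_space) mfd \<Rightarrow> ('a, 'e) distrib \<Rightarrow>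
   (('a, 'e) prol_point, 'e \<times> real) distrib" where
  "engel_dist T M \<xi> p =
     {w \<in> tangent_space (prolongation T M \<xi>) p.
        \<exists>v\<in>snd p. \<exists>a. differential (prolongation T M \<xi>) M fst p w = tv_scale a v}"

definition prol_map ::
  "('a, 'e::euclidean_space) mfd \<Rightarrow> ('b, 'e) mfd \<Rightarrow> ('a \<Rightarrow> 'b) \<Rightarrow>
   ('a, 'e) prol_point \<Rightarrow> ('b, 'e) prol_point" where
  "prol_map M N f = (\<lambda>(x, l). (f x, differential M N f x ` l))"

text \<open>The multiplication is the map induced by that of \<open>G\<close> on the prolongation of the fibre product,
  which is identified with the fibre product of the prolongations via the two projections.\<close>

definition prol_groupoid ::
  "real set \<Rightarrow> ('a, 'b, 'e::euclidean_space) dist_groupoid \<Rightarrow>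
   (('a, 'e) prol_point, ('b, 'e) prol_point, 'e \<times> real) dist_groupoid" where
  "prol_groupoid T G =
     \<lparr>Obj = prolongation T (Obj G) (Obj_dist G),
      Arr = prolongation T (Arr G) (Arr_dist G),
      src = prol_map (Arr G) (Obj G) (src G),
      tgt = prol_map (Arr G) (Obj G) (tgt G),
      ident = prol_map (Obj G) (Arr G) (ident G),
      ginv = prol_map (Arr G) (Arr G) (ginv G),
      gmult = (\<lambda>(\<sigma>, l) (\<tau>, m).
        prol_map (composable G) (Arr G) (\<lambda>(\<sigma>, \<tau>). gmult G \<sigma> \<tau>)
          ((\<sigma>, \<tau>),
           {u \<in> tangent_space (composable G) (\<sigma>, \<tau>).
              differential (composable G) (Arr G) fst (\<sigma>, \<tau>) u \<in> l \<and>
              differential (composable G) (Arr G) snd (\<sigma>, \<tau>) u \<in> m})),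
      Obj_dist = engel_dist T (Obj G) (Obj_dist G),
      Arr_dist = engel_dist T (Arr G) (Arr_dist G)\<rparr>"

definition cartan_prolongation ::
  "('a, 'b, real^3) dist_groupoid \<Rightarrow>
   (('a, real^3) prol_point, ('b, real^3) prol_point, (real^3) \<times> real) dist_groupoid" where
  "cartan_prolongation G = prol_groupoid UNIV G"

definition oriented_cartan_prolongation ::
  "('a, 'b, real^3) dist_groupoid \<Rightarrow>
   (('a, real^3) prol_point, ('b, real^3) prol_point, (real^3) \<times> real) dist_groupoid" where
  "oriented_cartan_prolongation G = prol_groupoid {0<..} G"

end

theory Submission
  imports Defs "HOL-Algebra.Multiplicative_Group"
begin

text \<open>An arrow of the prolongation is an arrow of the groupoid together with a line (ray). Hence the
  prolongation is free iff no nontrivial isotropy element fixes a direction in the contact plane.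
  Since the fibres of the prolongation are circles, the bundle projection is proper, and properness
  passes from the groupoid to its prolongation and back.

  An automorphism of the plane with negative determinant has a positive eigenvalue, and an isotropy
  group of even order contains an involution, which fixes a line. Conversely, let an isotropy element
  of finite order preserve the orientation of the plane and fix a ray (or a line, the order being odd).
  Then it is the identity on the plane. It multiplies a contact form by a function whose value at the
  fixed point is \<open>1\<close>, because it preserves the exterior derivative of the form; so its derivative is the
  identity on the whole tangent space. A germ of finite order with trivial derivative is trivial, and
  effectiveness shows that the element is the identity.\<close>

section \<open>Differential calculus in Euclidean spaces\<close>

text \<open>The action of an arrow on the contact plane is given by a germ, represented on a
  neighbourhood that may be chosen freely. Products and powers are hard to follow in this form. Each
  arrow is therefore replaced by a local section of the source, parametrised by a chart of the
  objects. Sections through the same arrow agree locally, sections can be multiplied, and the target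
  along the section through the n-th power of an isotropy element is the n-th iterate of one
  coordinate map. So the order of a group element becomes the order of a map near its fixed point.

  Second derivatives enter once, when the multiplier of the contact form is computed, and there they
  cancel by symmetry. This is why class \<open>C2_on\<close>, which is easily closed under
  composition, is the working notion.

  The two directions of properness differ: passing down cancels a surjective projection, while
  passing up requires continuous induced maps and a Hausdorff prolongation.

  Lines and rays are treated together. A fixed direction is an eigenvector in the plane, and only
  the set \<open>T\<close> of admissible scalars tells a nonzero eigenvalue from a positive
  one.\<close>

lemma differentiable_transform_open:
  assumes "f differentiable (at x)" "open S" "x \<in> S" "\<And>y. y \<in> S \<Longrightarrow> f y = g y"
  shows "g differentiable (at x)"
proof -
  obtain D where "(f has_derivative D) (at x)" using assms(1) unfolding differentiable_def by blast
  then have "(g has_derivative D) (at x)"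
    by (rule has_derivative_transform_within_open[OF _ assms(2,3)]) (rule assms(4))
  then show ?thesis unfolding differentiable_def by blast
qed

section \<open>Functions of class C^k: locality, sums and products\<close>

lemma Ck_on_lower: "Ck_on (Suc k) f S \<Longrightarrow> Ck_on k f S"
proof (induction k arbitrary: f)
  case 0
  then show ?case
    by (simp add: differentiable_on_def differentiable_at_withinI differentiable_imp_continuous_on)
next
  case (Suc k)
  have "Ck_on k (\<lambda>x. frechet_derivative f (at x) v) S" for v
    by (rule Suc.IH) (use Suc.prems in simp)
  then show ?case using Suc.prems by simp
qed

lemma Ck_on_cong:
  assumes "open S" "\<And>x. x \<in> S \<Longrightarrow> f x = g x" "Ck_on k f S"
  shows "Ck_on k g S"
  using assms(2,3)
proof (induction k arbitrary: f g)
  case 0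
  then show ?case using continuous_on_eq[of S f g] by simp
next
  case (Suc k)
  have d: "f differentiable (at x)" if "x \<in> S" for x
    using Suc.prems that by auto
  have d': "g differentiable (at x)" if "x \<in> S" for x
    by (rule differentiable_transform_open[OF d[OF that] assms(1) that]) (rule Suc.prems(1))
  have "frechet_derivative f (at x) = frechet_derivative g (at x)" if "x \<in> S" for x
    by (rule frechet_derivative_transform_within_open[OF d[OF that] assms(1) that]) (rule Suc.prems(1))
  note eq = this
  have "Ck_on k (\<lambda>x. frechet_derivative g (at x) v) S" for v
    by (rule Suc.IH[of "\<lambda>x. frechet_derivative f (at x) v"]) (use Suc.prems(2) in \<open>simp_all add: eq\<close>)
  then show ?case
    using d' by simp
qed

lemma Ck_on_subset: "Ck_on k f S \<Longrightarrow> S' \<subseteq> S \<Longrightarrow> Ck_on k f S'"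
proof (induction k arbitrary: f)
  case 0
  then show ?case using continuous_on_subset[of S f S'] by simp
next
  case (Suc k)
  then show ?case by (simp add: subset_iff)
qed

lemma smooth_on_subset: "smooth_on S f \<Longrightarrow> S' \<subseteq> S \<Longrightarrow> smooth_on S' f"
  by (simp add: smooth_on_def Ck_on_subset[of _ f S])

lemma Ck_on_const: "Ck_on k (\<lambda>x. c) S"
proof (induction k arbitrary: c)
  case (Suc k)
  then show ?case by simp
qed simp

lemma Ck_on_add:
  assumes "open S" "Ck_on k f S" "Ck_on k g S"
  shows "Ck_on k (\<lambda>x. f x + g x) S"
  using assms(2,3)
proof (induction k arbitrary: f g)
  case 0
  then show ?case by (auto intro: continuous_on_add)
next
  case (Suc k)
  have "frechet_derivative (\<lambda>x. f x + g x) (at x) v =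
      frechet_derivative f (at x) v + frechet_derivative g (at x) v" if "x \<in> S" for x v
  proof -
    have "(f has_derivative frechet_derivative f (at x)) (at x)"
      "(g has_derivative frechet_derivative g (at x)) (at x)"
      using Suc.prems that by (auto simp: frechet_derivative_works)
    from frechet_derivative_at[OF has_derivative_add[OF this]] show ?thesis by metis
  qed
  note eq = this
  have "Ck_on k (\<lambda>x. frechet_derivative f (at x) v + frechet_derivative g (at x) v) S" for v
    using Suc by simp
  then have "Ck_on k (\<lambda>x. frechet_derivative (\<lambda>x. f x + g x) (at x) v) S" for v
    by (rule Ck_on_cong[OF assms(1), rotated]) (simp add: eq)
  then show ?case
    using Suc.prems by simp
qed

text \<open>By the product rule a directional derivative is a sum of two terms of the same bilinear
  shape. In each of them one factor has lost a derivative and the other can be regarded as one class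
  lower, so the induction hypothesis applies to both.\<close>

lemma Ck_on_bilinear:
  assumes "bounded_bilinear B" "open S" "Ck_on k f S" "Ck_on k g S"
  shows "Ck_on k (\<lambda>x. B (f x) (g x)) S"
  using assms(3,4)
proof (induction k arbitrary: f g)
  case 0
  then show ?case using bounded_bilinear.continuous_on[OF assms(1)] by auto
next
  case (Suc k)
  have der: "((\<lambda>x. B (f x) (g x)) has_derivative
      (\<lambda>v. B (f x) (frechet_derivative g (at x) v) + B (frechet_derivative f (at x) v) (g x))) (at x)"
    if "x \<in> S" for x
  proof -
    have "(f has_derivative frechet_derivative f (at x)) (at x)"
      "(g has_derivative frechet_derivative g (at x)) (at x)"
      using Suc.prems that by (auto simp: frechet_derivative_works)
    then show ?thesis by (rule bounded_bilinear.FDERIV[OF assms(1)])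
  qed
  have eq: "frechet_derivative (\<lambda>x. B (f x) (g x)) (at x) v =
      B (f x) (frechet_derivative g (at x) v) + B (frechet_derivative f (at x) v) (g x)"
    if "x \<in> S" for x v
    using frechet_derivative_at[OF der[OF that]] by metis
  have "Ck_on k (\<lambda>x. B (f x) (frechet_derivative g (at x) v)
      + B (frechet_derivative f (at x) v) (g x)) S" for v
    using Suc.prems Ck_on_lower[OF Suc.prems(1)] Ck_on_lower[OF Suc.prems(2)]
    by (intro Ck_on_add[OF assms(2)] Suc.IH) auto
  then have "Ck_on k (\<lambda>x. frechet_derivative (\<lambda>x. B (f x) (g x)) (at x) v) S" for v
    by (rule Ck_on_cong[OF assms(2), rotated]) (simp add: eq)
  moreover have "(\<lambda>x. B (f x) (g x)) differentiable (at x)" if "x \<in> S" for x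
    using der[OF that] by (rule differentiableI)
  ultimately show ?case by simp
qed

lemma smooth_on_bilinear:
  assumes "bounded_bilinear B" "open S" "smooth_on S f" "smooth_on S g"
  shows "smooth_on S (\<lambda>x. B (f x) (g x))"
  using assms by (simp add: smooth_on_def Ck_on_bilinear)

lemma smooth_on_const: "smooth_on S (\<lambda>x. c)"
  by (simp add: smooth_on_def Ck_on_const)

lemma smooth_on_continuous: "smooth_on S f \<Longrightarrow> continuous_on S f"
  using Ck_on.simps(1)[of f S] unfolding smooth_on_def by metis

text \<open>Continuity of the first derivative and symmetry of the second are all that is used of
  smoothness later. Openness is part of the notion because the derivatives are taken in a full
  neighbourhood of each point.\<close>

definition C2_on :: "'e set \<Rightarrow> ('e::real_normed_vector \<Rightarrow> 'f::real_normed_vector) \<Rightarrow> bool" where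
  "C2_on S f \<longleftrightarrow> open S \<and> (\<forall>x\<in>S. f differentiable (at x)) \<and>
     (\<forall>v. \<forall>x\<in>S. (\<lambda>y. frechet_derivative f (at y) v) differentiable (at x))"

lemma smooth_on_imp_C2_on: "open S \<Longrightarrow> smooth_on S f \<Longrightarrow> C2_on S f"
  proof -
  assume "open S" "smooth_on S f"
  then have "Ck_on (Suc (Suc 0)) f S" by (simp add: smooth_on_def)
  then show ?thesis using \<open>open S\<close> by (simp add: C2_on_def)
qed

lemma C2_on_subset: "C2_on S f \<Longrightarrow> open S' \<Longrightarrow> S' \<subseteq> S \<Longrightarrow> C2_on S' f"
  unfolding C2_on_def by blast

lemma C2_on_open: "C2_on S f \<Longrightarrow> open S"
  unfolding C2_on_def by blast

lemma C2_on_derivative: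
  "C2_on S f \<Longrightarrow> x \<in> S \<Longrightarrow> (f has_derivative frechet_derivative f (at x)) (at x)"
  unfolding C2_on_def by (metis frechet_derivative_works)

lemma C2_on_continuous: "C2_on S f \<Longrightarrow> continuous_on S f"
  unfolding C2_on_def
  by (blast intro: continuous_at_imp_continuous_on differentiable_imp_continuous_within)

lemma C2_on_continuous_derivative:
  "C2_on S f \<Longrightarrow> continuous_on S (\<lambda>y. frechet_derivative f (at y) v)"
  unfolding C2_on_def
  by (blast intro: continuous_at_imp_continuous_on differentiable_imp_continuous_within)

lemma linear_frechet_derivative:
  "f differentiable (at x) \<Longrightarrow> linear (frechet_derivative f (at x))"
  using frechet_derivative_works has_derivative_linear by blast

lemma C2_on_linear: "C2_on S f \<Longrightarrow> x \<in> S \<Longrightarrow> linear (frechet_derivative f (at x))"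
  unfolding C2_on_def by (auto intro: linear_frechet_derivative)

lemma C2_on_cong:
  assumes "C2_on S f" "\<And>x. x \<in> S \<Longrightarrow> f x = g x"
  shows "C2_on S g"
proof -
  have S: "open S" and d: "\<And>x. x \<in> S \<Longrightarrow> f differentiable (at x)"
    and dd: "\<And>v x. x \<in> S \<Longrightarrow> (\<lambda>y. frechet_derivative f (at y) v) differentiable (at x)"
    using assms(1) by (auto simp: C2_on_def)
  have "g differentiable (at x)" if "x \<in> S" for x
    by (rule differentiable_transform_open[OF d[OF that] S that]) (rule assms(2))
  moreover have eq: "frechet_derivative f (at x) = frechet_derivative g (at x)" if "x \<in> S" for x
    by (rule frechet_derivative_transform_within_open[OF d[OF that] S that]) (rule assms(2))
  moreover have "(\<lambda>y. frechet_derivative g (at y) v) differentiable (at x)" if "x \<in> S" for v x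
    by (rule differentiable_transform_open[OF dd[OF that, of v] S that]) (simp add: eq)
  ultimately show ?thesis using S by (simp add: C2_on_def)
qed

text \<open>Regularity of a derivative is known only for each fixed direction. When the direction
  varies with the point, this expansion turns the value into a finite sum of products to which the
  usual rules apply.\<close>

lemma linear_eq_sum_Basis:
  fixes L :: "'e::euclidean_space \<Rightarrow> 'f::real_vector"
  assumes "linear L"
  shows "L w = (\<Sum>b\<in>Basis. (w \<bullet> b) *\<^sub>R L b)"
proof -
  have "L w = L (\<Sum>b\<in>Basis. (w \<bullet> b) *\<^sub>R b)" by (simp only: euclidean_representation)
  then show ?thesis by (simp only: linear_sum[OF assms] linear_scale[OF assms])
qed

lemma frechet_derivative_comp:
  assumes "f differentiable (at x)" "g differentiable (at (f x))"
  shows "frechet_derivative (g \<circ> f) (at x) v =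
    frechet_derivative g (at (f x)) (frechet_derivative f (at x) v)"
  using assms by (simp add: frechet_derivative_compose)

text \<open>In the chain rule the direction fed to the derivative of \<open>g\<close> moves with the
  point. Expanded in the basis, the derivative of the composite is a sum of products of
  differentiable functions.\<close>

lemma C2_on_comp:
  fixes f :: "'e::real_normed_vector \<Rightarrow> 'f::euclidean_space" and g :: "'f \<Rightarrow> 'g::real_normed_vector"
  assumes f: "C2_on S f" and g: "C2_on S' g" and sub: "\<And>x. x \<in> S \<Longrightarrow> f x \<in> S'"
  shows "C2_on S (g \<circ> f)"
proof -
  let ?D = "\<lambda>v y. \<Sum>b\<in>Basis. (frechet_derivative f (at y) v \<bullet> b) *\<^sub>R frechet_derivative g (at (f y)) b"
  have eq: "frechet_derivative (g \<circ> f) (at y) v = ?D v y" if "y \<in> S" for y v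
  proof -
    have "frechet_derivative (g \<circ> f) (at y) v = frechet_derivative g (at (f y)) (frechet_derivative f (at y) v)"
      using f g sub[OF that] that by (intro frechet_derivative_comp) (auto simp: C2_on_def)
    also have "\<dots> = ?D v y"
      by (rule linear_eq_sum_Basis[OF C2_on_linear[OF g sub[OF that]]])
    finally show ?thesis .
  qed
  have "?D v differentiable (at x)" if x: "x \<in> S" for v x
  proof -
    have df: "f differentiable (at x)" and "(\<lambda>y. frechet_derivative f (at y) v) differentiable (at x)"
      using f x by (auto simp: C2_on_def)
    moreover have "(\<lambda>y. frechet_derivative g (at (f y)) b) differentiable (at x)" for b
      using differentiable_chain_at[OF df, of "\<lambda>z. frechet_derivative g (at z) b"] g sub[OF x]
      by (auto simp: C2_on_def o_def)
    ultimately show ?thesis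
      by (intro differentiable_sum differentiable_scaleR differentiable_inner) auto
  qed
  then have "(\<lambda>y. frechet_derivative (g \<circ> f) (at y) v) differentiable (at x)" if "x \<in> S" for v x
    by (rule differentiable_transform_open[OF _ C2_on_open[OF f] that, of "?D v"])
      (simp_all add: eq that)
  moreover have "g \<circ> f differentiable (at x)" if "x \<in> S" for x
    using f g sub that by (auto simp: C2_on_def intro: differentiable_chain_at)
  ultimately show ?thesis using f by (simp add: C2_on_def)
qed

lemma continuous_on_apply_linear:
  fixes L :: "'z::topological_space \<Rightarrow> 'e::euclidean_space \<Rightarrow> 'f::real_normed_vector"
  assumes "\<And>z. z \<in> S \<Longrightarrow> linear (L z)" "\<And>v. continuous_on S (\<lambda>z. L z v)" "continuous_on S w"
  shows "continuous_on S (\<lambda>z. L z (w z))"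
proof -
  have "continuous_on S (\<lambda>z. \<Sum>b\<in>Basis. (w z \<bullet> b) *\<^sub>R L z b)"
    by (intro continuous_intros assms)
  then show ?thesis
    by (rule continuous_on_eq) (rule linear_eq_sum_Basis[OF assms(1), symmetric])
qed

text \<open>The mean value theorem is applied along \<open>u\<close> to the difference across
  \<open>v\<close>, so that only the derivative in direction \<open>u\<close> is differentiated
  again, and only at \<open>p\<close>. The quotient is symmetric in \<open>u\<close> and
  \<open>v\<close> although the limit is not visibly so; this is the source of the symmetry of
  second derivatives.\<close>

lemma second_difference_limit:
  fixes f :: "'e::real_normed_vector \<Rightarrow> real"
  assumes "open S" "p \<in> S" and der: "\<And>x. x \<in> S \<Longrightarrow> (f has_derivative f' x) (at x)"
    and der2: "((\<lambda>x. f' x u) has_derivative f2) (at p)"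
  shows "((\<lambda>t. (f (p + t *\<^sub>R u + t *\<^sub>R v) - f (p + t *\<^sub>R u) - f (p + t *\<^sub>R v) + f p) / t^2)
    \<longlongrightarrow> f2 v) (at_right 0)"
proof (rule tendstoI)
  fix e :: real assume "e > 0"
  \<comment> \<open>\<open>K\<close> bounds the size of the parallelogram and stays positive even if
    both vectors vanish. The factor 2 in \<open>e'\<close> below pays for two errors, one on each
    edge parallel to \<open>u\<close>.\<close>
  define K where "K = 2 * (norm u + norm v) + 1"
  have K: "norm u + norm v < K" "K > 0"
    unfolding K_def by (simp_all add: add_strict_increasing2 add_nonneg_pos)
  define e' where "e' = e / (2 * K)"
  have "e' > 0" using \<open>e > 0\<close> K by (simp add: e'_def)
  have lin: "linear f2" using der2 by (rule has_derivative_linear)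
  obtain d where d: "d > 0"
    "\<And>y. norm (y - p) < d \<Longrightarrow> norm (f' y u - f' p u - f2 (y - p)) \<le> e' * norm (y - p)"
    using der2 \<open>e' > 0\<close> unfolding has_derivative_at_alt by blast
  obtain r where r: "r > 0" "ball p r \<subseteq> S"
    using assms(1,2) open_contains_ball by blast
  define \<delta> where "\<delta> = min d r / K"
  have "\<delta> > 0" using d r K by (simp add: \<delta>_def)
  have "\<bar>(f (p + t *\<^sub>R u + t *\<^sub>R v) - f (p + t *\<^sub>R u) - f (p + t *\<^sub>R v) + f p) / t^2 - f2 v\<bar> < e"
    if t: "0 < t" "t < \<delta>" for t
  proof -
    have near: "norm (s *\<^sub>R u + w *\<^sub>R v) \<le> t * (norm u + norm v)" if "0 \<le> s" "s \<le> t" "0 \<le> w" "w \<le> t" for s w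
    proof -
      have "norm (s *\<^sub>R u + w *\<^sub>R v) \<le> s * norm u + w * norm v"
        using norm_triangle_ineq[of "s *\<^sub>R u" "w *\<^sub>R v"] that by simp
      also have "\<dots> \<le> t * norm u + t * norm v"
        using that by (intro add_mono mult_right_mono) auto
      finally show ?thesis by (simp add: algebra_simps)
    qed
    have tK: "t * (norm u + norm v) < min d r"
    proof -
      have "t * (norm u + norm v) \<le> t * K" using t K by (intro mult_left_mono) auto
      also have "\<dots> < \<delta> * K" using t K by simp
      finally show ?thesis using K by (simp add: \<delta>_def)
    qed
    have inS: "p + (s *\<^sub>R u + w *\<^sub>R v) \<in> S" if "0 \<le> s" "s \<le> t" "0 \<le> w" "w \<le> t" for s w
    proof -
      have "p + (s *\<^sub>R u + w *\<^sub>R v) \<in> ball p r"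
        using near[OF that] tK unfolding mem_ball dist_norm norm_minus_commute[of p]
        by (simp only: add_diff_cancel_left')
      then show ?thesis using r by blast
    qed
    \<comment> \<open>The summand \<open>0 *\<^sub>R v\<close> is kept so that both edges, at height
      \<open>t\<close> and at height \<open>0\<close>, are instances of the same formula.\<close>
    define \<phi> where "\<phi> s = f (p + (s *\<^sub>R u + t *\<^sub>R v)) - f (p + (s *\<^sub>R u + 0 *\<^sub>R v))" for s
    have "(\<phi> has_real_derivative f' (p + (s *\<^sub>R u + t *\<^sub>R v)) u - f' (p + (s *\<^sub>R u + 0 *\<^sub>R v)) u) (at s)"
      if "0 \<le> s" "s \<le> t" for s
    proof -
      have *: "((\<lambda>s. f (p + (s *\<^sub>R u + w *\<^sub>R v))) has_derivative (\<lambda>h. f' (p + (s *\<^sub>R u + w *\<^sub>R v)) (h *\<^sub>R u))) (at s)"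
        if "0 \<le> w" "w \<le> t" for w
      proof -
        have "((\<lambda>s. p + (s *\<^sub>R u + w *\<^sub>R v)) has_derivative (\<lambda>h. h *\<^sub>R u)) (at s)"
          by (auto intro!: derivative_eq_intros)
        from has_derivative_compose[OF this der[OF inS[OF \<open>0 \<le> s\<close> \<open>s \<le> t\<close> that]]]
        show ?thesis .
      qed
      have L: "f' (p + (s *\<^sub>R u + w *\<^sub>R v)) (h *\<^sub>R u) = h * f' (p + (s *\<^sub>R u + w *\<^sub>R v)) u"
        if "0 \<le> w" "w \<le> t" for w h
        using linear_scale[OF has_derivative_linear[OF der[OF inS[OF \<open>0 \<le> s\<close> \<open>s \<le> t\<close> that]]]] by simp
      have "(\<phi> has_derivative (\<lambda>h. h * f' (p + (s *\<^sub>R u + t *\<^sub>R v)) u - h * f' (p + (s *\<^sub>R u + 0 *\<^sub>R v)) u)) (at s)"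
        unfolding \<phi>_def using has_derivative_diff[OF *[of t] *[of 0]] L[of t] L[of 0] t
        by (simp only: less_imp_le order_refl simp_thms)
      then show ?thesis
        unfolding has_field_derivative_def
        by (rule has_derivative_eq_rhs) (simp add: fun_eq_iff algebra_simps)
    qed
    from MVT2[OF t(1) this] obtain z where z: "0 < z" "z < t"
      "\<phi> t - \<phi> 0 = t * (f' (p + (z *\<^sub>R u + t *\<^sub>R v)) u - f' (p + (z *\<^sub>R u + 0 *\<^sub>R v)) u)"
      by (auto simp del: scaleR_zero_left)
    \<comment> \<open>\<open>a\<close> is the error of the linear approximation of the derivative in
      direction \<open>u\<close>. In the difference of the two edges the contributions of
      \<open>z\<close> cancel and exactly \<open>t * f2 v\<close> remains.\<close>
    define a where "a w = f' (p + (z *\<^sub>R u + w *\<^sub>R v)) u - f' p u - f2 (z *\<^sub>R u + w *\<^sub>R v)" for w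
    have a: "\<bar>a w\<bar> \<le> e' * (t * (norm u + norm v))" if "0 \<le> w" "w \<le> t" for w
    proof -
      have "\<bar>a w\<bar> \<le> e' * norm (z *\<^sub>R u + w *\<^sub>R v)"
        using d(2)[of "p + (z *\<^sub>R u + w *\<^sub>R v)"] near[of z w] z that tK by (simp add: a_def)
      also have "\<dots> \<le> e' * (t * (norm u + norm v))"
        using near[of z w] z that \<open>e' > 0\<close> by (intro mult_left_mono) auto
      finally show ?thesis .
    qed
    have "\<phi> t - \<phi> 0 = t * (a t - a 0 + t * f2 v)"
      unfolding z(3) a_def using linear_add[OF lin] linear_scale[OF lin] by (simp add: algebra_simps)
    then have "(\<phi> t - \<phi> 0) / t^2 = (a t - a 0 + t * f2 v) / t"
      using t by (simp add: power2_eq_square)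
    also have "\<dots> = (a t - a 0) / t + f2 v"
      using t by (simp add: field_simps)
    finally have "(\<phi> t - \<phi> 0) / t^2 - f2 v = (a t - a 0) / t" by simp
    then have "\<bar>(\<phi> t - \<phi> 0) / t^2 - f2 v\<bar> = \<bar>a t - a 0\<bar> / t" using t by simp
    also have "\<dots> \<le> (2 * (e' * (t * (norm u + norm v)))) / t"
      using a[of t] a[of 0] t by (intro divide_right_mono) auto
    also have "\<dots> = 2 * e' * (norm u + norm v)" using t by simp
    also have "\<dots> < 2 * e' * K" using \<open>e' > 0\<close> K(1)
      by (intro mult_strict_left_mono) auto
    also have "\<dots> = e" using K by (simp add: e'_def)
    finally have "\<bar>(\<phi> t - \<phi> 0) / t^2 - f2 v\<bar> < e" .
    moreover have "\<phi> t - \<phi> 0 = f (p + t *\<^sub>R u + t *\<^sub>R v) - f (p + t *\<^sub>R u) - f (p + t *\<^sub>R v) + f p"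
      by (simp add: \<phi>_def add.assoc)
    ultimately show ?thesis by simp
  qed
  then show "\<forall>\<^sub>F t in at_right 0. dist ((f (p + t *\<^sub>R u + t *\<^sub>R v) - f (p + t *\<^sub>R u) - f (p + t *\<^sub>R v) + f p) / t^2) (f2 v) < e"
    using \<open>\<delta> > 0\<close> unfolding eventually_at_right_field dist_real_def by blast
qed

lemma symmetric_second_derivative:
  fixes f :: "'e::real_normed_vector \<Rightarrow> 'f::euclidean_space"
  assumes "C2_on S f" "p \<in> S"
  shows "frechet_derivative (\<lambda>x. frechet_derivative f (at x) u) (at p) v =
    frechet_derivative (\<lambda>x. frechet_derivative f (at x) v) (at p) u"
proof (rule euclidean_eqI)
  fix b :: 'f assume "b \<in> Basis"
  let ?g = "\<lambda>x. f x \<bullet> b"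
  have d: "(?g has_derivative (\<lambda>v. frechet_derivative f (at x) v \<bullet> b)) (at x)" if "x \<in> S" for x
    by (intro has_derivative_inner_left C2_on_derivative[OF assms(1) that])
  have d2: "((\<lambda>x. frechet_derivative f (at x) u \<bullet> b) has_derivative
      (\<lambda>v. frechet_derivative (\<lambda>x. frechet_derivative f (at x) u) (at p) v \<bullet> b)) (at p)" for u
    using assms unfolding C2_on_def
    by (intro has_derivative_inner_left) (metis frechet_derivative_works)
  have "((\<lambda>t. (?g (p + t *\<^sub>R u + t *\<^sub>R v) - ?g (p + t *\<^sub>R u) - ?g (p + t *\<^sub>R v) + ?g p) / t^2)
    \<longlongrightarrow> frechet_derivative (\<lambda>x. frechet_derivative f (at x) u) (at p) v \<bullet> b) (at_right 0)" for u v
    by (rule second_difference_limit[OF C2_on_open[OF assms(1)] assms(2) d d2]) auto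
  from this[of u v] this[of v u]
  show "frechet_derivative (\<lambda>x. frechet_derivative f (at x) u) (at p) v \<bullet> b =
    frechet_derivative (\<lambda>x. frechet_derivative f (at x) v) (at p) u \<bullet> b"
    by (intro tendsto_unique[OF trivial_limit_at_right_real]) (simp_all add: algebra_simps)
qed

section \<open>Maps tangent to the identity at a fixed point\<close>

lemma C2_on_near_id_lipschitz:
  fixes F :: "'e::euclidean_space \<Rightarrow> 'e"
  assumes "C2_on U F" "p \<in> U" "\<And>v. frechet_derivative F (at p) v = v" "\<epsilon> > 0"
  obtains r where "r > 0" "ball p r \<subseteq> U"
    "\<And>a b. a \<in> ball p r \<Longrightarrow> b \<in> ball p r \<Longrightarrow> norm ((F a - a) - (F b - b)) \<le> \<epsilon> * norm (a - b)"
proof -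
  \<comment> \<open>The derivative of \<open>F - id\<close> vanishes at \<open>p\<close>, so near
    \<open>p\<close> it sends every basis vector to a vector shorter than \<open>\<delta>\<close>.
    Summation over the basis gives operator norm at most \<open>\<epsilon>\<close>, and the mean
    value inequality on the convex ball gives the Lipschitz bound.\<close>
  define \<delta> where "\<delta> = \<epsilon> / DIM('e)"
  have "\<delta> > 0" using assms(4) by (simp add: \<delta>_def)
  have "\<forall>\<^sub>F q in nhds p. norm (frechet_derivative F (at q) b - b) < \<delta>" for b
  proof -
    have "isCont (\<lambda>q. frechet_derivative F (at q) b) p"
      using C2_on_continuous_derivative[OF assms(1)] C2_on_open[OF assms(1)] assms(2)
        continuous_on_eq_continuous_at by blast
    then have "((\<lambda>q. frechet_derivative F (at q) b) \<longlongrightarrow> b) (nhds p)"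
      using assms(3) by (metis tendsto_at_iff_tendsto_nhds isCont_def)
    then show ?thesis
      using \<open>\<delta> > 0\<close> unfolding tendsto_iff dist_norm by blast
  qed
  then have "\<forall>\<^sub>F q in nhds p. \<forall>b\<in>Basis. norm (frechet_derivative F (at q) b - b) < \<delta>"
    by (simp add: eventually_ball_finite_distrib)
  moreover have "\<forall>\<^sub>F q in nhds p. q \<in> U"
    using C2_on_open[OF assms(1)] assms(2) by (rule eventually_nhds_in_open)
  ultimately have "\<forall>\<^sub>F q in nhds p. q \<in> U \<and> (\<forall>b\<in>Basis. norm (frechet_derivative F (at q) b - b) < \<delta>)"
    by eventually_elim auto
  then obtain r where r: "r > 0" "\<And>q. dist q p < r \<Longrightarrow> q \<in> U \<and> (\<forall>b\<in>Basis. norm (frechet_derivative F (at q) b - b) < \<delta>)"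
    unfolding eventually_nhds_metric by blast
  have bd: "norm (frechet_derivative F (at q) v - v) \<le> \<epsilon> * norm v" if q: "q \<in> ball p r" for q v
  proof -
    have lin: "linear (\<lambda>v. frechet_derivative F (at q) v - v)"
      using C2_on_linear[OF assms(1)] r(2)[of q] q by (auto simp: dist_commute intro!: linear_compose_sub linear_ident)
    have "norm (frechet_derivative F (at q) v - v) =
        norm (\<Sum>b\<in>Basis. (v \<bullet> b) *\<^sub>R (frechet_derivative F (at q) b - b))"
      using linear_eq_sum_Basis[OF lin, of v] by simp
    also have "\<dots> \<le> (\<Sum>b\<in>(Basis::'e set). norm v * \<delta>)"
      using r(2)[of q] q by (intro sum_norm_le)
        (auto simp: dist_commute Basis_le_norm less_imp_le intro!: mult_mono)
    also have "\<dots> = \<epsilon> * norm v" by (simp add: \<delta>_def)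
    finally show ?thesis .
  qed
  have "norm ((F a - a) - (F b - b)) \<le> \<epsilon> * norm (a - b)" if "a \<in> ball p r" "b \<in> ball p r" for a b
  proof (rule differentiable_bound[of "ball p r" "\<lambda>x. F x - x" "\<lambda>q v. frechet_derivative F (at q) v - v"])
    fix q assume q: "q \<in> ball p r"
    then have "q \<in> U" using r(2)[of q] by (simp add: dist_commute)
    then show "((\<lambda>x. F x - x) has_derivative (\<lambda>v. frechet_derivative F (at q) v - v)) (at q within ball p r)"
      using C2_on_derivative[OF assms(1)]
      by (auto intro!: has_derivative_diff has_derivative_ident intro: has_derivative_at_withinI)
    show "onorm (\<lambda>v. frechet_derivative F (at q) v - v) \<le> \<epsilon>"
      using bd[OF q] by (rule onorm_bound[OF less_imp_le[OF assms(4)]])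
  qed (use that in auto)
  then show thesis
    using that[of r] r by (auto simp: subset_iff dist_commute)
qed

text \<open>With \<open>d i = F\<^sup>i\<^sup>+\<^sup>1 q - F\<^sup>i q\<close>, a Lipschitz constant \<open>\<epsilon>\<close> of \<open>F - id\<close> keeps every \<open>d i\<close> close to
  \<open>d 0\<close>, whereas the sum of the \<open>d i\<close> telescopes to \<open>0\<close>.\<close>

lemma finite_order_germ_eq_id:
  fixes F :: "'e::euclidean_space \<Rightarrow> 'e"
  assumes "C2_on U F" "p \<in> U" "F p = p" "\<And>v. frechet_derivative F (at p) v = v"
    and n: "n > 0" "\<forall>\<^sub>F q in nhds p. (F ^^ n) q = q"
  shows "\<forall>\<^sub>F q in nhds p. F q = q"
proof -
  \<comment> \<open>Since \<open>\<epsilon> \<le> 1\<close>, each application of \<open>F\<close> at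
    most doubles an increment, and the deviation from \<open>d 0\<close> after \<open>i\<close>
    steps is at most \<open>\<epsilon> * 2 ^ i\<close> times its length. The constant makes this at
    most one half for all \<open>i \<le> n\<close>.\<close>
  define \<epsilon> :: real where "\<epsilon> = 1 / 2 ^ Suc n"
  have eps: "\<epsilon> > 0" "\<epsilon> * 2 ^ n = 1 / 2" by (auto simp: \<epsilon>_def)
  have eps1: "\<epsilon> \<le> 1" using one_le_power[of "2::real" "Suc n"] by (simp add: \<epsilon>_def del: power_Suc)
  obtain r where r: "r > 0" "ball p r \<subseteq> U" and lip:
    "\<And>a b. a \<in> ball p r \<Longrightarrow> b \<in> ball p r \<Longrightarrow> norm ((F a - a) - (F b - b)) \<le> \<epsilon> * norm (a - b)"
    using C2_on_near_id_lipschitz[OF assms(1,2,4) eps(1)] by blast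
  have lim: "filterlim F (nhds p) (nhds p)"
    using C2_on_continuous[OF assms(1)] C2_on_open[OF assms(1)] assms(2,3)
    by (metis continuous_on_eq_continuous_at isCont_def tendsto_at_iff_tendsto_nhds)
  have "filterlim (F ^^ i) (nhds p) (nhds p)" for i
  proof (induction i)
    case 0
    then show ?case by (simp add: filterlim_ident id_def)
  next
    case (Suc i)
    then show ?case using filterlim_compose[OF lim Suc] by (simp add: o_def)
  qed
  then have "\<forall>\<^sub>F q in nhds p. (F ^^ i) q \<in> ball p r" for i
    using topological_tendstoD[of "F ^^ i" p "nhds p" "ball p r"] r(1) by simp
  then have "\<forall>\<^sub>F q in nhds p. \<forall>i\<in>{..n}. (F ^^ i) q \<in> ball p r"
    by (simp add: eventually_ball_finite_distrib)
  with n(2) show ?thesis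
  proof eventually_elim
    case (elim q)
    define d where "d i = (F ^^ Suc i) q - (F ^^ i) q" for i
    have step: "norm (d (Suc i) - d i) \<le> \<epsilon> * norm (d i)" if "Suc i \<le> n" for i
    proof -
      have "(F ^^ Suc i) q \<in> ball p r" "(F ^^ i) q \<in> ball p r" using elim(2) that by (blast intro: Suc_leD)+
      from lip[OF this] show ?thesis by (simp add: d_def)
    qed
    have *: "norm (d i) \<le> 2 ^ i * norm (d 0) \<and> norm (d i - d 0) \<le> \<epsilon> * 2 ^ i * norm (d 0)" if "i \<le> n" for i
      using that
    proof (induction i)
      case 0
      then show ?case using eps by simp
    next
      case (Suc i)
      then have IH: "norm (d i) \<le> 2 ^ i * norm (d 0)" "norm (d i - d 0) \<le> \<epsilon> * 2 ^ i * norm (d 0)" by auto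
      have 1: "norm (d (Suc i) - d i) \<le> \<epsilon> * (2 ^ i * norm (d 0))"
        using step[OF Suc.prems] mult_left_mono[OF IH(1) less_imp_le[OF eps(1)]] by (rule order_trans)
      have "\<epsilon> * (2 ^ i * norm (d 0)) \<le> 1 * (2 ^ i * norm (d 0))"
        using eps1 by (intro mult_right_mono) auto
      then have "norm (d (Suc i)) \<le> 2 ^ Suc i * norm (d 0)"
        using norm_triangle_ineq2[of "d (Suc i)" "d i"] 1 IH(1)
        by (simp only: power_Suc mult.assoc)
      moreover have "norm (d (Suc i) - d 0) \<le> \<epsilon> * 2 ^ Suc i * norm (d 0)"
        using norm_triangle_ineq[of "d (Suc i) - d i" "d i - d 0"] 1 IH(2) by (simp add: algebra_simps)
      ultimately show ?case by blast
    qed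
    have "(\<Sum>i<n. d i) = 0"
      unfolding d_def using elim(1) sum_lessThan_telescope[of "\<lambda>i. (F ^^ i) q" n] by simp
    \<comment> \<open>The increments add up to zero, yet each lies within half the length of
      \<open>d 0\<close> from \<open>d 0\<close>. Hence \<open>n\<close> times that length is at
      most half of itself, and \<open>d 0\<close> vanishes.\<close>
    then have "real n *\<^sub>R d 0 = - (\<Sum>i<n. d i - d 0)"
      by (simp add: sum_subtractf sum_constant_scaleR)
    then have "real n * norm (d 0) = norm (\<Sum>i<n. d i - d 0)"
      by (metis norm_minus_cancel norm_scaleR abs_of_nat)
    also have "\<dots> \<le> (\<Sum>i<n. 1 / 2 * norm (d 0))"
    proof (rule sum_norm_le)
      fix i assume i: "i \<in> {..<n}"
      then have "\<epsilon> * 2 ^ i \<le> \<epsilon> * 2 ^ n" using eps by (intro mult_left_mono power_increasing) auto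
      then have "\<epsilon> * 2 ^ i * norm (d 0) \<le> 1 / 2 * norm (d 0)" unfolding eps by (rule mult_right_mono) simp
      then show "norm (d i - d 0) \<le> 1 / 2 * norm (d 0)" using *[of i] i by auto
    qed
    also have "\<dots> = real n * norm (d 0) / 2" by simp
    finally have "norm (d 0) = 0" using n(1) by simp
    then show ?case by (simp add: d_def)
  qed
qed


section \<open>Linear maps of a plane and one-forms\<close>

text \<open>The coefficient form excludes \<open>u = v\<close>, which
  \<open>independent {u, v}\<close> would admit, and it is the coordinate version of the condition
  in \<open>preserves_orientation\<close>.\<close>

definition lin_indep2 :: "'e::real_vector \<Rightarrow> 'e \<Rightarrow> bool" where
  "lin_indep2 u v \<longleftrightarrow> (\<forall>a b. a *\<^sub>R u + b *\<^sub>R v = 0 \<longrightarrow> a = 0 \<and> b = 0)"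

lemma lin_indep2_iff: "lin_indep2 u v \<longleftrightarrow> u \<noteq> v \<and> independent {u, v}"
proof
  assume *: "lin_indep2 u v"
  have "u \<noteq> v"
  proof
    assume "u = v"
    then have "1 *\<^sub>R u + (-1) *\<^sub>R v = 0" by simp
    then show False using * unfolding lin_indep2_def by fastforce
  qed
  moreover have "independent {u, v}"
  proof (rule independent_if_scalars_zero)
    fix f x assume f: "(\<Sum>x\<in>{u, v}. f x *\<^sub>R x) = 0" "x \<in> {u, v}"
    then have "f u *\<^sub>R u + f v *\<^sub>R v = 0" using \<open>u \<noteq> v\<close> by simp
    then show "f x = 0" using * f(2) unfolding lin_indep2_def by blast
  qed simp
  ultimately show "u \<noteq> v \<and> independent {u, v}" by blast
next
  assume *: "u \<noteq> v \<and> independent {u, v}"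
  show "lin_indep2 u v"
    unfolding lin_indep2_def
  proof (intro allI impI)
    fix a b assume "a *\<^sub>R u + b *\<^sub>R v = 0"
    then have "(\<Sum>x\<in>{u, v}. (if x = u then a else b) *\<^sub>R x) = 0" using * by auto
    then show "a = 0 \<and> b = 0"
      using * independentD[of "{u, v}" "{u, v}" "\<lambda>x. if x = u then a else b"] by (metis finite.emptyI finite_insert insertCI order_refl)
  qed
qed

lemma in_span_pair: "x \<in> span {u, v} \<longleftrightarrow> (\<exists>a b. x = a *\<^sub>R u + b *\<^sub>R v)"
  by (auto simp: span_insert algebra_simps)

lemma lin_indep2_span:
  fixes P :: "'e::euclidean_space set"
  assumes "subspace P" "dim P = 2" "u \<in> P" "v \<in> P" "lin_indep2 u v"
  shows "P = span {u, v}"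
proof -
  have "u \<noteq> v" "independent {u, v}" using assms(5) by (auto simp: lin_indep2_iff)
  then have "P \<subseteq> span {u, v}"
    using assms by (intro card_ge_dim_independent) auto
  moreover have "span {u, v} \<subseteq> P" using assms by (intro span_minimal) auto
  ultimately show ?thesis by blast
qed

lemma lin_indep2_coords:
  fixes P :: "'e::euclidean_space set"
  assumes "subspace P" "dim P = 2" "u \<in> P" "v \<in> P" "lin_indep2 u v" "w \<in> P"
  obtains a b where "w = a *\<^sub>R u + b *\<^sub>R v"
  using lin_indep2_span[OF assms(1-5)] assms(6) in_span_pair by blast

lemma span_pair_lin_indep2:
  assumes "dim (span {u, v} :: 'e::euclidean_space set) = 2"
  shows "lin_indep2 u v"
proof -
  have d: "dim {u, v} = 2" using assms by simp
  have "u \<noteq> v"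
  proof
    assume "u = v"
    then have "dim {u, v} \<le> card {u}" using dim_le_card[of "{u, v}" "{u}"] by (simp add: span_superset)
    then show False using d by simp
  qed
  moreover have "independent {u, v}"
    using d \<open>u \<noteq> v\<close> by (intro card_le_dim_spanning[of _ "{u,v}"]) (auto simp: span_superset)
  ultimately show ?thesis by (simp add: lin_indep2_iff)
qed

lemma extend_lin_indep2:
  fixes P :: "'e::euclidean_space set"
  assumes "subspace P" "dim P = 2" "u \<in> P" "u \<noteq> 0"
  obtains v where "v \<in> P" "lin_indep2 u v"
proof -
  have "\<not> P \<subseteq> span {u}"
  proof
    assume "P \<subseteq> span {u}"
    then have "dim P \<le> card {u}" by (rule dim_le_card) simp
    then show False using assms by simp
  qed
  then obtain v where v: "v \<in> P" "v \<notin> span {u}" by blast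
  have "lin_indep2 u v"
    unfolding lin_indep2_def
  proof (intro allI impI)
    fix a b assume eq: "a *\<^sub>R u + b *\<^sub>R v = 0"
    have "b = 0"
    proof (rule ccontr)
      assume "b \<noteq> 0"
      have "b *\<^sub>R v = (- a) *\<^sub>R u" using eq by (simp add: add_eq_0_iff)
      then have "v = (- a / b) *\<^sub>R u"
        using \<open>b \<noteq> 0\<close> by (metis divide_inverse_commute left_inverse scaleR_one scaleR_scaleR)
      then show False using v(2) by (metis span_base span_scale singletonI)
    qed
    then show "a = 0 \<and> b = 0" using eq assms(4) by simp
  qed
  then show thesis using that v(1) by blast
qed

lemma linear_lin_comb: "linear B \<Longrightarrow> B (a *\<^sub>R u + b *\<^sub>R v) = a *\<^sub>R B u + b *\<^sub>R B v"
  by (simp add: linear_add linear_scale)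

lemma lin_indep2_eq_iff:
  assumes "lin_indep2 u v"
  shows "a *\<^sub>R u + b *\<^sub>R v = c *\<^sub>R u + d *\<^sub>R v \<longleftrightarrow> a = c \<and> b = d"
proof
  assume "a *\<^sub>R u + b *\<^sub>R v = c *\<^sub>R u + d *\<^sub>R v"
  then have "(a - c) *\<^sub>R u + (b - d) *\<^sub>R v = 0" by (simp add: algebra_simps)
  then show "a = c \<and> b = d" using assms unfolding lin_indep2_def by fastforce
qed simp

text \<open>The hypothesis \<open>root\<close> is the characteristic equation of the matrix of
  \<open>B\<close>; an eigenvector is read off from one of its coefficient equations.\<close>

lemma eigenvector_2x2:
  assumes "linear B" "lin_indep2 u v" "B u = a *\<^sub>R u + b *\<^sub>R v" "B v = c *\<^sub>R u + d *\<^sub>R v"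
    and root: "(a - \<mu>) * (d - \<mu>) = b * c"
  obtains x y where "x *\<^sub>R u + y *\<^sub>R v \<noteq> 0" "B (x *\<^sub>R u + y *\<^sub>R v) = \<mu> *\<^sub>R (x *\<^sub>R u + y *\<^sub>R v)"
proof -
  note obt = that
  have *: "thesis" if "x * a + y * c = \<mu> * x" "x * b + y * d = \<mu> * y" "x \<noteq> 0 \<or> y \<noteq> 0" for x y
  proof (rule obt)
    show "x *\<^sub>R u + y *\<^sub>R v \<noteq> 0" using that(3) assms(2) unfolding lin_indep2_def by blast
    have "B (x *\<^sub>R u + y *\<^sub>R v) = (x * a + y * c) *\<^sub>R u + (x * b + y * d) *\<^sub>R v"
      using assms(1,3,4) by (simp add: linear_lin_comb algebra_simps)
    then show "B (x *\<^sub>R u + y *\<^sub>R v) = \<mu> *\<^sub>R (x *\<^sub>R u + y *\<^sub>R v)"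
      by (simp add: that(1,2) scaleR_add_right)
  qed
  \<comment> \<open>The pair \<open>(c, \<mu> - a)\<close> solves the first equation identically and
    the second by \<open>root\<close>. If it vanishes, \<open>(\<mu> - d, b)\<close> is tried; if
    \<open>b\<close> and \<open>c\<close> both vanish and \<open>\<mu> = a\<close>, then
    \<open>u\<close> itself is an eigenvector.\<close>
  consider "c \<noteq> 0 \<or> \<mu> \<noteq> a" | "c = 0" "\<mu> = a" "b \<noteq> 0 \<or> \<mu> \<noteq> d" | "c = 0" "\<mu> = a" "b = 0" by blast
  then show thesis
  proof cases
    case 1
    then show ?thesis using root by (intro *[of c "\<mu> - a"]) (auto simp: algebra_simps)
  next
    case 2
    then show ?thesis using root by (intro *[of "\<mu> - d" b]) (auto simp: algebra_simps)
  next
    case 3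
    then show ?thesis by (intro *[of 1 0]) auto
  qed
qed

text \<open>A zero determinant would produce a kernel vector. A negative determinant is the product
  of two real eigenvalues of opposite sign, one of which would be positive.\<close>

lemma orientation_preserving_if_no_positive_eigenvalue:
  fixes P :: "'e::euclidean_space set"
  assumes "linear B" "subspace P" "dim P = 2" and inv: "\<And>w. w \<in> P \<Longrightarrow> B w \<in> P"
    and inj: "\<And>w. w \<in> P \<Longrightarrow> B w = 0 \<Longrightarrow> w = 0"
    and no_eig: "\<And>w \<mu>. w \<in> P \<Longrightarrow> \<mu> > 0 \<Longrightarrow> B w = \<mu> *\<^sub>R w \<Longrightarrow> w = 0"
    and uv: "u \<in> P" "v \<in> P" "lin_indep2 u v"
  shows "\<exists>a b c d. B u = a *\<^sub>R u + b *\<^sub>R v \<and> B v = c *\<^sub>R u + d *\<^sub>R v \<and> a * d - b * c > 0"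
proof -
  obtain a b where ab: "B u = a *\<^sub>R u + b *\<^sub>R v" using lin_indep2_coords[OF assms(2,3) uv inv[OF uv(1)]] .
  obtain c d where cd: "B v = c *\<^sub>R u + d *\<^sub>R v" using lin_indep2_coords[OF assms(2,3) uv inv[OF uv(2)]] .
  have inP: "x *\<^sub>R u + y *\<^sub>R v \<in> P" for x y using assms(2) uv by (simp add: subspace_add subspace_scale)
  have "a * d - b * c > 0"
  proof (rule ccontr)
    assume "\<not> a * d - b * c > 0"
    then consider "a * d - b * c = 0" | "a * d - b * c < 0" by linarith
    then show False
    proof cases
      case 1
      then obtain x y where "x *\<^sub>R u + y *\<^sub>R v \<noteq> 0" "B (x *\<^sub>R u + y *\<^sub>R v) = 0 *\<^sub>R (x *\<^sub>R u + y *\<^sub>R v)"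
        by (auto intro: eigenvector_2x2[OF assms(1) uv(3) ab cd, of 0])
      then show False using inj[OF inP] by simp
    next
      case 2
      obtain e where e: "a * d - b * c = e" "e < 0" using 2 by blast
      \<comment> \<open>\<open>D\<close> is the root of the discriminant. As the determinant
        \<open>e\<close> is negative, \<open>D\<close> exceeds the absolute value of the trace, so
        the larger eigenvalue \<open>\<mu>\<close> is positive.\<close>
      define D where "D = sqrt ((a + d)^2 - 4 * e)"
      define \<mu> where "\<mu> = (a + d + D) / 2"
      have D2: "D^2 = (a + d)^2 - 4 * (a * d - b * c)"
        unfolding D_def e using e(2) zero_le_power2[of "a + d"] by (intro real_sqrt_pow2) linarith
      have "\<bar>a + d\<bar> < D"
        unfolding D_def using e(2) by (intro real_less_rsqrt) simp
      then have "\<mu> > 0" by (simp add: \<mu>_def)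
      have "4 * ((a - \<mu>) * (d - \<mu>)) = D^2 - (a + d)^2 + 4 * (a * d)"
        by (simp add: \<mu>_def power2_eq_square field_simps)
      then have "(a - \<mu>) * (d - \<mu>) = b * c" using D2 by simp
      then obtain x y where "x *\<^sub>R u + y *\<^sub>R v \<noteq> 0" "B (x *\<^sub>R u + y *\<^sub>R v) = \<mu> *\<^sub>R (x *\<^sub>R u + y *\<^sub>R v)"
        by (rule eigenvector_2x2[OF assms(1) uv(3) ab cd])
      then show False using no_eig[OF inP \<open>\<mu> > 0\<close>] by blast
    qed
  qed
  then show ?thesis using ab cd by blast
qed

text \<open>For any nonzero \<open>u\<close> the vector \<open>u + B u\<close> is fixed; if it
  happens to vanish, \<open>u\<close> is sent to its negative.\<close>

lemma involution_has_eigenvector: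
  fixes P :: "'e::euclidean_space set"
  assumes "linear B" "subspace P" "dim P = 2" "\<And>w. w \<in> P \<Longrightarrow> B w \<in> P" "\<And>w. w \<in> P \<Longrightarrow> B (B w) = w"
  obtains w where "w \<in> P" "w \<noteq> 0" "B w = w \<or> B w = - w"
proof -
  obtain u where u: "u \<in> P" "u \<noteq> 0"
    using assms(3) dim_eq_0[of P] by (metis subsetI singletonI zero_neq_numeral)
  show thesis
  proof (cases "u + B u = 0")
    case True
    then show ?thesis using that[of u] u by (simp add: add_eq_0_iff)
  next
    case False
    moreover have "u + B u \<in> P" using u assms by (simp add: subspace_add)
    ultimately show ?thesis
      using that[of "u + B u"] assms(1,5) u by (simp add: linear_add add.commute)
  qed
qed

lemma funpow_eigenvector:
  assumes "linear B" "B u = \<mu> *\<^sub>R u"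
  shows "(B ^^ n) u = \<mu> ^ n *\<^sub>R u"
  by (induction n) (simp_all add: assms linear_scale)

lemma funpow_shear:
  assumes "linear B" "B u = u" "B w = w + u"
  shows "(B ^^ n) w = w + real n *\<^sub>R u"
  by (induction n) (simp_all add: assms linear_add linear_scale algebra_simps)

text \<open>The displacement \<open>B w - w\<close> is itself fixed, so iteration adds it once per
  step; returning after \<open>n\<close> steps forces it to be zero.\<close>

lemma finite_order_unipotent:
  assumes "linear B" "B (B w - w) = B w - w" "n > 0" "(B ^^ n) w = w"
  shows "B w = w"
proof -
  have "(B ^^ n) w = w + real n *\<^sub>R (B w - w)"
    using assms by (intro funpow_shear) auto
  then show ?thesis using assms by simp
qed

text \<open>The eigenvalue is a real root of unity, and the assumption on sign or parity leaves only
  1. In a basis starting with \<open>u\<close> the map is triangular with second diagonal entry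
  \<open>d\<close>; positivity of the determinant makes \<open>d\<close> positive, finite order
  makes it 1, and a shear of finite order is trivial.\<close>

lemma finite_order_eigenvector_imp_id:
  fixes P :: "'e::euclidean_space set"
  assumes "linear B" "subspace P" "dim P = 2"
    and pos: "\<And>u v. u \<in> P \<Longrightarrow> v \<in> P \<Longrightarrow> lin_indep2 u v \<Longrightarrow>
      \<exists>a b c d. B u = a *\<^sub>R u + b *\<^sub>R v \<and> B v = c *\<^sub>R u + d *\<^sub>R v \<and> a * d - b * c > 0"
    and u: "u \<in> P" "u \<noteq> 0" "B u = \<mu> *\<^sub>R u" and n: "n > 0" "\<mu> > 0 \<or> odd n"
    and ord: "\<And>w. w \<in> P \<Longrightarrow> (B ^^ n) w = w"
    and w: "w \<in> P"
  shows "B w = w"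
proof -
  have "\<mu> ^ n *\<^sub>R u = 1 *\<^sub>R u"
    using funpow_eigenvector[OF assms(1) u(3)] ord[OF u(1)] by simp
  then have \<mu>n: "\<mu> ^ n = 1" using u(2) scaleR_cancel_right[of "\<mu> ^ n" u 1] by blast
  \<comment> \<open>For odd \<open>n\<close> a positive power has a positive base; this is where odd
    order rules out the eigenvalue -1.\<close>
  then have "\<mu> > 0" using n zero_less_power_eq[of \<mu> n] by auto
  then have "\<mu> = 1" using \<mu>n n(1) power_eq_imp_eq_base[of \<mu> n 1] by simp
  then have Bu: "B u = u" using u(3) by simp
  obtain v where v: "v \<in> P" "lin_indep2 u v" using extend_lin_indep2[OF assms(2,3) u(1,2)] .
  obtain a b c d where abcd: "B u = a *\<^sub>R u + b *\<^sub>R v" "B v = c *\<^sub>R u + d *\<^sub>R v" "a * d - b * c > 0"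
    using pos[OF u(1) v] by blast
  have "1 *\<^sub>R u + 0 *\<^sub>R v = a *\<^sub>R u + b *\<^sub>R v" using abcd(1) Bu by simp
  then have "1 = a \<and> 0 = b" by (simp only: lin_indep2_eq_iff[OF v(2)])
  then have "a = 1" "b = 0" by auto
  then have "d > 0" using abcd by simp
  have "\<exists>c'. (B ^^ k) v = c' *\<^sub>R u + d ^ k *\<^sub>R v" for k
  proof (induction k)
    case 0
    then show ?case by (intro exI[of _ 0]) simp
  next
    case (Suc k)
    then obtain c' where "(B ^^ k) v = c' *\<^sub>R u + d ^ k *\<^sub>R v" by blast
    then have "(B ^^ Suc k) v = c' *\<^sub>R B u + d ^ k *\<^sub>R B v"
      using assms(1) by (simp add: linear_lin_comb)
    also have "\<dots> = (c' + d ^ k * c) *\<^sub>R u + d ^ Suc k *\<^sub>R v"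
      unfolding Bu abcd(2) by (simp add: algebra_simps)
    finally show ?case by blast
  qed
  then obtain c' where "(B ^^ n) v = c' *\<^sub>R u + d ^ n *\<^sub>R v" by blast
  then have "c' *\<^sub>R u + d ^ n *\<^sub>R v = 0 *\<^sub>R u + 1 *\<^sub>R v" using ord[OF v(1)] by simp
  then have "d ^ n = 1" by (simp only: lin_indep2_eq_iff[OF v(2)])
  then have "d = 1" using \<open>d > 0\<close> n(1) power_eq_imp_eq_base[of d n 1] by simp
  then have "B v - v = c *\<^sub>R u" using abcd(2) by simp
  then have "B v = v"
    using assms(1) Bu n ord[OF v(1)] by (intro finite_order_unipotent[of B v n]) (auto simp: linear_scale)
  moreover obtain x y where "w = x *\<^sub>R u + y *\<^sub>R v" using lin_indep2_coords[OF assms(2,3) u(1) v w] .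
  ultimately show ?thesis using Bu linear_lin_comb[OF assms(1)] by simp
qed

text \<open>With \<open>z\<close> normalised by \<open>a z = 1\<close>, a skew form vanishing on the
  kernel of \<open>a\<close> is the wedge of the one-form \<open>\<beta> _ z\<close> with
  \<open>a\<close>. Its wedge with \<open>a\<close> therefore contains \<open>a\<close>
  twice.\<close>

lemma wedge12_eq_0:
  assumes a: "linear a" and b1: "\<And>w. linear (\<lambda>u. \<beta> u w)" and anti: "\<And>u v. \<beta> u v = - \<beta> v u"
    and ker: "\<And>u v. a u = 0 \<Longrightarrow> a v = 0 \<Longrightarrow> \<beta> u v = 0"
  shows "wedge12 a \<beta> u v w = 0"
proof (cases "\<forall>x. a x = 0")
  case True
  then show ?thesis by (simp add: wedge12_def)
next
  case False
  then obtain x where x: "a x \<noteq> 0" by blast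
  define z where "z = x /\<^sub>R a x"
  have z: "a z = 1" using x a by (simp add: z_def linear_scale)
  have zz: "\<beta> z z = 0" using anti[of z z] by simp
  have formula: "\<beta> u v = a v * \<beta> u z - a u * \<beta> v z" for u v
  proof -
    have zero: "\<beta> (u - a u *\<^sub>R z) (v - a v *\<^sub>R z) = 0"
      using a z by (intro ker) (simp_all add: linear_diff linear_scale)
    have "\<beta> (u - a u *\<^sub>R z) w = \<beta> u w - a u * \<beta> z w" for u w
      using linear_diff[OF b1[of w], of u "a u *\<^sub>R z"] linear_scale[OF b1[of w], of "a u" z] by simp
    note l = this
    have r: "\<beta> w (v - a v *\<^sub>R z) = \<beta> w v - a v * \<beta> w z" for w
      using l[of v w] anti[of w "v - a v *\<^sub>R z"] anti[of w v] anti[of w z] by simp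
    have "\<beta> (u - a u *\<^sub>R z) (v - a v *\<^sub>R z) = \<beta> u v - a v * \<beta> u z - a u * (\<beta> z v - a v * \<beta> z z)"
      unfolding l[of u] r by (simp add: algebra_simps)
    then show ?thesis using zero zz anti[of z v] by simp
  qed
  show ?thesis
    unfolding wedge12_def formula[of u v] formula[of u w] formula[of v w] by (simp add: algebra_simps)
qed

section \<open>One-forms in coordinates and their pull-back by a map with a fixed point\<close>

lemma one_form_on_differentiable:
  assumes "one_form_on V \<alpha>" "q \<in> V"
  shows "(\<lambda>q. \<alpha> q x) differentiable (at q)"
proof -
  have "Ck_on (Suc 0) (\<lambda>q. \<alpha> q x) V" using assms(1) unfolding one_form_on_def smooth_on_def by blast
  then show ?thesis using assms(2) by simp
qed

lemma one_form_on_linear: "one_form_on V \<alpha> \<Longrightarrow> q \<in> V \<Longrightarrow> linear (\<alpha> q)"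
  by (simp add: one_form_on_def)

lemma linear_one_form_derivative:
  assumes "one_form_on V \<alpha>" "open V" "p \<in> V"
  shows "linear (\<lambda>x. frechet_derivative (\<lambda>q. \<alpha> q x) (at p) h)"
proof (rule linearI)
  note d = one_form_on_differentiable[OF assms(1,3), unfolded frechet_derivative_works]
  fix x y
  have "((\<lambda>q. \<alpha> q (x + y)) has_derivative
      (\<lambda>h. frechet_derivative (\<lambda>q. \<alpha> q x) (at p) h + frechet_derivative (\<lambda>q. \<alpha> q y) (at p) h)) (at p)"
    by (rule has_derivative_transform_within_open[OF has_derivative_add[OF d[of x] d[of y]] assms(2,3)])
      (simp add: linear_add[OF one_form_on_linear[OF assms(1)]])
  from frechet_derivative_at[OF this]
  show "frechet_derivative (\<lambda>q. \<alpha> q (x + y)) (at p) h =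
      frechet_derivative (\<lambda>q. \<alpha> q x) (at p) h + frechet_derivative (\<lambda>q. \<alpha> q y) (at p) h"
    by (metis (no_types, lifting))
next
  note d = one_form_on_differentiable[OF assms(1,3), unfolded frechet_derivative_works]
  fix r x
  have "((\<lambda>q. \<alpha> q (r *\<^sub>R x)) has_derivative (\<lambda>h. r *\<^sub>R frechet_derivative (\<lambda>q. \<alpha> q x) (at p) h)) (at p)"
    by (rule has_derivative_transform_within_open[OF has_derivative_scaleR_right[OF d[of x], of r] assms(2,3)])
      (simp add: linear_scale[OF one_form_on_linear[OF assms(1)]])
  from frechet_derivative_at[OF this]
  show "frechet_derivative (\<lambda>q. \<alpha> q (r *\<^sub>R x)) (at p) h = r *\<^sub>R frechet_derivative (\<lambda>q. \<alpha> q x) (at p) h"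
    by (metis (no_types, lifting))
qed

lemma ext_deriv_linear:
  assumes "one_form_on V \<alpha>" "open V" "p \<in> V"
  shows "linear (\<lambda>u. ext_deriv \<alpha> p u w)"
  unfolding ext_deriv_def
  using linear_frechet_derivative[OF one_form_on_differentiable[OF assms(1,3)]]
    linear_one_form_derivative[OF assms] by (rule linear_compose_sub)

text \<open>Product rule for a form whose base point and argument both move: the first term
  differentiates the coefficients of the form along \<open>F\<close>, the second differentiates the
  derivative of \<open>F\<close>. The second term is symmetric in \<open>x\<close> and
  \<open>h\<close> and will cancel under antisymmetrisation.\<close>

lemma pullback_form_derivative:
  fixes F :: "'e::euclidean_space \<Rightarrow> 'e"
  assumes form: "one_form_on V \<alpha>" "open V" "p \<in> V"
    and F: "C2_on U F" "p \<in> U" "F p = p"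
  shows "((\<lambda>q. \<alpha> (F q) (frechet_derivative F (at q) x)) has_derivative
    (\<lambda>h. frechet_derivative (\<lambda>q. \<alpha> q (frechet_derivative F (at p) x)) (at p) (frechet_derivative F (at p) h)
      + \<alpha> p (frechet_derivative (\<lambda>q. frechet_derivative F (at q) x) (at p) h))) (at p)"
proof -
  define W where "W = U \<inter> F -` V"
  have W: "open W" "p \<in> W"
    using continuous_open_preimage[OF C2_on_continuous[OF F(1)] C2_on_open[OF F(1)] form(2)] F form
    by (auto simp: W_def)
  let ?A = "frechet_derivative F (at p)" and ?D2 = "frechet_derivative (\<lambda>q. frechet_derivative F (at q) x) (at p)"
  let ?D = "\<lambda>x. frechet_derivative (\<lambda>q. \<alpha> q x) (at p)"
  have dF: "(F has_derivative ?A) (at p)" by (rule C2_on_derivative[OF F(1,2)])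
  have dDF: "((\<lambda>q. frechet_derivative F (at q) x) has_derivative ?D2) (at p)"
    using F(1,2) unfolding C2_on_def by (simp add: frechet_derivative_works)
  have da: "((\<lambda>q. \<alpha> (F q) b) has_derivative (\<lambda>h. ?D b (?A h))) (at p)" for b
  proof -
    have "((\<lambda>q. \<alpha> q b) has_derivative ?D b) (at (F p))"
      using one_form_on_differentiable[OF form(1,3)] F(3) by (simp add: frechet_derivative_works)
    then show ?thesis using has_derivative_compose[OF dF] by blast
  qed
  have *: "((\<lambda>q. \<Sum>b\<in>Basis. (frechet_derivative F (at q) x \<bullet> b) * \<alpha> (F q) b) has_derivative
      (\<lambda>h. \<Sum>b\<in>Basis. (?A x \<bullet> b) * ?D b (?A h) + (?D2 h \<bullet> b) * \<alpha> (F p) b)) (at p)"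
    by (intro has_derivative_sum has_derivative_mult has_derivative_inner_left dDF da)
  have "((\<lambda>q. \<alpha> (F q) (frechet_derivative F (at q) x)) has_derivative
      (\<lambda>h. \<Sum>b\<in>Basis. (?A x \<bullet> b) * ?D b (?A h) + (?D2 h \<bullet> b) * \<alpha> (F p) b)) (at p)"
  proof (rule has_derivative_transform_within_open[OF * W])
    fix q assume "q \<in> W"
    then have "linear (\<alpha> (F q))" using one_form_on_linear[OF form(1)] by (simp add: W_def)
    from linear_eq_sum_Basis[OF this, of "frechet_derivative F (at q) x"]
    show "(\<Sum>b\<in>Basis. (frechet_derivative F (at q) x \<bullet> b) * \<alpha> (F q) b) = \<alpha> (F q) (frechet_derivative F (at q) x)"
      by simp
  qed
  moreover have "(\<Sum>b\<in>Basis. (?A x \<bullet> b) * ?D b (?A h) + (?D2 h \<bullet> b) * \<alpha> (F p) b) = ?D (?A x) (?A h) + \<alpha> p (?D2 h)" for h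
    using linear_eq_sum_Basis[OF linear_one_form_derivative[OF form, of "?A h"], of "?A x"]
      linear_eq_sum_Basis[OF one_form_on_linear[OF form(1,3)], of "?D2 h"] F(3)
    by (simp add: sum.distrib)
  ultimately show ?thesis by simp
qed

text \<open>A map with \<open>F\<^sup>* \<alpha> = g \<alpha>\<close> satisfies \<open>F\<^sup>* d\<alpha> = g d\<alpha>\<close> on the kernel of \<open>\<alpha>\<close>. If the derivative of \<open>F\<close> at
  the fixed point \<open>p\<close> is the identity on the kernel and \<open>d\<alpha>\<close> does not vanish there, then \<open>g p = 1\<close>.\<close>

lemma contact_multiplier_eq_1:
  fixes F :: "'e::euclidean_space \<Rightarrow> 'e"
  assumes form: "one_form_on V \<alpha>" "open V" "p \<in> V"
    and F: "C2_on U F" "p \<in> U" "F p = p"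
    and pres: "\<forall>\<^sub>F q in nhds p. \<forall>v. \<alpha> q v = 0 \<longrightarrow> \<alpha> (F q) (frechet_derivative F (at q) v) = 0"
    and id_ker: "\<And>v. \<alpha> p v = 0 \<Longrightarrow> frechet_derivative F (at p) v = v"
    and uv: "\<alpha> p u = 0" "\<alpha> p v = 0" "ext_deriv \<alpha> p u v \<noteq> 0"
    and w: "\<alpha> p w \<noteq> 0"
  shows "\<alpha> p (frechet_derivative F (at p) w) = \<alpha> p w"
proof -
  define L where "L x q = \<alpha> (F q) (frechet_derivative F (at q) x)" for x q
  let ?A = "frechet_derivative F (at p)" and ?D = "\<lambda>x. frechet_derivative (\<lambda>q. \<alpha> q x) (at p)"
  define D2 where "D2 x h = frechet_derivative (\<lambda>q. frechet_derivative F (at q) x) (at p) h" for x h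
  \<comment> \<open>The multiplier of the form is the function \<open>L w q / \<alpha> q w\<close>,
    with \<open>w\<close> any vector transverse to the kernel; \<open>m\<close> is its value at the
    fixed point.\<close>
  define m where "m = L w p / \<alpha> p w"
  have dL: "(L x has_derivative (\<lambda>h. ?D (?A x) (?A h) + \<alpha> p (D2 x h))) (at p)" for x
    unfolding L_def D2_def by (rule pullback_form_derivative[OF form F])
  have da: "((\<lambda>q. \<alpha> q x) has_derivative ?D x) (at p)" for x
    using one_form_on_differentiable[OF form(1,3)] by (simp add: frechet_derivative_works)
  have near: "\<forall>\<^sub>F q in nhds p. q \<in> V" using form by (intro eventually_nhds_in_open)
  have "isCont (\<lambda>q. \<alpha> q w) p"
    using da has_derivative_continuous by blast
  then have "((\<lambda>q. \<alpha> q w) \<longlongrightarrow> \<alpha> p w) (nhds p)"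
    unfolding isCont_def using tendsto_at_iff_tendsto_nhds[of "\<lambda>q. \<alpha> q w" p] by blast
  then have ev: "\<forall>\<^sub>F q in nhds p. \<alpha> q w \<noteq> 0"
    using w tendsto_imp_eventually_ne by blast
  have Leq: "\<forall>\<^sub>F q in nhds p. L w q / \<alpha> q w * \<alpha> q x = L x q" for x
  proof -
    have "(F \<longlongrightarrow> p) (nhds p)"
      using C2_on_continuous[OF F(1)] C2_on_open[OF F(1)] F(2,3)
      by (metis continuous_on_eq_continuous_at isCont_def tendsto_at_iff_tendsto_nhds)
    then have "\<forall>\<^sub>F q in nhds p. F q \<in> V" using topological_tendstoD form(2,3) by blast
    with ev near pres eventually_nhds_in_open[OF C2_on_open[OF F(1)] F(2)]
    show ?thesis
    proof eventually_elim
      \<comment> \<open>Subtracting a multiple of \<open>w\<close> moves \<open>x\<close> into the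
        kernel of \<open>\<alpha> q\<close>, which is preserved. So the same quotient is the
        multiplier on every vector.\<close>
      case (elim q)
      have lin: "linear (\<alpha> q)" "linear (\<alpha> (F q))" "linear (frechet_derivative F (at q))"
        using one_form_on_linear[OF form(1)] C2_on_linear[OF F(1)] elim by auto
      have "\<alpha> q (x - (\<alpha> q x / \<alpha> q w) *\<^sub>R w) = 0"
        using lin elim(1) by (simp add: linear_diff linear_scale)
      then have "\<alpha> (F q) (frechet_derivative F (at q) (x - (\<alpha> q x / \<alpha> q w) *\<^sub>R w)) = 0"
        using elim(3) by blast
      then have "L x q - \<alpha> q x / \<alpha> q w * L w q = 0"
        using lin by (simp add: L_def linear_diff linear_scale)
      then show ?case by (simp add: mult.commute)
    qed
  qed
  \<comment> \<open>The identity between \<open>L x\<close> and the multiplier times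
    \<open>\<alpha> q x\<close> is differentiated at \<open>p\<close> in direction \<open>y\<close>.
    The derivative \<open>G\<close> of the multiplier drops out because it is multiplied by
    \<open>\<alpha> p x = 0\<close>.\<close>
  have key: "?D x y + \<alpha> p (D2 x y) = m * ?D x y" if xy: "\<alpha> p x = 0" "\<alpha> p y = 0" for x y
  proof -
    obtain G where dG: "((\<lambda>q. L w q / \<alpha> q w) has_derivative G) (at p)"
      using has_derivative_divide[OF dL da w] by blast
    have 1: "((\<lambda>q. L w q / \<alpha> q w * \<alpha> q x) has_derivative (\<lambda>h. L w p / \<alpha> p w * ?D x h + G h * \<alpha> p x)) (at p)"
      by (rule has_derivative_mult[OF dG da])
    obtain S where S: "open S" "p \<in> S" "\<And>q. q \<in> S \<Longrightarrow> L w q / \<alpha> q w * \<alpha> q x = L x q"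
      using Leq[of x] unfolding eventually_nhds by blast
    have "(L x has_derivative (\<lambda>h. L w p / \<alpha> p w * ?D x h + G h * \<alpha> p x)) (at p)"
      by (rule has_derivative_transform_within_open[OF 1 S(1,2)]) (rule S(3))
    from has_derivative_unique[OF this dL]
    have "m * ?D x y = ?D (?A x) (?A y) + \<alpha> p (D2 x y)"
      using xy by (simp add: m_def fun_eq_iff)
    then show ?thesis using id_ker xy by simp
  qed
  \<comment> \<open>Exchanging \<open>u\<close> and \<open>v\<close> in \<open>key\<close> and
    subtracting removes the second derivatives of \<open>F\<close> and leaves \<open>m - 1\<close>
    times the exterior derivative, which is nonzero on this pair.\<close>
  have "D2 u v = D2 v u"
    unfolding D2_def by (rule symmetric_second_derivative[OF F(1,2)])
  then have "(m - 1) * ext_deriv \<alpha> p u v = 0"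
    using key[OF uv(1,2)] key[OF uv(2,1)] by (simp add: ext_deriv_def algebra_simps)
  then have "m = 1" using uv(3) by simp
  then show ?thesis using w F(3) by (simp add: m_def L_def)
qed

text \<open>The contact condition in the form needed for the multiplier: if the exterior derivative
  vanished on the kernel, its wedge with the form would vanish by
  \<open>wedge12_eq_0\<close>.\<close>

lemma exists_nonzero_ext_deriv:
  assumes form: "one_form_on V \<alpha>" "open V" "p \<in> V"
    and "wedge12 (\<alpha> p) (ext_deriv \<alpha> p) x y z \<noteq> 0"
  obtains u v where "\<alpha> p u = 0" "\<alpha> p v = 0" "ext_deriv \<alpha> p u v \<noteq> 0"
proof -
  have "\<exists>u v. \<alpha> p u = 0 \<and> \<alpha> p v = 0 \<and> ext_deriv \<alpha> p u v \<noteq> 0"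
  proof (rule ccontr)
    assume "\<not> ?thesis"
    then have "wedge12 (\<alpha> p) (ext_deriv \<alpha> p) x y z = 0"
      by (intro wedge12_eq_0 one_form_on_linear[OF form(1,3)] ext_deriv_linear[OF form])
        (auto simp: ext_deriv_def)
    then show False using assms(4) by simp
  qed
  then show thesis using that by blast
qed


section \<open>Manifolds, tangent vectors and differentials\<close>

text \<open>Injectivity of the charts makes images commute with intersections. It is all that is
  assumed, so that the topology is available also for the prolongation and for the fibre product of
  composable pairs, which are not treated as instances of \<open>manifold\<close>.\<close>

lemma istopology_charts:
  assumes "\<And>c. c \<in> C \<Longrightarrow> inj_on (snd c) (fst c)"
  shows "istopology (\<lambda>W. W \<subseteq> P \<and> (\<forall>c\<in>C. open (snd c ` (W \<inter> fst c))))"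
  unfolding istopology_def
proof (intro conjI allI impI ballI)
  fix S T assume S: "S \<subseteq> P \<and> (\<forall>c\<in>C. open (snd c ` (S \<inter> fst c)))"
    and T: "T \<subseteq> P \<and> (\<forall>c\<in>C. open (snd c ` (T \<inter> fst c)))"
  show "S \<inter> T \<subseteq> P" using S by blast
  fix c assume "c \<in> C"
  have "snd c ` (S \<inter> T \<inter> fst c) = snd c ` (S \<inter> fst c) \<inter> snd c ` (T \<inter> fst c)"
    using inj_on_image_Int[OF assms[OF \<open>c \<in> C\<close>], of "S \<inter> fst c" "T \<inter> fst c"]
    by (simp add: Int_ac)
  then show "open (snd c ` (S \<inter> T \<inter> fst c))" using S T \<open>c \<in> C\<close> by auto
next
  fix K assume K: "\<forall>S\<in>K. S \<subseteq> P \<and> (\<forall>c\<in>C. open (snd c ` (S \<inter> fst c)))"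
  show "\<Union> K \<subseteq> P" using K by blast
  fix c assume "c \<in> C"
  have "snd c ` (\<Union> K \<inter> fst c) = (\<Union>S\<in>K. snd c ` (S \<inter> fst c))" by blast
  then show "open (snd c ` (\<Union> K \<inter> fst c))" using K \<open>c \<in> C\<close> by auto
qed

lemma openin_mtop:
  assumes "\<And>c. c \<in> charts M \<Longrightarrow> inj_on (snd c) (fst c)"
  shows "openin (mtop M) W \<longleftrightarrow> W \<subseteq> points M \<and> (\<forall>c\<in>charts M. open (snd c ` (W \<inter> fst c)))"
  unfolding mtop_def using topology_inverse'[OF istopology_charts[of "charts M" "points M"]] assms by simp

lemma chart_inv_chart: "inj_on (snd c) (fst c) \<Longrightarrow> x \<in> fst c \<Longrightarrow> chart_inv c (snd c x) = x"
  by (simp add: chart_inv_def)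

lemma chart_inv_in: "q \<in> snd c ` fst c \<Longrightarrow> chart_inv c q \<in> fst c"
  unfolding chart_inv_def by (rule inv_into_into)

lemma chart_chart_inv: "q \<in> snd c ` fst c \<Longrightarrow> snd c (chart_inv c q) = q"
  unfolding chart_inv_def by (rule f_inv_into_f)

lemma differentiable_cong_nhds:
  assumes "\<forall>\<^sub>F y in nhds x. f y = g y" "f differentiable (at x)"
  shows "g differentiable (at x)" "frechet_derivative g (at x) = frechet_derivative f (at x)"
proof -
  obtain S where S: "open S" "x \<in> S" "\<And>y. y \<in> S \<Longrightarrow> f y = g y"
    using assms(1) unfolding eventually_nhds by blast
  show "g differentiable (at x)"
    by (rule differentiable_transform_open[OF assms(2) S(1,2)]) (rule S(3))
  show "frechet_derivative g (at x) = frechet_derivative f (at x)"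
    by (rule frechet_derivative_transform_within_open[OF assms(2) S(1,2), symmetric]) (rule S(3))
qed

lemma isCont_tendsto_nhds: "isCont f x \<Longrightarrow> (f \<longlongrightarrow> f x) (nhds x)"
  unfolding isCont_def using tendsto_at_iff_tendsto_nhds[of f x] by blast

section \<open>Charts, topology and tangent spaces of a manifold\<close>

context
  fixes M :: "('a, 'e::euclidean_space) mfd"
  assumes M: "manifold M"
begin

lemma chart_inj: "c \<in> charts M \<Longrightarrow> inj_on (snd c) (fst c)"
  using M unfolding manifold_def by blast

lemma open_chart_image: "c \<in> charts M \<Longrightarrow> open (snd c ` fst c)"
  using M unfolding manifold_def by blast

lemma chart_dom_subset: "c \<in> charts M \<Longrightarrow> fst c \<subseteq> points M"
  using M unfolding manifold_def by blast

lemma manifold_Hausdorff: "Hausdorff_space (mtop M)"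
  using M unfolding manifold_def by blast

lemma charts_at_D: "c \<in> charts_at M x \<Longrightarrow> c \<in> charts M \<and> x \<in> fst c \<and> x \<in> points M"
  using chart_dom_subset unfolding charts_at_def by blast

lemma charts_at_ex: "x \<in> points M \<Longrightarrow> \<exists>c. c \<in> charts_at M x"
  using M unfolding manifold_def charts_at_def by blast

lemma manifold_openin:
  "openin (mtop M) W \<longleftrightarrow> W \<subseteq> points M \<and> (\<forall>c\<in>charts M. open (snd c ` (W \<inter> fst c)))"
  by (rule openin_mtop) (rule chart_inj)

lemma manifold_topspace [simp]: "topspace (mtop M) = points M"
proof -
  have "openin (mtop M) (points M)"
    unfolding manifold_openin using open_chart_image chart_dom_subset by (simp add: Int_absorb1)
  moreover have "topspace (mtop M) \<subseteq> points M"
    using openin_topspace[of "mtop M"] unfolding manifold_openin by blast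
  ultimately show ?thesis using openin_subset by blast
qed

lemma open_overlap:
  assumes "c \<in> charts M" "d \<in> charts M"
  shows "open (snd c ` (fst c \<inter> fst d))"
  using M assms unfolding manifold_def by blast

lemma smooth_transition:
  assumes "c \<in> charts M" "d \<in> charts M"
  shows "smooth_on (snd c ` (fst c \<inter> fst d)) (snd d \<circ> chart_inv c)"
  using M assms unfolding manifold_def by blast

lemma C2_on_transition:
  assumes "c \<in> charts M" "d \<in> charts M"
  shows "C2_on (snd c ` (fst c \<inter> fst d)) (snd d \<circ> chart_inv c)"
  using smooth_on_imp_C2_on open_overlap smooth_transition assms by blast

lemma transition_differentiable:
  assumes "c \<in> charts_at M x" "d \<in> charts_at M x"
  shows "(snd d \<circ> chart_inv c) differentiable (at (snd c x))"
  using C2_on_transition[of c d] assms unfolding C2_on_def charts_at_def by blast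

lemma openin_chart_dom: "c \<in> charts M \<Longrightarrow> openin (mtop M) (fst c)"
  unfolding manifold_openin using chart_dom_subset open_overlap by (simp add: Int_commute)

lemma openin_chart_preimage:
  assumes c: "c \<in> charts M" and Q: "open Q"
  shows "openin (mtop M) (fst c \<inter> snd c -` Q)"
  unfolding manifold_openin
proof (intro conjI ballI)
  show "fst c \<inter> snd c -` Q \<subseteq> points M" using chart_dom_subset[OF c] by blast
  fix d assume d: "d \<in> charts M"
  have "snd d ` (fst c \<inter> snd c -` Q \<inter> fst d) =
      snd d ` (fst d \<inter> fst c) \<inter> (snd c \<circ> chart_inv d) -` Q"
    using chart_inv_chart[OF chart_inj[OF d]] by (auto simp: image_iff)
  moreover have "open (snd d ` (fst d \<inter> fst c) \<inter> (snd c \<circ> chart_inv d) -` Q)"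
    using smooth_on_continuous[OF smooth_transition[OF d c]] open_overlap[OF d c] Q
    by (rule continuous_open_preimage)
  ultimately show "open (snd d ` (fst c \<inter> snd c -` Q \<inter> fst d))" by simp
qed

lemma continuous_map_chart:
  assumes "c \<in> charts M"
  shows "continuous_map (subtopology (mtop M) (fst c)) euclidean (snd c)"
  unfolding continuous_map_def
proof (intro conjI allI impI)
  fix Q :: "'e set" assume "openin euclidean Q"
  then have "openin (mtop M) (fst c \<inter> snd c -` Q)" using openin_chart_preimage[OF assms] by simp
  moreover have "{x \<in> topspace (subtopology (mtop M) (fst c)). snd c x \<in> Q} = (fst c \<inter> snd c -` Q) \<inter> fst c"
    using chart_dom_subset[OF assms] by auto
  ultimately show "openin (subtopology (mtop M) (fst c)) {x \<in> topspace (subtopology (mtop M) (fst c)). snd c x \<in> Q}"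
    unfolding openin_subtopology by blast
qed simp

lemma open_chart_image_of:
  assumes "c \<in> charts M" "openin (mtop M) W"
  shows "open (snd c ` (fst c \<inter> W))"
  using assms unfolding manifold_openin by (simp add: Int_commute)

lemma continuous_map_chart_inv:
  assumes c: "c \<in> charts M"
  shows "continuous_map (top_of_set (snd c ` fst c)) (mtop M) (chart_inv c)"
  unfolding continuous_map_def
proof (intro conjI allI impI)
  show "chart_inv c \<in> topspace (top_of_set (snd c ` fst c)) \<rightarrow> topspace (mtop M)"
  proof (rule Pi_I)
    fix q assume "q \<in> topspace (top_of_set (snd c ` fst c))"
    then have "chart_inv c q \<in> fst c" using chart_inv_in[of q c] by simp
    then show "chart_inv c q \<in> topspace (mtop M)" using chart_dom_subset[OF c] by auto
  qed
  fix W assume W: "openin (mtop M) W"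
  have "{q \<in> topspace (top_of_set (snd c ` fst c)). chart_inv c q \<in> W} = snd c ` (fst c \<inter> W)"
    using chart_inv_chart[OF chart_inj[OF c]] chart_chart_inv[of _ c] chart_inv_in[of _ c]
    by (auto simp: image_iff)
  then show "openin (top_of_set (snd c ` fst c)) {q \<in> topspace (top_of_set (snd c ` fst c)). chart_inv c q \<in> W}"
    using open_chart_image_of[OF c W] open_chart_image[OF c] by (simp add: openin_open_eq image_mono)
qed

text \<open>\<open>chart_inv c\<close> has arbitrary values off the image of the chart, so
  coordinate identities are stated only near a coordinate point. This lemma supplies the
  neighbourhoods.\<close>

lemma eventually_chart_inv:
  assumes "c \<in> charts_at M x" "openin (mtop M) W" "x \<in> W"
  shows "\<forall>\<^sub>F q in nhds (snd c x). q \<in> snd c ` fst c \<and> chart_inv c q \<in> W"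
proof -
  have c: "c \<in> charts M" "x \<in> fst c" using charts_at_D assms(1) by blast+
  have "\<forall>\<^sub>F q in nhds (snd c x). q \<in> snd c ` (fst c \<inter> W)"
    using open_chart_image_of[OF c(1) assms(2)] c(2) assms(3) by (intro eventually_nhds_in_open) auto
  then show ?thesis
    by (rule eventually_mono) (use chart_inv_chart[OF chart_inj[OF c(1)]] in auto)
qed

lemma eventually_chart_overlap:
  assumes "c \<in> charts_at M x" "d \<in> charts_at M x"
  shows "\<forall>\<^sub>F q in nhds (snd c x). q \<in> snd c ` fst c \<and> chart_inv c q \<in> fst d"
  using eventually_chart_inv[OF assms(1) openin_chart_dom] assms charts_at_D by blast

lemma tangent_space_transition:
  assumes "v \<in> tangent_space M x" "c \<in> charts_at M x" "d \<in> charts_at M x"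
  shows "v d = frechet_derivative (snd d \<circ> chart_inv c) (at (snd c x)) (v c)"
  using assms unfolding tangent_space_def by blast

lemma tangent_space_eqI:
  assumes "v \<in> tangent_space M x" "w \<in> tangent_space M x" "c \<in> charts_at M x" "v c = w c"
  shows "v = w"
proof
  fix d show "v d = w d"
  proof (cases "d \<in> charts_at M x")
    case True
    then show ?thesis using tangent_space_transition assms by metis
  next
    case False
    then have "v d = 0" "w d = 0" using assms(1,2) unfolding tangent_space_def by blast+
    then show ?thesis by simp
  qed
qed

lemma tangent_space_lin_comb:
  assumes "v \<in> tangent_space M x" "w \<in> tangent_space M x"
  shows "tv_add (tv_scale a v) (tv_scale b w) \<in> tangent_space M x"
  unfolding tangent_space_def mem_Collect_eq
proof (intro conjI ballI allI impI)
  fix c d assume cd: "c \<in> charts_at M x" "d \<in> charts_at M x"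
  let ?L = "frechet_derivative (snd d \<circ> chart_inv c) (at (snd c x))"
  have "linear ?L" using transition_differentiable[OF cd] by (rule linear_frechet_derivative)
  from linear_lin_comb[OF this, of a "v c" b "w c"]
  show "tv_add (tv_scale a v) (tv_scale b w) d = ?L (tv_add (tv_scale a v) (tv_scale b w) c)"
    using tangent_space_transition[OF assms(1) cd] tangent_space_transition[OF assms(2) cd]
    by (simp add: tv_add_def tv_scale_def)
next
  fix c assume "c \<notin> charts_at M x"
  then have "v c = 0" "w c = 0" using assms unfolding tangent_space_def by blast+
  then show "tv_add (tv_scale a v) (tv_scale b w) c = 0" by (simp add: tv_add_def tv_scale_def)
qed

lemma tangent_space_scale:
  assumes "v \<in> tangent_space M x"
  shows "tv_scale a v \<in> tangent_space M x"
proof -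
  have "tv_add (tv_scale a v) (tv_scale 0 v) = tv_scale a v"
    by (simp add: tv_add_def tv_scale_def)
  then show ?thesis using tangent_space_lin_comb[OF assms assms, of a 0] by simp
qed

lemma tv_zero_in_tangent_space: "tv_zero \<in> tangent_space M x"
proof -
  have "linear (frechet_derivative (snd d \<circ> chart_inv c) (at (snd c x)))"
    if "c \<in> charts_at M x" "d \<in> charts_at M x" for c d
    using transition_differentiable[OF that] by (rule linear_frechet_derivative)
  then show ?thesis unfolding tangent_space_def tv_zero_def by (simp add: linear_0)
qed

end

lemma tv_orbit_eq_image: "tv_orbit T v = (\<lambda>a. tv_scale a v) ` T"
  unfolding tv_orbit_def by blast

text \<open>A pointwise notion, tested in a single pair of charts. Unlike \<open>smooth_map\<close>
  it also covers \<open>germ_map G W\<close>, which is meaningful only near the source of an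
  arrow.\<close>

definition diff_at ::
  "('a, 'e::euclidean_space) mfd \<Rightarrow> ('b, 'f::euclidean_space) mfd \<Rightarrow> ('a \<Rightarrow> 'b) \<Rightarrow> 'a \<Rightarrow> bool" where
  "diff_at M N f x \<longleftrightarrow>
     (\<exists>c\<in>charts_at M x. \<exists>d\<in>charts_at N (f x).
        (\<forall>\<^sub>F q in nhds (snd c x). f (chart_inv c q) \<in> fst d) \<and>
        (snd d \<circ> f \<circ> chart_inv c) differentiable (at (snd c x)))"

text \<open>Chain rule with the coordinate change. The condition that \<open>f\<close> maps nearby
  points into \<open>D\<close> is carried along, since otherwise the coordinate expression would mix
  in values outside the target chart.\<close>

lemma rep_change_source:
  assumes M: "manifold M" and c: "c \<in> charts_at M x" "c' \<in> charts_at M x"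
    and ev: "\<forall>\<^sub>F q in nhds (snd c x). f (chart_inv c q) \<in> D"
    and d: "(snd d \<circ> f \<circ> chart_inv c) differentiable (at (snd c x))"
  shows "\<forall>\<^sub>F q in nhds (snd c' x). f (chart_inv c' q) \<in> D"
    and "(snd d \<circ> f \<circ> chart_inv c') differentiable (at (snd c' x))"
    and "frechet_derivative (snd d \<circ> f \<circ> chart_inv c') (at (snd c' x)) u =
      frechet_derivative (snd d \<circ> f \<circ> chart_inv c) (at (snd c x))
        (frechet_derivative (snd c \<circ> chart_inv c') (at (snd c' x)) u)"
proof -
  let ?t = "snd c \<circ> chart_inv c'"
  have C: "c \<in> charts M" "c' \<in> charts M" "x \<in> fst c" "x \<in> fst c'" using c charts_at_D[OF M] by blast+
  have dt: "?t differentiable (at (snd c' x))" by (rule transition_differentiable[OF M c(2,1)])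
  have tx: "?t (snd c' x) = snd c x" using chart_inv_chart[OF chart_inj[OF M C(2)] C(4)] by simp
  have ov: "\<forall>\<^sub>F q in nhds (snd c' x). chart_inv c (?t q) = chart_inv c' q"
    using eventually_chart_overlap[OF M c(2,1)]
    by (rule eventually_mono) (simp add: chart_inv_chart[OF chart_inj[OF M C(1)]])
  have lim: "filterlim ?t (nhds (snd c x)) (nhds (snd c' x))"
    using isCont_tendsto_nhds[OF differentiable_imp_continuous_within[OF dt]] tx by simp
  have "\<forall>\<^sub>F q in nhds (snd c' x). f (chart_inv c (?t q)) \<in> D"
    using eventually_compose_filterlim[OF ev lim] .
  with ov show "\<forall>\<^sub>F q in nhds (snd c' x). f (chart_inv c' q) \<in> D" by eventually_elim simp
  have eq: "\<forall>\<^sub>F q in nhds (snd c' x). ((snd d \<circ> f \<circ> chart_inv c) \<circ> ?t) q = (snd d \<circ> f \<circ> chart_inv c') q"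
    using ov by eventually_elim simp
  have d': "(snd d \<circ> f \<circ> chart_inv c) differentiable (at (?t (snd c' x)))" using d tx by simp
  have dd: "((snd d \<circ> f \<circ> chart_inv c) \<circ> ?t) differentiable (at (snd c' x))"
    using dt d' by (rule differentiable_chain_at)
  show "(snd d \<circ> f \<circ> chart_inv c') differentiable (at (snd c' x))"
    using differentiable_cong_nhds(1)[OF eq dd] .
  show "frechet_derivative (snd d \<circ> f \<circ> chart_inv c') (at (snd c' x)) u =
      frechet_derivative (snd d \<circ> f \<circ> chart_inv c) (at (snd c x))
        (frechet_derivative (snd c \<circ> chart_inv c') (at (snd c' x)) u)"
    unfolding differentiable_cong_nhds(2)[OF eq dd]
      frechet_derivative_comp[OF dt d'] tx ..
qed

lemma rep_change_target:
  assumes M: "manifold M" and N: "manifold N" and c: "c \<in> charts_at M x"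
    and d: "d \<in> charts_at N (f x)" "d' \<in> charts_at N (f x)"
    and ev: "\<forall>\<^sub>F q in nhds (snd c x). f (chart_inv c q) \<in> fst d"
    and df: "(snd d \<circ> f \<circ> chart_inv c) differentiable (at (snd c x))"
  shows "\<forall>\<^sub>F q in nhds (snd c x). f (chart_inv c q) \<in> fst d'"
    and "(snd d' \<circ> f \<circ> chart_inv c) differentiable (at (snd c x))"
    and "frechet_derivative (snd d' \<circ> f \<circ> chart_inv c) (at (snd c x)) u =
      frechet_derivative (snd d' \<circ> chart_inv d) (at (snd d (f x)))
        (frechet_derivative (snd d \<circ> f \<circ> chart_inv c) (at (snd c x)) u)"
proof -
  let ?t = "snd d' \<circ> chart_inv d" and ?f = "snd d \<circ> f \<circ> chart_inv c"
  have C: "c \<in> charts M" "x \<in> fst c" using c charts_at_D[OF M] by blast+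
  have D: "d \<in> charts N" "d' \<in> charts N" "f x \<in> fst d" "f x \<in> fst d'" using d charts_at_D[OF N] by blast+
  have fx: "?f (snd c x) = snd d (f x)" using chart_inv_chart[OF chart_inj[OF M C(1)] C(2)] by simp
  have dt: "?t differentiable (at (?f (snd c x)))" using transition_differentiable[OF N d] fx by simp
  have lim: "filterlim ?f (nhds (snd d (f x))) (nhds (snd c x))"
    using isCont_tendsto_nhds[OF differentiable_imp_continuous_within[OF df]] fx by simp
  have "\<forall>\<^sub>F q in nhds (snd c x). chart_inv d (?f q) \<in> fst d'"
    using eventually_compose_filterlim[OF eventually_chart_overlap[OF N d] lim] by (rule eventually_mono) blast
  with ev show "\<forall>\<^sub>F q in nhds (snd c x). f (chart_inv c q) \<in> fst d'"
    by eventually_elim (simp add: chart_inv_chart[OF chart_inj[OF N D(1)]])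
  have eq: "\<forall>\<^sub>F q in nhds (snd c x). (?t \<circ> ?f) q = (snd d' \<circ> f \<circ> chart_inv c) q"
    using ev by eventually_elim (simp add: chart_inv_chart[OF chart_inj[OF N D(1)]])
  have dd: "(?t \<circ> ?f) differentiable (at (snd c x))"
    using df dt by (rule differentiable_chain_at)
  show "(snd d' \<circ> f \<circ> chart_inv c) differentiable (at (snd c x))"
    using differentiable_cong_nhds(1)[OF eq dd] .
  show "frechet_derivative (snd d' \<circ> f \<circ> chart_inv c) (at (snd c x)) u =
      frechet_derivative (snd d' \<circ> chart_inv d) (at (snd d (f x))) (frechet_derivative ?f (at (snd c x)) u)"
    unfolding differentiable_cong_nhds(2)[OF eq dd]
      frechet_derivative_comp[OF df dt] fx ..
qed

context
  fixes M :: "('a, 'e::euclidean_space) mfd" and N :: "('b, 'f::euclidean_space) mfd"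
    and f :: "'a \<Rightarrow> 'b" and x :: 'a
  assumes M: "manifold M" and N: "manifold N" and f: "diff_at M N f x"
begin

lemma diff_at_rep:
  assumes "c \<in> charts_at M x" "d \<in> charts_at N (f x)"
  shows "\<forall>\<^sub>F q in nhds (snd c x). f (chart_inv c q) \<in> fst d"
    and "(snd d \<circ> f \<circ> chart_inv c) differentiable (at (snd c x))"
proof -
  obtain c0 d0 where *: "c0 \<in> charts_at M x" "d0 \<in> charts_at N (f x)"
    "\<forall>\<^sub>F q in nhds (snd c0 x). f (chart_inv c0 q) \<in> fst d0"
    "(snd d0 \<circ> f \<circ> chart_inv c0) differentiable (at (snd c0 x))"
    using f unfolding diff_at_def by blast
  note s = rep_change_source[OF M *(1) assms(1) *(3,4)]
  note t = rep_change_target[OF M N assms(1) *(2) assms(2) s(1,2)]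
  show "\<forall>\<^sub>F q in nhds (snd c x). f (chart_inv c q) \<in> fst d"
    and "(snd d \<circ> f \<circ> chart_inv c) differentiable (at (snd c x))" using t by blast+
qed

text \<open>Frees \<open>differential\<close> from the chart picked by \<open>SOME\<close>: for
  tangent vectors the coordinate change is absorbed into \<open>v\<close>, so any chart around
  \<open>x\<close> gives the same result.\<close>

lemma differential_eq:
  assumes v: "v \<in> tangent_space M x" and c: "c \<in> charts_at M x" and d: "d \<in> charts_at N (f x)"
  shows "differential M N f x v d = frechet_derivative (snd d \<circ> f \<circ> chart_inv c) (at (snd c x)) (v c)"
proof -
  define c0 where "c0 = (SOME c. c \<in> charts_at M x)"
  have c0: "c0 \<in> charts_at M x" unfolding c0_def using c by (rule someI)
  have "differential M N f x v d = frechet_derivative (snd d \<circ> f \<circ> chart_inv c0) (at (snd c0 x)) (v c0)"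
    unfolding differential_def Let_def c0_def[symmetric] using d by simp
  also have "\<dots> = frechet_derivative (snd d \<circ> f \<circ> chart_inv c) (at (snd c x))
      (frechet_derivative (snd c \<circ> chart_inv c0) (at (snd c0 x)) (v c0))"
    by (rule rep_change_source(3)[OF M c c0 diff_at_rep[OF c d]])
  also have "frechet_derivative (snd c \<circ> chart_inv c0) (at (snd c0 x)) (v c0) = v c"
    by (rule tangent_space_transition[OF M v c0 c, symmetric])
  finally show ?thesis .
qed

lemma differential_in_tangent_space:
  assumes v: "v \<in> tangent_space M x"
  shows "differential M N f x v \<in> tangent_space N (f x)"
proof -
  obtain c where c: "c \<in> charts_at M x" using f unfolding diff_at_def by blast
  have "differential M N f x v d' = frechet_derivative (snd d' \<circ> chart_inv d) (at (snd d (f x))) (differential M N f x v d)"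
    if d: "d \<in> charts_at N (f x)" "d' \<in> charts_at N (f x)" for d d'
    unfolding differential_eq[OF v c d(1)] differential_eq[OF v c d(2)]
    by (rule rep_change_target(3)[OF M N c d diff_at_rep[OF c d(1)]])
  moreover have "differential M N f x v d = 0" if "d \<notin> charts_at N (f x)" for d
    using that unfolding differential_def Let_def by simp
  ultimately show ?thesis unfolding tangent_space_def by blast
qed

lemma differential_scale:
  assumes v: "v \<in> tangent_space M x"
  shows "differential M N f x (tv_scale a v) = tv_scale a (differential M N f x v)"
proof
  fix d
  obtain c where c: "c \<in> charts_at M x" using f unfolding diff_at_def by blast
  show "differential M N f x (tv_scale a v) d = tv_scale a (differential M N f x v) d"
  proof (cases "d \<in> charts_at N (f x)")
    case True
    note d = this
    show ?thesis
      using differential_eq[OF v c d] differential_eq[OF tangent_space_scale[OF M v] c d]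
        linear_scale[OF linear_frechet_derivative[OF diff_at_rep(2)[OF c d]]]
      by (simp add: tv_scale_def)
  next
    case False
    then show ?thesis by (simp add: differential_def Let_def tv_scale_def)
  qed
qed

lemma differential_orbit:
  assumes v: "v \<in> tangent_space M x"
  shows "differential M N f x ` tv_orbit T v = tv_orbit T (differential M N f x v)"
  unfolding tv_orbit_eq_image by (simp add: image_image differential_scale[OF v])

end

section \<open>Smooth maps in coordinates\<close>

lemma smooth_map_continuous: "smooth_map M N f \<Longrightarrow> continuous_map (mtop M) (mtop N) f"
  unfolding smooth_map_def by blast

lemma smooth_map_in_points:
  assumes "manifold M" "manifold N" "smooth_map M N f" "x \<in> points M"
  shows "f x \<in> points N"
proof -
  have "f \<in> points M \<rightarrow> points N"
    using continuous_map_funspace[OF smooth_map_continuous[OF assms(3)]] assms(1,2) by simp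
  then show ?thesis using assms(4) by blast
qed

lemma smooth_map_rep:
  assumes M: "manifold M" and N: "manifold N" and f: "smooth_map M N f"
    and c: "c \<in> charts M" and d: "d \<in> charts N"
  shows "C2_on (snd c ` (fst c \<inter> f -` fst d)) (snd d \<circ> f \<circ> chart_inv c)"
proof (rule smooth_on_imp_C2_on)
  have "openin (mtop M) {x \<in> topspace (mtop M). f x \<in> fst d}"
    using openin_continuous_map_preimage[OF smooth_map_continuous[OF f] openin_chart_dom[OF N d]] .
  from open_chart_image_of[OF M c this]
  have "open (snd c ` (fst c \<inter> {x \<in> points M. f x \<in> fst d}))" using M by simp
  moreover have "fst c \<inter> {x \<in> points M. f x \<in> fst d} = fst c \<inter> f -` fst d"
    using chart_dom_subset[OF M c] by blast
  ultimately show "open (snd c ` (fst c \<inter> f -` fst d))" by simp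
qed (use f c d in \<open>simp add: smooth_map_def\<close>)

lemma smooth_map_diff_at:
  assumes M: "manifold M" and N: "manifold N" and f: "smooth_map M N f" and x: "x \<in> points M"
  shows "diff_at M N f x"
proof -
  obtain c where c: "c \<in> charts_at M x" using charts_at_ex[OF M x] by blast
  obtain d where d: "d \<in> charts_at N (f x)" using charts_at_ex[OF N smooth_map_in_points[OF M N f x]] by blast
  have C: "c \<in> charts M" "x \<in> fst c" "d \<in> charts N" "f x \<in> fst d"
    using c d charts_at_D[OF M] charts_at_D[OF N] by blast+
  let ?S = "snd c ` (fst c \<inter> f -` fst d)"
  have S: "C2_on ?S (snd d \<circ> f \<circ> chart_inv c)" by (rule smooth_map_rep[OF M N f C(1,3)])
  have "snd c x \<in> ?S" using C by blast
  then have "(snd d \<circ> f \<circ> chart_inv c) differentiable (at (snd c x))"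
    using S unfolding C2_on_def by blast
  moreover have "\<forall>\<^sub>F q in nhds (snd c x). f (chart_inv c q) \<in> fst d"
    using eventually_nhds_in_open[OF C2_on_open[OF S] \<open>snd c x \<in> ?S\<close>]
    by (rule eventually_mono) (use chart_inv_chart[OF chart_inj[OF M C(1)]] in auto)
  ultimately show ?thesis unfolding diff_at_def using c d by blast
qed

section \<open>Plane fields in coordinates\<close>

context
  fixes M :: "('a, 'e::euclidean_space) mfd" and \<xi> :: "('a, 'e) distrib"
  assumes M: "manifold M" and \<xi>: "distribution M 2 \<xi>"
begin

lemma distribution_subset: "x \<in> points M \<Longrightarrow> \<xi> x \<subseteq> tangent_space M x"
  using \<xi> unfolding distribution_def by blast

lemma local_frame:
  assumes c: "c \<in> charts M" and p: "p \<in> snd c ` fst c"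
  obtains V X Y where "open V" "p \<in> V" "V \<subseteq> snd c ` fst c" "smooth_on V X" "smooth_on V Y"
    "\<forall>q\<in>V. coord_distrib c \<xi> q = span {X q, Y q} \<and> dim (coord_distrib c \<xi> q) = 2"
proof -
  obtain V X where *: "open V" "p \<in> V" "V \<subseteq> snd c ` fst c" "\<forall>i<2. smooth_on V (X i)"
    "\<forall>q\<in>V. coord_distrib c \<xi> q = span {X i q |i. i < (2::nat)} \<and> dim (coord_distrib c \<xi> q) = 2"
    using \<xi>[unfolded distribution_def, THEN conjunct2, rule_format, OF c p] by blast
  have eq: "{X i q |i. i < (2::nat)} = {X 0 q, X 1 q}" for q
    by (auto simp: less_2_cases_iff)
  have "smooth_on V (X 0)" "smooth_on V (X 1)" using *(4) by simp_all
  then show thesis by (rule that[OF *(1-3) _ _ *(5)[unfolded eq]])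
qed

lemma coord_distrib_chart:
  assumes "c \<in> charts_at M x"
  shows "coord_distrib c \<xi> (snd c x) = (\<lambda>v. v c) ` \<xi> x"
proof -
  have "chart_inv c (snd c x) = x"
    using charts_at_D[OF M assms] chart_inv_chart[OF chart_inj[OF M]] by blast
  then show ?thesis by (simp add: coord_distrib_def)
qed

lemma coord_plane:
  assumes "c \<in> charts_at M x"
  shows "subspace ((\<lambda>v. v c) ` \<xi> x)" "dim ((\<lambda>v. v c) ` \<xi> x) = 2"
proof -
  have c: "c \<in> charts M" "x \<in> fst c" using charts_at_D[OF M assms] by blast+
  obtain V X Y where *: "open V" "snd c x \<in> V" "V \<subseteq> snd c ` fst c" "smooth_on V X" "smooth_on V Y"
    "\<forall>q\<in>V. coord_distrib c \<xi> q = span {X q, Y q} \<and> dim (coord_distrib c \<xi> q) = 2"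
    using local_frame[OF c(1) imageI[OF c(2)]] .
  note plane = bspec[OF *(6) *(2), unfolded coord_distrib_chart[OF assms]]
  show "subspace ((\<lambda>v. v c) ` \<xi> x)" unfolding conjunct1[OF plane] by (rule subspace_span)
  show "dim ((\<lambda>v. v c) ` \<xi> x) = 2" by (rule conjunct2[OF plane])
qed

lemma distribution_inj:
  assumes "c \<in> charts_at M x" "v \<in> \<xi> x" "w \<in> \<xi> x" "v c = w c"
  shows "v = w"
proof (rule tangent_space_eqI[OF M _ _ assms(1)])
  have "x \<in> points M" using charts_at_D[OF M assms(1)] by blast
  then show "v \<in> tangent_space M x" "w \<in> tangent_space M x" using distribution_subset assms by blast+
qed (rule assms(4))

text \<open>A tangent vector is determined by its coordinates in one chart around its base point, so
  membership in the plane can be tested in one chart.\<close>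

lemma distribution_memI:
  assumes c: "c \<in> charts_at M x" and v: "v \<in> tangent_space M x" "v c \<in> (\<lambda>v. v c) ` \<xi> x"
  shows "v \<in> \<xi> x"
proof -
  obtain w where w: "w \<in> \<xi> x" "v c = w c" using v(2) by blast
  have "x \<in> points M" using charts_at_D[OF M c] by blast
  then have "w \<in> tangent_space M x" using distribution_subset w(1) by blast
  then have "v = w" using v(1) c w(2) by (intro tangent_space_eqI[OF M])
  then show ?thesis using w(1) by simp
qed

lemma distribution_lin_comb:
  assumes x: "x \<in> points M" and "v \<in> \<xi> x" "w \<in> \<xi> x"
  shows "tv_add (tv_scale a v) (tv_scale b w) \<in> \<xi> x"
proof -
  obtain c where c: "c \<in> charts_at M x" using charts_at_ex[OF M x] by blast
  have "tv_add (tv_scale a v) (tv_scale b w) c \<in> (\<lambda>v. v c) ` \<xi> x"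
    unfolding tv_add_def tv_scale_def using coord_plane(1)[OF c] assms
    by (intro subspace_add subspace_scale) auto
  moreover have "tv_add (tv_scale a v) (tv_scale b w) \<in> tangent_space M x"
    using distribution_subset[OF x] assms(2,3) by (intro tangent_space_lin_comb[OF M]) blast+
  ultimately show ?thesis by (intro distribution_memI[OF c])
qed

lemma distribution_scale:
  assumes x: "x \<in> points M" and "v \<in> \<xi> x"
  shows "tv_scale a v \<in> \<xi> x"
proof -
  have "tv_add (tv_scale a v) (tv_scale 0 v) = tv_scale a v"
    by (simp add: tv_add_def tv_scale_def)
  then show ?thesis using distribution_lin_comb[OF assms assms(2), of a 0] by simp
qed

lemma distribution_eq_zero_iff:
  assumes "c \<in> charts_at M x" "v \<in> \<xi> x"
  shows "v = tv_zero \<longleftrightarrow> v c = 0"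
proof
  assume "v c = 0"
  have "x \<in> points M" using charts_at_D[OF M assms(1)] by blast
  then have "v \<in> tangent_space M x" using distribution_subset assms(2) by blast
  moreover have "v c = tv_zero c" using \<open>v c = 0\<close> by (simp add: tv_zero_def)
  ultimately show "v = tv_zero"
    using assms(1) tv_zero_in_tangent_space[OF M] by (intro tangent_space_eqI[OF M])
qed (simp add: tv_zero_def)

lemma distribution_nonzero:
  assumes "x \<in> points M"
  obtains v where "v \<in> \<xi> x" "v \<noteq> tv_zero"
proof -
  obtain c where c: "c \<in> charts_at M x" using charts_at_ex[OF M assms] by blast
  have "\<not> (\<lambda>v. v c) ` \<xi> x \<subseteq> {0}"
    using coord_plane(2)[OF c] dim_eq_0[of "(\<lambda>v. v c) ` \<xi> x"] by simp
  then show thesis using distribution_eq_zero_iff[OF c] that by blast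
qed

end


section \<open>Topology of the prolongation\<close>

lemma tv_scale_1 [simp]: "tv_scale 1 v = v"
  by (simp add: tv_scale_def)

lemma tv_scale_scale: "tv_scale a (tv_scale b v) = tv_scale (a * b) v"
  by (simp add: tv_scale_def)

lemma tv_scale_eq_zero_iff: "tv_scale a v = tv_zero \<longleftrightarrow> a = 0 \<or> v = tv_zero"
  by (auto simp: tv_scale_def tv_zero_def fun_eq_iff)

text \<open>What both cases share: all positive reals are admissible, and the nonzero admissible
  scalars form a group under multiplication.\<close>

definition line_or_ray_scalars :: "real set \<Rightarrow> bool" where
  "line_or_ray_scalars T \<longleftrightarrow> T = UNIV \<or> T = {0<..}"

lemma line_or_ray_scalars_pos: "line_or_ray_scalars T \<Longrightarrow> a > 0 \<Longrightarrow> a \<in> T"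
  by (auto simp: line_or_ray_scalars_def)

lemma tv_orbit_self: "line_or_ray_scalars T \<Longrightarrow> v \<in> tv_orbit T v"
  using line_or_ray_scalars_pos[of T 1] unfolding tv_orbit_def by force

text \<open>Rescaling permutes the orbit by the group of nonzero admissible scalars. The condition
  \<open>a \<noteq> 0\<close> matters for lines, whose orbits also contain the zero vector.\<close>

lemma tv_orbit_scale:
  assumes T: "line_or_ray_scalars T" and a: "a \<in> T" "a \<noteq> 0"
  shows "tv_orbit T (tv_scale a v) = tv_orbit T v"
proof -
  have 1: "t * a \<in> T" if "t \<in> T" for t
    using T a that by (auto simp: line_or_ray_scalars_def)
  have 2: "t / a \<in> T" if "t \<in> T" for t
    using T a that by (auto simp: line_or_ray_scalars_def)
  show ?thesis
  proof (intro equalityI subsetI)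
    fix w assume "w \<in> tv_orbit T (tv_scale a v)"
    then show "w \<in> tv_orbit T v"
      using 1 unfolding tv_orbit_def by (auto simp: tv_scale_scale)
  next
    fix w assume "w \<in> tv_orbit T v"
    then obtain t where t: "t \<in> T" "w = tv_scale t v" unfolding tv_orbit_def by blast
    then have "w = tv_scale (t / a) (tv_scale a v)" using a by (simp add: tv_scale_scale)
    then show "w \<in> tv_orbit T (tv_scale a v)" using 2[OF t(1)] unfolding tv_orbit_def by blast
  qed
qed

lemma tv_orbit_eqD:
  assumes T: "line_or_ray_scalars T" and "tv_orbit T v = tv_orbit T w" "w \<noteq> tv_zero"
  obtains a where "a \<in> T" "a \<noteq> 0" "w = tv_scale a v"
proof -
  have "w \<in> tv_orbit T v" using tv_orbit_self[OF T, of w] assms(2) by simp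
  then obtain a where "a \<in> T" "w = tv_scale a v" unfolding tv_orbit_def by blast
  then show thesis using assms(3) tv_scale_eq_zero_iff[of a v] by (intro that) auto
qed

text \<open>Inverse of reading off coordinates on the plane at \<open>x\<close>; it recovers the
  tangent vector from one coordinate vector.\<close>

definition lift :: "('a, 'e::euclidean_space) distrib \<Rightarrow> ('a, 'e) chart \<Rightarrow> 'a \<Rightarrow> 'e \<Rightarrow> ('a, 'e) tvec" where
  "lift \<xi> c x = inv_into (\<xi> x) (\<lambda>v. v c)"

text \<open>Homogeneous coordinates on the prolongation: \<open>u\<close> is a nonzero coordinate
  vector of the plane, relevant only up to scalars in \<open>T\<close>. Together with the base
  coordinate \<open>q\<close> it describes every direction, whereas an affine chart
  \<open>X + r Y\<close> misses some.\<close>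

definition prol_pt ::
  "real set \<Rightarrow> ('a, 'e::euclidean_space) distrib \<Rightarrow> ('a, 'e) chart \<Rightarrow> 'e \<Rightarrow> 'e \<Rightarrow> ('a, 'e) prol_point" where
  "prol_pt T \<xi> c q u = (chart_inv c q, tv_orbit T (lift \<xi> c (chart_inv c q) u))"

definition local_frame_on ::
  "('a, 'e::euclidean_space) mfd \<Rightarrow> ('a, 'e) distrib \<Rightarrow> ('a, 'e) chart \<Rightarrow> 'e set \<Rightarrow> ('e \<Rightarrow> 'e) \<Rightarrow> ('e \<Rightarrow> 'e) \<Rightarrow> bool" where
  "local_frame_on M \<xi> c V X Y \<longleftrightarrow> c \<in> charts M \<and> open V \<and> V \<subseteq> snd c ` fst c \<and> smooth_on V X \<and> smooth_on V Y \<and>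
     (\<forall>q\<in>V. coord_distrib c \<xi> q = span {X q, Y q} \<and> dim (coord_distrib c \<xi> q) = 2)"

lemma charts_prolongation:
  "charts (prolongation T M \<xi>) = {prol_chart T M \<xi> c V X Y |c V X Y. local_frame_on M \<xi> c V X Y}"
  by (simp add: prolongation_def local_frame_on_def)

lemma points_prolongation: "points (prolongation T M \<xi>) = prol_points T M \<xi>"
  by (simp add: prolongation_def)

lemma local_frame_onD:
  assumes "local_frame_on M \<xi> c V X Y"
  shows "c \<in> charts M" "open V" "V \<subseteq> snd c ` fst c" "continuous_on V X" "continuous_on V Y"
    "\<And>q. q \<in> V \<Longrightarrow> coord_distrib c \<xi> q = span {X q, Y q}"
    "\<And>q. q \<in> V \<Longrightarrow> lin_indep2 (X q) (Y q)"
proof -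
  show "c \<in> charts M" "open V" "V \<subseteq> snd c ` fst c" "continuous_on V X" "continuous_on V Y"
    "\<And>q. q \<in> V \<Longrightarrow> coord_distrib c \<xi> q = span {X q, Y q}"
    using assms smooth_on_continuous unfolding local_frame_on_def by blast+
  fix q assume "q \<in> V"
  then have "coord_distrib c \<xi> q = span {X q, Y q}" "dim (coord_distrib c \<xi> q) = 2"
    using assms unfolding local_frame_on_def by blast+
  then show "lin_indep2 (X q) (Y q)" using span_pair_lin_indep2 by metis
qed

lemma local_frame_on_nonzero:
  assumes "local_frame_on M \<xi> c V X Y" "q \<in> V"
  shows "X q + r *\<^sub>R Y q \<in> coord_distrib c \<xi> q" "X q + r *\<^sub>R Y q \<noteq> 0"
proof -
  show "X q + r *\<^sub>R Y q \<in> coord_distrib c \<xi> q"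
    unfolding local_frame_onD(6)[OF assms] by (intro span_add span_scale span_base) auto
  show "X q + r *\<^sub>R Y q \<noteq> 0"
    using local_frame_onD(7)[OF assms] unfolding lin_indep2_def by (metis scaleR_one zero_neq_one)
qed

context
  fixes T :: "real set" and M :: "('a, 'e::euclidean_space) mfd" and \<xi> :: "('a, 'e) distrib"
  assumes T: "line_or_ray_scalars T" and M: "manifold M" and \<xi>: "distribution M 2 \<xi>"
begin

lemma charts_at_chart_inv:
  assumes "c \<in> charts M" "q \<in> snd c ` fst c"
  shows "c \<in> charts_at M (chart_inv c q)" "chart_inv c q \<in> points M" "snd c (chart_inv c q) = q"
proof -
  have "chart_inv c q \<in> fst c" using chart_inv_in[OF assms(2)] .
  then show "c \<in> charts_at M (chart_inv c q)" "chart_inv c q \<in> points M"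
    using assms(1) chart_dom_subset[OF M assms(1)] unfolding charts_at_def by blast+
  show "snd c (chart_inv c q) = q" by (rule chart_chart_inv[OF assms(2)])
qed

lemma local_frame_on_ex:
  assumes "c \<in> charts M" "p \<in> snd c ` fst c"
  obtains V X Y where "local_frame_on M \<xi> c V X Y" "p \<in> V"
proof -
  obtain V X Y where *: "open V" "p \<in> V" "V \<subseteq> snd c ` fst c" "smooth_on V X" "smooth_on V Y"
    "\<forall>q\<in>V. coord_distrib c \<xi> q = span {X q, Y q} \<and> dim (coord_distrib c \<xi> q) = 2"
    using local_frame[OF M \<xi> assms] .
  then have "local_frame_on M \<xi> c V X Y" using assms(1) unfolding local_frame_on_def by blast
  then show thesis using that *(2) by blast
qed

lemma lift_in:
  assumes "q \<in> snd c ` fst c" "u \<in> coord_distrib c \<xi> q"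
  shows "lift \<xi> c (chart_inv c q) u \<in> \<xi> (chart_inv c q)" "lift \<xi> c (chart_inv c q) u c = u"
proof -
  have u: "u \<in> (\<lambda>v. v c) ` \<xi> (chart_inv c q)" using assms(2) unfolding coord_distrib_def .
  show "lift \<xi> c (chart_inv c q) u \<in> \<xi> (chart_inv c q)" unfolding lift_def by (rule inv_into_into[OF u])
  show "lift \<xi> c (chart_inv c q) u c = u" unfolding lift_def using f_inv_into_f[OF u] by simp
qed

lemma lift_coord:
  assumes "c \<in> charts_at M x" "v \<in> \<xi> x"
  shows "lift \<xi> c x (v c) = v"
proof -
  have "inj_on (\<lambda>v. v c) (\<xi> x)" using distribution_inj[OF M \<xi> assms(1)] by (intro inj_onI)
  from inv_into_f_f[OF this assms(2)] show ?thesis unfolding lift_def .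
qed

lemma lift_eqI:
  assumes c: "c \<in> charts M" "q \<in> snd c ` fst c" and v: "v \<in> \<xi> (chart_inv c q)" "v c = u"
  shows "lift \<xi> c (chart_inv c q) u = v"
  using lift_coord[OF charts_at_chart_inv(1)[OF c] v(1)] v(2) by simp

lemma lift_nonzero:
  assumes c: "c \<in> charts M" "q \<in> snd c ` fst c" and u: "u \<in> coord_distrib c \<xi> q" "u \<noteq> 0"
  shows "lift \<xi> c (chart_inv c q) u \<noteq> tv_zero"
  using lift_in(2)[OF c(2) u(1)] u(2) by (auto simp: tv_zero_def)

lemma lift_scale:
  assumes c: "c \<in> charts M" "q \<in> snd c ` fst c" and u: "u \<in> coord_distrib c \<xi> q"
  shows "lift \<xi> c (chart_inv c q) (a *\<^sub>R u) = tv_scale a (lift \<xi> c (chart_inv c q) u)"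
  using distribution_scale[OF M \<xi> charts_at_chart_inv(2)[OF c] lift_in(1)[OF c(2) u]] lift_in(2)[OF c(2) u]
  by (intro lift_eqI[OF c]) (simp_all add: tv_scale_def)

lemma prol_pt_in:
  assumes c: "c \<in> charts M" "q \<in> snd c ` fst c" and u: "u \<in> coord_distrib c \<xi> q" "u \<noteq> 0"
  shows "prol_pt T \<xi> c q u \<in> prol_points T M \<xi>"
  using charts_at_chart_inv(2)[OF c] lift_in(1)[OF c(2) u(1)] lift_nonzero[OF c u]
  unfolding prol_pt_def prol_points_def by blast

lemma prol_pt_scale:
  assumes c: "c \<in> charts M" "q \<in> snd c ` fst c" and u: "u \<in> coord_distrib c \<xi> q" and a: "a \<in> T" "a \<noteq> 0"
  shows "prol_pt T \<xi> c q (a *\<^sub>R u) = prol_pt T \<xi> c q u"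
  unfolding prol_pt_def lift_scale[OF c u] tv_orbit_scale[OF T a] ..

lemma prol_points_cases:
  assumes "p \<in> prol_points T M \<xi>" "c \<in> charts M" "fst p \<in> fst c"
  obtains q u where "q \<in> snd c ` fst c" "q = snd c (fst p)" "u \<in> coord_distrib c \<xi> q" "u \<noteq> 0" "p = prol_pt T \<xi> c q u"
proof -
  obtain x v where p: "p = (x, tv_orbit T v)" "x \<in> points M" "v \<in> \<xi> x" "v \<noteq> tv_zero"
    using assms(1) unfolding prol_points_def by blast
  have c: "c \<in> charts_at M x" using assms p unfolding charts_at_def by simp
  have x: "chart_inv c (snd c x) = x"
    using chart_inv_chart[OF chart_inj[OF M assms(2)]] assms(3) p by simp
  have fx: "fst p = x" using p(1) by simp
  have 1: "snd c x \<in> snd c ` fst c" using assms(3) fx by blast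
  have 2: "v c \<in> coord_distrib c \<xi> (snd c x)" unfolding coord_distrib_chart[OF M \<xi> c] using p(3) by blast
  have 3: "v c \<noteq> 0" using distribution_eq_zero_iff[OF M \<xi> c p(3)] p(4) by blast
  have 4: "p = prol_pt T \<xi> c (snd c x) (v c)"
    unfolding prol_pt_def x lift_coord[OF c p(3)] p(1) ..
  show thesis by (rule that[OF 1 _ 2 3 4]) (simp only: fx)
qed

text \<open>Translates the affine charts of the definition into homogeneous coordinates. All later
  topology is done with \<open>prol_pt\<close>.\<close>

lemma prol_chart_dom:
  assumes fr: "local_frame_on M \<xi> c V X Y"
  shows "fst (prol_chart T M \<xi> c V X Y) = {prol_pt T \<xi> c q (X q + r *\<^sub>R Y q) |q r. q \<in> V}" (is "?A = ?B")
    and "q \<in> V \<Longrightarrow> snd (prol_chart T M \<xi> c V X Y) (prol_pt T \<xi> c q (X q + r *\<^sub>R Y q)) = (q, r)"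
proof -
  note D = local_frame_onD[OF fr] and nz = local_frame_on_nonzero[OF fr]
  show "?A = ?B"
  proof (intro equalityI subsetI)
    fix p assume "p \<in> ?A"
    then obtain x l r v where p: "p = (x, l)" "p \<in> prol_points T M \<xi>" "x \<in> fst c" "snd c x \<in> V"
      "v \<in> l" "v c = X (snd c x) + r *\<^sub>R Y (snd c x)"
      unfolding prol_chart_def by auto
    have "fst p \<in> fst c" using p by simp
    from prol_points_cases[OF p(2) D(1) this] obtain q u where
      q: "q \<in> snd c ` fst c" "q = snd c x" "u \<in> coord_distrib c \<xi> q" "u \<noteq> 0" "p = prol_pt T \<xi> c q u"
      using p(1) by (metis fst_conv)
    then obtain a where a: "a \<in> T" "v = tv_scale a (lift \<xi> c (chart_inv c q) u)"
      using p(1,5) unfolding prol_pt_def tv_orbit_def by auto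
    then have vc: "v c = a *\<^sub>R u" using lift_in(2)[OF q(1,3)] by (simp add: tv_scale_def)
    \<comment> \<open>A line contains the zero vector, but \<open>X + r Y\<close> is never zero, so
      the representative that meets the affine chart is a proper rescaling of
      \<open>u\<close>.\<close>
    then have "a \<noteq> 0" using nz(2)[OF p(4)] p(6) by (metis scaleR_zero_left)
    then have "p = prol_pt T \<xi> c q (a *\<^sub>R u)" using prol_pt_scale[OF D(1) q(1,3) a(1)] q(5) by simp
    then have "p = prol_pt T \<xi> c q (X q + r *\<^sub>R Y q)" using vc p(6) q(2) by simp
    then show "p \<in> ?B" using p(4) q(2) by blast
  next
    fix p assume "p \<in> ?B"
    then obtain q r where q: "q \<in> V" "p = prol_pt T \<xi> c q (X q + r *\<^sub>R Y q)" by blast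
    then have qc: "q \<in> snd c ` fst c" using D(3) by blast
    let ?v = "lift \<xi> c (chart_inv c q) (X q + r *\<^sub>R Y q)"
    have "?v \<in> tv_orbit T ?v" by (rule tv_orbit_self[OF T])
    moreover have "?v c = X q + r *\<^sub>R Y q" by (rule lift_in(2)[OF qc nz(1)[OF q(1)]])
    moreover have "p \<in> prol_points T M \<xi>" unfolding q(2) by (rule prol_pt_in[OF D(1) qc nz[OF q(1)]])
    ultimately show "p \<in> ?A"
      using chart_inv_in[OF qc] chart_chart_inv[OF qc] q unfolding prol_chart_def prol_pt_def by auto
  qed
  assume q: "q \<in> V"
  then have qc: "q \<in> snd c ` fst c" using D(3) by blast
  let ?v = "lift \<xi> c (chart_inv c q) (X q + r *\<^sub>R Y q)"
  have vc: "?v c = X q + r *\<^sub>R Y q" by (rule lift_in(2)[OF qc nz(1)[OF q]])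
  have "(THE r'. \<exists>v\<in>tv_orbit T ?v. v c = X q + r' *\<^sub>R Y q) = r"
  proof (rule the_equality)
    show "\<exists>v\<in>tv_orbit T ?v. v c = X q + r *\<^sub>R Y q" using vc tv_orbit_self[OF T] by blast
    \<comment> \<open>Comparing coefficients of \<open>X\<close> fixes the scalar to be 1; then
      those of \<open>Y\<close> give the uniqueness of \<open>r\<close>.\<close>
    fix r' assume "\<exists>v\<in>tv_orbit T ?v. v c = X q + r' *\<^sub>R Y q"
    then obtain a where "a *\<^sub>R (X q + r *\<^sub>R Y q) = X q + r' *\<^sub>R Y q"
      unfolding tv_orbit_def using vc by (auto simp: tv_scale_def)
    then have "a *\<^sub>R X q + (a * r) *\<^sub>R Y q = 1 *\<^sub>R X q + r' *\<^sub>R Y q" by (simp add: algebra_simps)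
    then have "a = 1 \<and> a * r = r'" by (rule iffD1[OF lin_indep2_eq_iff[OF D(7)[OF q]]])
    then show "r' = r" by auto
  qed
  then show "snd (prol_chart T M \<xi> c V X Y) (prol_pt T \<xi> c q (X q + r *\<^sub>R Y q)) = (q, r)"
    unfolding prol_chart_def prol_pt_def by (simp add: chart_chart_inv[OF qc])
qed

lemma prol_chart_inj:
  assumes fr: "local_frame_on M \<xi> c V X Y"
  shows "inj_on (snd (prol_chart T M \<xi> c V X Y)) (fst (prol_chart T M \<xi> c V X Y))"
proof (rule inj_onI)
  fix p p' assume "p \<in> fst (prol_chart T M \<xi> c V X Y)" "p' \<in> fst (prol_chart T M \<xi> c V X Y)"
    and eq: "snd (prol_chart T M \<xi> c V X Y) p = snd (prol_chart T M \<xi> c V X Y) p'"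
  then obtain q r q' r' where "q \<in> V" "p = prol_pt T \<xi> c q (X q + r *\<^sub>R Y q)"
    "q' \<in> V" "p' = prol_pt T \<xi> c q' (X q' + r' *\<^sub>R Y q')"
    unfolding prol_chart_dom(1)[OF fr] by blast
  then show "p = p'" using eq prol_chart_dom(2)[OF fr] by simp
qed

lemma prol_chart_image:
  assumes fr: "local_frame_on M \<xi> c V X Y"
  shows "snd (prol_chart T M \<xi> c V X Y) ` (W \<inter> fst (prol_chart T M \<xi> c V X Y)) =
    {(q, r). q \<in> V \<and> prol_pt T \<xi> c q (X q + r *\<^sub>R Y q) \<in> W}"
proof (intro equalityI subsetI)
  fix z assume "z \<in> snd (prol_chart T M \<xi> c V X Y) ` (W \<inter> fst (prol_chart T M \<xi> c V X Y))"
  then obtain q r where "q \<in> V" "prol_pt T \<xi> c q (X q + r *\<^sub>R Y q) \<in> W"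
    "z = snd (prol_chart T M \<xi> c V X Y) (prol_pt T \<xi> c q (X q + r *\<^sub>R Y q))"
    unfolding prol_chart_dom(1)[OF fr] by blast
  then show "z \<in> {(q, r). q \<in> V \<and> prol_pt T \<xi> c q (X q + r *\<^sub>R Y q) \<in> W}"
    by (simp add: prol_chart_dom(2)[OF fr])
next
  fix z assume "z \<in> {(q, r). q \<in> V \<and> prol_pt T \<xi> c q (X q + r *\<^sub>R Y q) \<in> W}"
  then obtain q r where "z = (q, r)" "q \<in> V" "prol_pt T \<xi> c q (X q + r *\<^sub>R Y q) \<in> W" by blast
  moreover then have "prol_pt T \<xi> c q (X q + r *\<^sub>R Y q) \<in> fst (prol_chart T M \<xi> c V X Y)"
    unfolding prol_chart_dom(1)[OF fr] by blast
  ultimately show "z \<in> snd (prol_chart T M \<xi> c V X Y) ` (W \<inter> fst (prol_chart T M \<xi> c V X Y))"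
    using prol_chart_dom(2)[OF fr] by (metis IntI imageI)
qed

lemma openin_prolongation:
  "openin (mtop (prolongation T M \<xi>)) W \<longleftrightarrow> W \<subseteq> prol_points T M \<xi> \<and>
    (\<forall>c V X Y. local_frame_on M \<xi> c V X Y \<longrightarrow> open {(q, r). q \<in> V \<and> prol_pt T \<xi> c q (X q + r *\<^sub>R Y q) \<in> W})"
proof -
  have o: "openin (mtop (prolongation T M \<xi>)) W \<longleftrightarrow> W \<subseteq> prol_points T M \<xi> \<and>
      (\<forall>ch\<in>charts (prolongation T M \<xi>). open (snd ch ` (W \<inter> fst ch)))"
    unfolding points_prolongation[symmetric]
    by (rule openin_mtop) (use prol_chart_inj in \<open>auto simp: charts_prolongation\<close>)
  have "(\<forall>ch\<in>charts (prolongation T M \<xi>). open (snd ch ` (W \<inter> fst ch))) \<longleftrightarrow>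
     (\<forall>c V X Y. local_frame_on M \<xi> c V X Y \<longrightarrow> open (snd (prol_chart T M \<xi> c V X Y) ` (W \<inter> fst (prol_chart T M \<xi> c V X Y))))"
    unfolding charts_prolongation by blast
  also have "\<dots> \<longleftrightarrow> (\<forall>c V X Y. local_frame_on M \<xi> c V X Y \<longrightarrow>
      open {(q, r). q \<in> V \<and> prol_pt T \<xi> c q (X q + r *\<^sub>R Y q) \<in> W})"
    using prol_chart_image by simp
  finally show ?thesis unfolding o by simp
qed

lemma prol_pt_frame_in:
  assumes fr: "local_frame_on M \<xi> c V X Y" and q: "q \<in> V"
  shows "prol_pt T \<xi> c q (X q + r *\<^sub>R Y q) \<in> prol_points T M \<xi>"
proof -
  have "q \<in> snd c ` fst c" using local_frame_onD(3)[OF fr] q by blast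
  from prol_pt_in[OF local_frame_onD(1)[OF fr] this local_frame_on_nonzero[OF fr q]] show ?thesis .
qed

lemma topspace_prolongation: "topspace (mtop (prolongation T M \<xi>)) = prol_points T M \<xi>"
proof -
  have "openin (mtop (prolongation T M \<xi>)) (prol_points T M \<xi>)"
    unfolding openin_prolongation
  proof (intro conjI allI impI)
    fix c V X Y assume fr: "local_frame_on M \<xi> c V X Y"
    note D = local_frame_onD[OF fr]
    have "{(q, r). q \<in> V \<and> prol_pt T \<xi> c q (X q + r *\<^sub>R Y q) \<in> prol_points T M \<xi>} = V \<times> UNIV"
      using prol_pt_frame_in[OF fr] by auto
    then show "open {(q, r). q \<in> V \<and> prol_pt T \<xi> c q (X q + r *\<^sub>R Y q) \<in> prol_points T M \<xi>}"
      using open_Times[OF D(2) open_UNIV] by simp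
  qed simp
  moreover have "topspace (mtop (prolongation T M \<xi>)) \<subseteq> prol_points T M \<xi>"
    using iffD1[OF openin_prolongation openin_topspace] by (rule conjunct1)
  ultimately show ?thesis using openin_subset by blast
qed

lemma continuous_map_from_prolongation:
  assumes "\<And>p. p \<in> prol_points T M \<xi> \<Longrightarrow> F p \<in> topspace Y"
    and "\<And>c V X Z. local_frame_on M \<xi> c V X Z \<Longrightarrow>
      continuous_map (top_of_set (V \<times> UNIV)) Y (\<lambda>z. F (prol_pt T \<xi> c (fst z) (X (fst z) + snd z *\<^sub>R Z (fst z))))"
  shows "continuous_map (mtop (prolongation T M \<xi>)) Y F"
  unfolding continuous_map_def topspace_prolongation openin_prolongation
proof (intro conjI allI impI)
  show "F \<in> prol_points T M \<xi> \<rightarrow> topspace Y" using assms(1) by blast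
  fix U c V X Z assume U: "openin Y U" and fr: "local_frame_on M \<xi> c V X Z"
  note D = local_frame_onD[OF fr]
  have "openin (top_of_set (V \<times> UNIV)) {z \<in> V \<times> (UNIV :: real set). F (prol_pt T \<xi> c (fst z) (X (fst z) + snd z *\<^sub>R Z (fst z))) \<in> U}"
    using openin_continuous_map_preimage[OF assms(2)[OF fr] U] by simp
  then have "open {z \<in> V \<times> (UNIV :: real set). F (prol_pt T \<xi> c (fst z) (X (fst z) + snd z *\<^sub>R Z (fst z))) \<in> U}"
    using openin_open_trans open_Times[OF D(2) open_UNIV] by blast
  moreover have "{z \<in> V \<times> (UNIV :: real set). F (prol_pt T \<xi> c (fst z) (X (fst z) + snd z *\<^sub>R Z (fst z))) \<in> U} =
      {(q, r). q \<in> V \<and> prol_pt T \<xi> c q (X q + r *\<^sub>R Z q) \<in> {p \<in> prol_points T M \<xi>. F p \<in> U}}"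
      using prol_pt_frame_in[OF fr] by auto
  ultimately show "open {(q, r). q \<in> V \<and> prol_pt T \<xi> c q (X q + r *\<^sub>R Z q) \<in> {p \<in> prol_points T M \<xi>. F p \<in> U}}"
    by simp
qed blast

end

text \<open>Cramer's rule with the Gram matrix. It expresses coefficients by inner products, which
  makes them continuous in the vector and in the frame.\<close>

lemma span_pair_gram:
  fixes X Y u :: "'e::real_inner"
  assumes "u = a *\<^sub>R X + b *\<^sub>R Y"
  defines "G \<equiv> (X \<bullet> X) * (Y \<bullet> Y) - (X \<bullet> Y) * (X \<bullet> Y)"
  shows "(u \<bullet> X) * (Y \<bullet> Y) - (u \<bullet> Y) * (X \<bullet> Y) = a * G"
    and "(u \<bullet> Y) * (X \<bullet> X) - (u \<bullet> X) * (X \<bullet> Y) = b * G"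
  unfolding assms G_def by (simp_all add: inner_add_left inner_commute algebra_simps)

lemma gram_pos:
  fixes X Y :: "'e::real_inner"
  assumes "lin_indep2 X Y"
  shows "(X \<bullet> X) * (Y \<bullet> Y) - (X \<bullet> Y) * (X \<bullet> Y) > 0"
proof -
  have "Y \<noteq> 0"
  proof
    assume "Y = 0"
    then have "0 *\<^sub>R X + 1 *\<^sub>R Y = 0" by simp
    then show False using assms unfolding lin_indep2_def by (metis zero_neq_one)
  qed
  \<comment> \<open>\<open>Z\<close> is the component of \<open>X\<close> orthogonal to
    \<open>Y\<close>, multiplied by \<open>Y \<bullet> Y\<close>. Its squared length is the Gram
    determinant times \<open>Y \<bullet> Y\<close>.\<close>
  define Z where "Z = (Y \<bullet> Y) *\<^sub>R X + (- (X \<bullet> Y)) *\<^sub>R Y"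
  have "Z \<noteq> 0"
    using assms \<open>Y \<noteq> 0\<close> unfolding Z_def lin_indep2_def by (metis inner_eq_zero_iff)
  then have "0 < Z \<bullet> Z" by simp
  also have "Z \<bullet> Z = (Y \<bullet> Y) * ((X \<bullet> X) * (Y \<bullet> Y) - (X \<bullet> Y) * (X \<bullet> Y))"
    unfolding Z_def by (simp add: inner_add_left inner_add_right inner_diff_left inner_diff_right inner_commute algebra_simps)
  finally have "0 < (Y \<bullet> Y) * ((X \<bullet> X) * (Y \<bullet> Y) - (X \<bullet> Y) * (X \<bullet> Y))" .
  then show ?thesis using \<open>Y \<noteq> 0\<close> zero_less_mult_pos inner_gt_zero_iff by blast
qed

text \<open>The angle ranges over a compact interval; this is where the compactness of the fibres of
  the prolongation comes from.\<close>

lemma polar_coords_pair: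
  fixes u :: "'e::real_vector"
  assumes "u = a *\<^sub>R X + b *\<^sub>R Y" "u \<noteq> 0"
  obtains \<rho> \<theta> where "\<rho> > 0" "\<theta> \<in> {0..2*pi}" "u = \<rho> *\<^sub>R (cos \<theta> *\<^sub>R X + sin \<theta> *\<^sub>R Y)"
proof -
  define \<rho> where "\<rho> = sqrt (a^2 + b^2)"
  have "a \<noteq> 0 \<or> b \<noteq> 0" using assms by auto
  then have pos: "a^2 + b^2 > 0" by (simp add: sum_power2_gt_zero_iff)
  then have "\<rho> > 0" by (simp add: \<rho>_def)
  have "\<rho>^2 = a^2 + b^2" using pos by (simp add: \<rho>_def)
  have "(a / \<rho>)^2 + (b / \<rho>)^2 = (a^2 + b^2) / \<rho>^2" by (simp add: power_divide add_divide_distrib)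
  also have "\<dots> = 1" unfolding \<open>\<rho>^2 = a^2 + b^2\<close>[symmetric] using \<open>\<rho> > 0\<close> by simp
  finally have "(a / \<rho>)^2 + (b / \<rho>)^2 = 1" .
  then obtain t where t: "0 \<le> t" "t \<le> 2*pi" "a / \<rho> = cos t" "b / \<rho> = sin t"
    using sincos_total_2pi_le by blast
  then have ab: "a = \<rho> * cos t" "b = \<rho> * sin t" using \<open>\<rho> > 0\<close> by (simp_all add: field_simps)
  have "u = \<rho> *\<^sub>R (cos t *\<^sub>R X + sin t *\<^sub>R Y)"
    unfolding assms(1) ab by (simp add: scaleR_add_right)
  then show thesis using that[of \<rho> t] \<open>\<rho> > 0\<close> t by simp
qed

lemma smooth_on_lin_comb:
  assumes "open S" "smooth_on S X" "smooth_on S Y"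
  shows "smooth_on S (\<lambda>q. a *\<^sub>R X q + b *\<^sub>R Y q)"
proof -
  have "smooth_on S (\<lambda>q. a *\<^sub>R X q)" "smooth_on S (\<lambda>q. b *\<^sub>R Y q)"
    by (rule smooth_on_bilinear[OF bounded_bilinear_scaleR assms(1) smooth_on_const], rule assms)+
  then show ?thesis using Ck_on_add[OF assms(1)] unfolding smooth_on_def by blast
qed

lemma scaleR_solve: "k \<noteq> 0 \<Longrightarrow> w = k *\<^sub>R x \<Longrightarrow> x = (1 / k) *\<^sub>R (w :: 'a::real_vector)"
  by simp

text \<open>The change of frame is a rotation followed by a dilation, with determinant
  \<open>a * a + b * b\<close>. It lets any chosen direction become the first frame vector, that is,
  the centre \<open>r = 0\<close> of an affine chart.\<close>

lemma local_frame_on_rotate: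
  assumes fr: "local_frame_on M \<xi> c V X Y" and ab: "a \<noteq> 0 \<or> b \<noteq> (0::real)"
  shows "local_frame_on M \<xi> c V (\<lambda>q. a *\<^sub>R X q + b *\<^sub>R Y q) (\<lambda>q. (- b) *\<^sub>R X q + a *\<^sub>R Y q)"
proof -
  have span: "span {a *\<^sub>R x + b *\<^sub>R y, (- b) *\<^sub>R x + a *\<^sub>R y} = span {x, y}" for x y :: 'b
  proof
    have "{a *\<^sub>R x + b *\<^sub>R y, (- b) *\<^sub>R x + a *\<^sub>R y} \<subseteq> span {x, y}"
      by (auto intro!: span_add span_diff span_scale span_neg intro: span_base)
    then show "span {a *\<^sub>R x + b *\<^sub>R y, (- b) *\<^sub>R x + a *\<^sub>R y} \<subseteq> span {x, y}"
      by (simp add: span_minimal)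
    let ?u = "a *\<^sub>R x + b *\<^sub>R y" and ?v = "(- b) *\<^sub>R x + a *\<^sub>R y" and ?D = "a * a + b * b"
    have D: "?D \<noteq> 0" using ab by (metis sum_squares_eq_zero_iff)
    have "a *\<^sub>R ?u + (- b) *\<^sub>R ?v = ?D *\<^sub>R x" by (simp add: algebra_simps)
    then have x: "x = (1 / ?D) *\<^sub>R (a *\<^sub>R ?u + (- b) *\<^sub>R ?v)" by (rule scaleR_solve[OF D])
    have "b *\<^sub>R ?u + a *\<^sub>R ?v = ?D *\<^sub>R y" by (simp add: algebra_simps)
    then have y: "y = (1 / ?D) *\<^sub>R (b *\<^sub>R ?u + a *\<^sub>R ?v)" by (rule scaleR_solve[OF D])
    have "(1 / ?D) *\<^sub>R (a *\<^sub>R ?u + (- b) *\<^sub>R ?v) \<in> span {?u, ?v}"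
      "(1 / ?D) *\<^sub>R (b *\<^sub>R ?u + a *\<^sub>R ?v) \<in> span {?u, ?v}"
      by (intro span_scale span_add span_base insertI1 insertI2)+
    then have "x \<in> span {?u, ?v}" "y \<in> span {?u, ?v}" by (simp_all only: x[symmetric] y[symmetric])
    then show "span {x, y} \<subseteq> span {?u, ?v}" by (intro span_minimal) auto
  qed
  have V: "open V" "smooth_on V X" "smooth_on V Y" using fr unfolding local_frame_on_def by blast+
  show ?thesis
    using fr smooth_on_lin_comb[OF V, of a b] smooth_on_lin_comb[OF V, of "- b" a]
    unfolding local_frame_on_def span by blast
qed

lemma top_of_set_Times:
  "top_of_set (A \<times> B) = prod_topology (top_of_set A) (top_of_set B)"
  using subtopology_Times[of euclidean euclidean A B] by simp

context
  fixes T :: "real set" and M :: "('a, 'e::euclidean_space) mfd" and \<xi> :: "('a, 'e) distrib"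
  assumes T: "line_or_ray_scalars T" and M: "manifold M" and \<xi>: "distribution M 2 \<xi>"
begin

text \<open>At a given parameter the frame is rotated so that \<open>u\<close> points along its
  first vector. Nearby, the coefficient of that vector stays positive, and the point has the
  continuous affine coordinate \<open>B z / A z\<close>.\<close>

lemma continuous_map_prol_pt:
  fixes b u :: "'z::topological_space \<Rightarrow> 'e"
  assumes c: "c \<in> charts M" and b: "continuous_on S b" "\<And>z. z \<in> S \<Longrightarrow> b z \<in> snd c ` fst c"
    and u: "continuous_on S u" "\<And>z. z \<in> S \<Longrightarrow> u z \<in> coord_distrib c \<xi> (b z)" "\<And>z. z \<in> S \<Longrightarrow> u z \<noteq> 0"
  shows "continuous_map (top_of_set S) (mtop (prolongation T M \<xi>)) (\<lambda>z. prol_pt T \<xi> c (b z) (u z))"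
  unfolding continuous_map_def
proof (intro conjI allI impI)
  show "(\<lambda>z. prol_pt T \<xi> c (b z) (u z)) \<in> topspace (top_of_set S) \<rightarrow> topspace (mtop (prolongation T M \<xi>))"
    unfolding topspace_prolongation[OF T M \<xi>] by (rule Pi_I) (use prol_pt_in[OF T M \<xi> c b(2) u(2,3)] in simp)
  fix W assume W: "openin (mtop (prolongation T M \<xi>)) W"
  have "\<exists>A. openin (top_of_set S) A \<and> z0 \<in> A \<and> A \<subseteq> {z \<in> S. prol_pt T \<xi> c (b z) (u z) \<in> W}"
    if z0: "z0 \<in> S" "prol_pt T \<xi> c (b z0) (u z0) \<in> W" for z0
  proof -
    obtain V X0 Y0 where fr0: "local_frame_on M \<xi> c V X0 Y0" "b z0 \<in> V"
      using local_frame_on_ex[OF T M \<xi> c b(2)[OF z0(1)]] .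
    have "u z0 \<in> span {X0 (b z0), Y0 (b z0)}"
      using u(2)[OF z0(1)] local_frame_onD(6)[OF fr0] by simp
    then obtain \<alpha> \<beta> where \<alpha>\<beta>: "u z0 = \<alpha> *\<^sub>R X0 (b z0) + \<beta> *\<^sub>R Y0 (b z0)" unfolding in_span_pair by blast
    define X where "X q = \<alpha> *\<^sub>R X0 q + \<beta> *\<^sub>R Y0 q" for q
    define Y where "Y q = (- \<beta>) *\<^sub>R X0 q + \<alpha> *\<^sub>R Y0 q" for q
    have "\<alpha> \<noteq> 0 \<or> \<beta> \<noteq> 0" using u(3)[OF z0(1)] \<alpha>\<beta> by auto
    then have fr: "local_frame_on M \<xi> c V X Y"
      unfolding X_def Y_def by (rule local_frame_on_rotate[OF fr0(1)])
    note D = local_frame_onD[OF fr]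
    define \<Omega> where "\<Omega> = {(q, r). q \<in> V \<and> prol_pt T \<xi> c q (X q + r *\<^sub>R Y q) \<in> W}"
    have \<Omega>: "open \<Omega>" using W fr unfolding \<Omega>_def openin_prolongation[OF T M \<xi>] by blast
    define S1 where "S1 = S \<inter> b -` V"
    have S1: "openin (top_of_set S) S1" unfolding S1_def by (rule continuous_openin_preimage_gen[OF b(1) D(2)])
    have cb: "continuous_on S1 b" "continuous_on S1 u"
      using b(1) u(1) continuous_on_subset unfolding S1_def by blast+
    have "b ` S1 \<subseteq> V" by (auto simp: S1_def)
    then have cX: "continuous_on S1 (\<lambda>z. X (b z))" "continuous_on S1 (\<lambda>z. Y (b z))"
      using continuous_on_compose2[OF D(4) cb(1)] continuous_on_compose2[OF D(5) cb(1)] by blast+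
    define G where "G z = (X (b z) \<bullet> X (b z)) * (Y (b z) \<bullet> Y (b z)) - (X (b z) \<bullet> Y (b z)) * (X (b z) \<bullet> Y (b z))" for z
    define A where "A z = ((u z \<bullet> X (b z)) * (Y (b z) \<bullet> Y (b z)) - (u z \<bullet> Y (b z)) * (X (b z) \<bullet> Y (b z))) / G z" for z
    define B where "B z = ((u z \<bullet> Y (b z)) * (X (b z) \<bullet> X (b z)) - (u z \<bullet> X (b z)) * (X (b z) \<bullet> Y (b z))) / G z" for z
    have G: "G z > 0" if "z \<in> S1" for z
      using gram_pos[OF D(7)] that unfolding G_def S1_def by simp
    have AB: "A z = x \<and> B z = y" if "z \<in> S1" "u z = x *\<^sub>R X (b z) + y *\<^sub>R Y (b z)" for z x y
      using span_pair_gram[OF that(2)] G[OF that(1)] unfolding A_def B_def G_def by simp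
    have uAB: "u z = A z *\<^sub>R X (b z) + B z *\<^sub>R Y (b z)" if z: "z \<in> S1" for z
    proof -
      have "b z \<in> V" "z \<in> S" using z by (auto simp: S1_def)
      then have "u z \<in> span {X (b z), Y (b z)}" using u(2) D(6) by metis
      then obtain x y where xy: "u z = x *\<^sub>R X (b z) + y *\<^sub>R Y (b z)" unfolding in_span_pair by blast
      then show ?thesis using AB[OF z xy] by simp
    qed
    have cA: "continuous_on S1 A" "continuous_on S1 B"
      unfolding A_def B_def G_def
      by (intro continuous_intros cb cX ballI, use G in \<open>force simp: G_def\<close>)+
    \<comment> \<open>Positivity of \<open>A\<close>, and not only \<open>A z \<noteq> 0\<close>, is
      required: dividing by it must not leave the ray.\<close>
    define S2 where "S2 = S1 \<inter> A -` {0<..}"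
    have S2: "openin (top_of_set S1) S2" unfolding S2_def by (rule continuous_openin_preimage_gen[OF cA(1) open_greaterThan])
    define S3 where "S3 = S2 \<inter> (\<lambda>z. (b z, B z / A z)) -` \<Omega>"
    have c3: "continuous_on S2 (\<lambda>z. (b z, B z / A z))"
      by (intro continuous_intros continuous_on_subset[OF cb(1)] continuous_on_subset[OF cA(1)] continuous_on_subset[OF cA(2)])
        (auto simp: S2_def)
    have S3: "openin (top_of_set S2) S3" unfolding S3_def by (rule continuous_openin_preimage_gen[OF c3 \<Omega>])
    have "openin (top_of_set S) S3"
      using openin_trans[OF openin_trans[OF S3 S2] S1] .
    moreover have eq: "prol_pt T \<xi> c (b z) (X (b z) + (B z / A z) *\<^sub>R Y (b z)) = prol_pt T \<xi> c (b z) (u z)"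
      if "z \<in> S2" for z
    proof -
      have z: "z \<in> S1" "A z > 0" "b z \<in> V" "z \<in> S" using that by (auto simp: S1_def S2_def)
      have "A z *\<^sub>R (X (b z) + (B z / A z) *\<^sub>R Y (b z)) = u z"
        using z(2) uAB[OF z(1)] by (simp add: scaleR_add_right)
      then show ?thesis
        using prol_pt_scale[OF T M \<xi> c b(2)[OF z(4)] local_frame_on_nonzero(1)[OF fr z(3)] line_or_ray_scalars_pos[OF T z(2)], of "B z / A z"] z(2)
        by simp
    qed
    then have "S3 \<subseteq> {z \<in> S. prol_pt T \<xi> c (b z) (u z) \<in> W}"
      unfolding S3_def \<Omega>_def S2_def S1_def by fastforce
    moreover have "z0 \<in> S3"
    proof -
      have 1: "z0 \<in> S1" using z0(1) fr0(2) by (simp add: S1_def)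
      have "u z0 = 1 *\<^sub>R X (b z0) + 0 *\<^sub>R Y (b z0)" using \<alpha>\<beta> by (simp add: X_def)
      from AB[OF 1 this] have "z0 \<in> S2" "A z0 = 1" "B z0 = 0" using 1 by (simp_all add: S2_def)
      then show ?thesis using z0(2) eq[of z0] fr0(2) by (simp add: S3_def \<Omega>_def)
    qed
    ultimately show ?thesis by blast
  qed
  then have "openin (top_of_set S) {z \<in> S. prol_pt T \<xi> c (b z) (u z) \<in> W}"
    by (subst openin_subopen) blast
  then show "openin (top_of_set S) {z \<in> topspace (top_of_set S). prol_pt T \<xi> c (b z) (u z) \<in> W}" by simp
qed

lemma fst_prol_points: "fst ` prol_points T M \<xi> = points M"
proof (intro equalityI subsetI)
  fix x assume x: "x \<in> points M"
  obtain v where "v \<in> \<xi> x" "v \<noteq> tv_zero" using distribution_nonzero[OF M \<xi> x] .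
  then have "(x, tv_orbit T v) \<in> prol_points T M \<xi>" using x unfolding prol_points_def by blast
  then show "x \<in> fst ` prol_points T M \<xi>" by (metis fst_conv imageI)
qed (auto simp: prol_points_def)

lemma continuous_map_fst_prolongation:
  "continuous_map (mtop (prolongation T M \<xi>)) (mtop M) fst"
proof (rule continuous_map_from_prolongation[OF T M \<xi>])
  show "fst p \<in> topspace (mtop M)" if "p \<in> prol_points T M \<xi>" for p
    using that fst_prol_points manifold_topspace[OF M] by blast
  fix c V X Z assume fr: "local_frame_on M \<xi> c V X Z"
  note D = local_frame_onD[OF fr]
  have "continuous_map (top_of_set (V \<times> (UNIV :: real set))) (top_of_set (snd c ` fst c)) fst"
    using D(3) by (auto simp: continuous_map_in_subtopology intro: continuous_on_fst continuous_on_id)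
  from continuous_map_compose[OF this continuous_map_chart_inv[OF M D(1)]]
  show "continuous_map (top_of_set (V \<times> (UNIV :: real set))) (mtop M) (\<lambda>z. fst (prol_pt T \<xi> c (fst z) (X (fst z) + snd z *\<^sub>R Z (fst z))))"
    by (simp add: prol_pt_def o_def)
qed

text \<open>A continuous parametrisation of the directions over \<open>V\<close> by angles. It is
  onto but not injective: the ends of the interval give the same direction, and for lines opposite
  angles do as well. Surjectivity and compactness of the interval are what properness needs.\<close>

lemma prolongation_circle_chart:
  assumes x: "x \<in> points M"
  obtains \<Phi> V c where "c \<in> charts_at M x" "snd c x \<in> V" "open V" "V \<subseteq> snd c ` fst c"
    "continuous_map (prod_topology (top_of_set V) (top_of_set {0..2*pi})) (mtop (prolongation T M \<xi>)) \<Phi>"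
    "\<forall>p\<in>prol_points T M \<xi>. fst p \<in> fst c \<longrightarrow> snd c (fst p) \<in> V \<longrightarrow> (\<exists>\<theta>\<in>{0..2*pi}. p = \<Phi> (snd c (fst p), \<theta>))"
    "\<forall>q\<in>V. \<forall>\<theta>\<in>{0..2*pi}. fst (\<Phi> (q, \<theta>)) = chart_inv c q"
proof -
  let ?P = "mtop (prolongation T M \<xi>)"
  obtain c where c: "c \<in> charts_at M x" using charts_at_ex[OF M x] by blast
  have C: "c \<in> charts M" "x \<in> fst c" using charts_at_D[OF M c] by blast+
  obtain V X Y where fr: "local_frame_on M \<xi> c V X Y" "snd c x \<in> V"
    using local_frame_on_ex[OF T M \<xi> C(1) imageI[OF C(2)]] .
  note D = local_frame_onD[OF fr(1)]
  let ?u = "\<lambda>z. cos (snd z) *\<^sub>R X (fst z) + sin (snd z) *\<^sub>R Y (fst z)"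
  let ?\<Phi> = "\<lambda>z. prol_pt T \<xi> c (fst z) (?u z)"
  have "continuous_map (top_of_set (V \<times> {0..2*pi})) ?P ?\<Phi>"
  proof (rule continuous_map_prol_pt[OF C(1)])
    have f: "continuous_on (V \<times> {0..2*pi}) fst" "fst ` (V \<times> {0..2*pi}) \<subseteq> V" by (auto intro: continuous_on_fst continuous_on_id)
    have "continuous_on (V \<times> {0..2*pi}) (\<lambda>z. X (fst z))" "continuous_on (V \<times> {0..2*pi}) (\<lambda>z. Y (fst z))"
      using continuous_on_compose2[OF D(4) f] continuous_on_compose2[OF D(5) f] .
    then show "continuous_on (V \<times> {0..2*pi}) ?u" by (intro continuous_intros)
    show "continuous_on (V \<times> {0..2*pi}) fst" by (intro continuous_intros)
    fix z assume z: "z \<in> V \<times> {0..2*pi}"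
    then have q: "fst z \<in> V" by auto
    then show "fst z \<in> snd c ` fst c" using D(3) by blast
    show "?u z \<in> coord_distrib c \<xi> (fst z)"
      unfolding D(6)[OF q] by (intro span_add span_scale span_base) auto
    show "?u z \<noteq> 0"
      using D(7)[OF q] sin_zero_abs_cos_one[of "snd z"] unfolding lin_indep2_def by fastforce
  qed
  then have "continuous_map (prod_topology (top_of_set V) (top_of_set {0..2*pi})) ?P ?\<Phi>"
    unfolding top_of_set_Times .
  note 1 = this
  have "\<exists>\<theta>\<in>{0..2*pi}. p = ?\<Phi> (snd c (fst p), \<theta>)"
    if p: "p \<in> prol_points T M \<xi>" "fst p \<in> fst c" "snd c (fst p) \<in> V" for p
  proof -
    obtain q u where q: "q \<in> snd c ` fst c" "q = snd c (fst p)" "u \<in> coord_distrib c \<xi> q" "u \<noteq> 0" "p = prol_pt T \<xi> c q u"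
      using prol_points_cases[OF T M \<xi> p(1) C(1) p(2)] .
    have qV: "q \<in> V" using q(2) p(3) by simp
    then obtain a b where "u = a *\<^sub>R X q + b *\<^sub>R Y q" using q(3) D(6) in_span_pair by metis
    then obtain \<rho> \<theta> where \<rho>: "\<rho> > 0" "\<theta> \<in> {0..2*pi}" "u = \<rho> *\<^sub>R (cos \<theta> *\<^sub>R X q + sin \<theta> *\<^sub>R Y q)"
      using polar_coords_pair q(4) by metis
    have "cos \<theta> *\<^sub>R X q + sin \<theta> *\<^sub>R Y q \<in> coord_distrib c \<xi> q"
      unfolding D(6)[OF qV] by (intro span_add span_scale span_base) auto
    then have "p = prol_pt T \<xi> c q (cos \<theta> *\<^sub>R X q + sin \<theta> *\<^sub>R Y q)"
      using prol_pt_scale[OF T M \<xi> C(1) q(1) _ line_or_ray_scalars_pos[OF T \<rho>(1)]] q(5) \<rho> by simp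
    then show ?thesis using q(2) \<rho>(2) by auto
  qed
  then have 2: "\<forall>p\<in>prol_points T M \<xi>. fst p \<in> fst c \<longrightarrow> snd c (fst p) \<in> V \<longrightarrow>
      (\<exists>\<theta>\<in>{0..2*pi}. p = ?\<Phi> (snd c (fst p), \<theta>))" by blast
  have 3: "\<forall>q\<in>V. \<forall>\<theta>\<in>{0..2*pi}. fst (?\<Phi> (q, \<theta>)) = chart_inv c q" by (simp add: prol_pt_def)
  show thesis by (rule that[OF c fr(2) D(2,3) 1 2 3])
qed

text \<open>A neighbourhood of a fibre contains, by the tube lemma for the map from the product with the circle,
  the preimage of a neighbourhood of the base point.\<close>

lemma proper_map_fst_prolongation:
  "proper_map (mtop (prolongation T M \<xi>)) (mtop M) fst"
proof -
  let ?P = "mtop (prolongation T M \<xi>)"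
  show ?thesis
    unfolding proper_map_def closed_map_fibre_neighbourhood topspace_prolongation[OF T M \<xi>] manifold_topspace[OF M]
  proof (intro conjI allI impI ballI)
    show "fst \<in> prol_points T M \<xi> \<rightarrow> points M" using fst_prol_points by blast
  next
    fix U x assume *: "openin ?P U \<and> x \<in> points M \<and> {p \<in> prol_points T M \<xi>. fst p = x} \<subseteq> U"
    obtain \<Phi> V c where c: "c \<in> charts_at M x" and V: "snd c x \<in> V" "open V" "V \<subseteq> snd c ` fst c"
      and \<Phi>: "continuous_map (prod_topology (top_of_set V) (top_of_set {0..2*pi})) ?P \<Phi>"
      and surj0: "\<forall>p\<in>prol_points T M \<xi>. fst p \<in> fst c \<longrightarrow> snd c (fst p) \<in> V \<longrightarrow> (\<exists>\<theta>\<in>{0..2*pi}. p = \<Phi> (snd c (fst p), \<theta>))"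
      and fst0: "\<forall>q\<in>V. \<forall>\<theta>\<in>{0..2*pi}. fst (\<Phi> (q, \<theta>)) = chart_inv c q"
      using prolongation_circle_chart[OF conjunct1[OF conjunct2[OF *]]] .
    note surj = surj0[rule_format] and fst = fst0[rule_format]
    have C: "c \<in> charts M" "x \<in> fst c" using charts_at_D[OF M c] by blast+
    have cx: "chart_inv c (snd c x) = x" by (rule chart_inv_chart[OF chart_inj[OF M C(1)] C(2)])
    define \<Omega> where "\<Omega> = {z \<in> V \<times> {0..2*pi}. \<Phi> z \<in> U}"
    have \<Omega>: "openin (prod_topology (top_of_set V) (top_of_set {0..2*pi})) \<Omega>"
      using openin_continuous_map_preimage[OF \<Phi>, of U] * unfolding \<Omega>_def by simp
    have "{snd c x} \<times> {0..2*pi} \<subseteq> \<Omega>"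
    proof
      fix z assume z: "z \<in> {snd c x} \<times> {0..2*pi}"
      then have zV: "z \<in> V \<times> {0..2*pi}" using V(1) by auto
      then have "\<Phi> z \<in> prol_points T M \<xi>"
        using continuous_map_funspace[OF \<Phi>] unfolding topspace_prolongation[OF T M \<xi>] by (auto simp: Pi_iff)
      moreover have "fst (\<Phi> z) = x" using fst[of "fst z" "snd z"] zV z cx by auto
      ultimately show "z \<in> \<Omega>" using * zV unfolding \<Omega>_def by blast
    qed
    note sub = this
    have 1: "compactin (top_of_set V) {snd c x}" using V(1) by simp
    have 2: "compactin (top_of_set {0..2*pi}) {0..2*pi}" by (simp add: compactin_subtopology)
    obtain N N' where N: "openin (top_of_set V) N" "openin (top_of_set {0..2*pi}) N'"
      "{snd c x} \<subseteq> N" "{0..2*pi} \<subseteq> N'" "N \<times> N' \<subseteq> \<Omega>"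
      using Wallace_theorem_prod_topology[OF 1 2 \<Omega> sub] .
    have "open N" using openin_open_trans[OF N(1) V(2)] .
    show "\<exists>V. openin (mtop M) V \<and> x \<in> V \<and> {p \<in> prol_points T M \<xi>. fst p \<in> V} \<subseteq> U"
    proof (intro exI conjI)
      show "openin (mtop M) (fst c \<inter> snd c -` N)" by (rule openin_chart_preimage[OF M C(1) \<open>open N\<close>])
      show "x \<in> fst c \<inter> snd c -` N" using C N(3) by simp
      show "{p \<in> prol_points T M \<xi>. fst p \<in> fst c \<inter> snd c -` N} \<subseteq> U"
      proof
        fix p assume "p \<in> {p \<in> prol_points T M \<xi>. fst p \<in> fst c \<inter> snd c -` N}"
        then have p: "p \<in> prol_points T M \<xi>" "fst p \<in> fst c" "snd c (fst p) \<in> N" by auto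
        then have "snd c (fst p) \<in> V" using openin_imp_subset[OF N(1)] by blast
        from surj[OF p(1,2) this] obtain \<theta> where \<theta>: "\<theta> \<in> {0..2*pi}" "p = \<Phi> (snd c (fst p), \<theta>)" by blast
        then have "(snd c (fst p), \<theta>) \<in> \<Omega>" using N(4,5) p(3) by blast
        then have "\<Phi> (snd c (fst p), \<theta>) \<in> U" unfolding \<Omega>_def by blast
        then show "p \<in> U" using \<theta>(2) by simp
      qed
    qed
  next
    fix x assume x: "x \<in> points M"
    obtain \<Phi> V c where c: "c \<in> charts_at M x" and V: "snd c x \<in> V" "open V" "V \<subseteq> snd c ` fst c"
      and \<Phi>: "continuous_map (prod_topology (top_of_set V) (top_of_set {0..2*pi})) ?P \<Phi>"
      and surj0: "\<forall>p\<in>prol_points T M \<xi>. fst p \<in> fst c \<longrightarrow> snd c (fst p) \<in> V \<longrightarrow> (\<exists>\<theta>\<in>{0..2*pi}. p = \<Phi> (snd c (fst p), \<theta>))"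
      and fst0: "\<forall>q\<in>V. \<forall>\<theta>\<in>{0..2*pi}. fst (\<Phi> (q, \<theta>)) = chart_inv c q"
      using prolongation_circle_chart[OF x] .
    note surj = surj0[rule_format] and fst = fst0[rule_format]
    have C: "c \<in> charts M" "x \<in> fst c" using charts_at_D[OF M c] by blast+
    have cx: "chart_inv c (snd c x) = x" by (rule chart_inv_chart[OF chart_inj[OF M C(1)] C(2)])
    \<comment> \<open>The fibre is the continuous image of the interval of angles, hence
      compact.\<close>
    have "{p \<in> prol_points T M \<xi>. fst p = x} = \<Phi> ` ({snd c x} \<times> {0..2*pi})"
    proof (intro equalityI subsetI)
      fix p assume "p \<in> {p \<in> prol_points T M \<xi>. fst p = x}"
      then have p: "p \<in> prol_points T M \<xi>" "fst p = x" by auto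
      then obtain \<theta> where "\<theta> \<in> {0..2*pi}" "p = \<Phi> (snd c x, \<theta>)" using surj[of p] C(2) V(1) by auto
      then show "p \<in> \<Phi> ` ({snd c x} \<times> {0..2*pi})" by blast
    next
      fix p assume "p \<in> \<Phi> ` ({snd c x} \<times> {0..2*pi})"
      then obtain \<theta> where \<theta>: "\<theta> \<in> {0..2*pi}" "p = \<Phi> (snd c x, \<theta>)" by blast
      then have "p \<in> prol_points T M \<xi>"
        using continuous_map_funspace[OF \<Phi>] V(1) unfolding topspace_prolongation[OF T M \<xi>] by (auto simp: Pi_iff)
      then show "p \<in> {p \<in> prol_points T M \<xi>. fst p = x}" using fst[OF V(1) \<theta>(1)] \<theta>(2) cx by simp
    qed
    note fibre = this
    have "compactin (prod_topology (top_of_set V) (top_of_set {0..2*pi})) ({snd c x} \<times> {0..2*pi})"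
      unfolding compactin_Times using V(1) by (simp add: compactin_subtopology)
    from image_compactin[OF this \<Phi>] show "compactin ?P {p \<in> prol_points T M \<xi>. fst p = x}"
      unfolding fibre .
  qed
qed

end

text \<open>The value does not depend on the chosen vector, since the sign is dropped in the case of lines.
  These functions separate the points of a fibre.\<close>

definition prol_cos :: "real set \<Rightarrow> ('a, 'e::euclidean_space) chart \<Rightarrow> 'e \<Rightarrow> ('a, 'e) prol_point \<Rightarrow> real" where
  "prol_cos T c w p = (let v = (SOME v. v \<in> snd p \<and> v \<noteq> tv_zero); t = v c \<bullet> w / norm (v c) in
     if T = UNIV then \<bar>t\<bar> else t)"

text \<open>Replacing \<open>v\<close> by a multiple changes the cosine by the sign of the scalar,
  which is 1 for rays and removed by the absolute value for lines.\<close>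

lemma prol_cos_eq:
  assumes T: "line_or_ray_scalars T" and v: "v \<noteq> tv_zero"
  shows "prol_cos T c w (x, tv_orbit T v) =
    (if T = UNIV then \<bar>v c \<bullet> w / norm (v c)\<bar> else v c \<bullet> w / norm (v c))"
proof -
  define v' where "v' = (SOME v'. v' \<in> tv_orbit T v \<and> v' \<noteq> tv_zero)"
  have "v' \<in> tv_orbit T v \<and> v' \<noteq> tv_zero"
    unfolding v'_def by (rule someI[of _ v]) (use tv_orbit_self[OF T] v in blast)
  then obtain a where a: "a \<in> T" "v' = tv_scale a v" "a \<noteq> 0"
    unfolding tv_orbit_def using tv_scale_eq_zero_iff by blast
  then have "v' c \<bullet> w / norm (v' c) = (a / \<bar>a\<bar>) * (v c \<bullet> w / norm (v c))"
    by (simp add: tv_scale_def)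
  moreover have "T = UNIV \<or> a / \<bar>a\<bar> = 1"
    using T a(1,3) by (auto simp: line_or_ray_scalars_def)
  moreover have "\<bar>a / \<bar>a\<bar>\<bar> = 1" using a(3) by simp
  ultimately have "(if T = UNIV then \<bar>v' c \<bullet> w / norm (v' c)\<bar> else v' c \<bullet> w / norm (v' c)) =
      (if T = UNIV then \<bar>v c \<bullet> w / norm (v c)\<bar> else v c \<bullet> w / norm (v c))"
    by (auto simp: abs_mult)
  then show ?thesis unfolding prol_cos_def Let_def snd_conv v'_def[symmetric] .
qed

section \<open>Separation of points in the prolongation\<close>

context
  fixes T :: "real set" and M :: "('a, 'e::euclidean_space) mfd" and \<xi> :: "('a, 'e) distrib"
  assumes T: "line_or_ray_scalars T" and M: "manifold M" and \<xi>: "distribution M 2 \<xi>"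
begin

text \<open>The cosine is measured in the fixed chart \<open>c\<close>, while openness is tested in
  frames over other charts \<open>c'\<close>. The coordinate vector is carried over by the
  derivative of the coordinate change, which is continuous in the base point.\<close>

lemma openin_prol_cos:
  assumes c: "c \<in> charts M" and Q: "open Q"
  shows "openin (mtop (prolongation T M \<xi>)) {p \<in> prol_points T M \<xi>. fst p \<in> fst c \<and> prol_cos T c w p \<in> Q}"
  unfolding openin_prolongation[OF T M \<xi>]
proof (intro conjI allI impI)
  fix c' V X Y assume fr: "local_frame_on M \<xi> c' V X Y"
  note D = local_frame_onD[OF fr] and nz = local_frame_on_nonzero[OF fr]
  define S where "S = snd c' ` (fst c' \<inter> fst c)"
  define D' where "D' q = frechet_derivative (snd c \<circ> chart_inv c') (at q)" for q
  define vec where "vec z = D' (fst z) (X (fst z) + snd z *\<^sub>R Y (fst z))" for z :: "'e \<times> real"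
  define k where "k z = (if T = UNIV then \<bar>vec z \<bullet> w / norm (vec z)\<bar> else vec z \<bullet> w / norm (vec z))" for z
  have C2: "C2_on S (snd c \<circ> chart_inv c')" unfolding S_def by (rule C2_on_transition[OF M D(1) c])
  let ?R = "(V \<inter> S) \<times> (UNIV :: real set)"
  have R: "open ?R" using D(2) C2_on_open[OF C2] by (intro open_Times open_Int open_UNIV)
  have cf: "continuous_on ?R fst" "continuous_on ?R snd" "fst ` ?R \<subseteq> V" "fst ` ?R \<subseteq> S"
    by (auto intro: continuous_on_fst continuous_on_snd continuous_on_id)
  have cont: "continuous_on ?R vec"
    unfolding vec_def
  proof (rule continuous_on_apply_linear[where L = "\<lambda>z. D' (fst z)" and w = "\<lambda>z. X (fst z) + snd z *\<^sub>R Y (fst z)"])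
    show "linear (D' (fst z))" if "z \<in> ?R" for z
      unfolding D'_def using that by (intro C2_on_linear[OF C2]) auto
    show "continuous_on ?R (\<lambda>z. D' (fst z) v)" for v
      unfolding D'_def by (rule continuous_on_compose2[OF C2_on_continuous_derivative[OF C2] cf(1,4)])
    show "continuous_on ?R (\<lambda>z. X (fst z) + snd z *\<^sub>R Y (fst z))"
      by (intro continuous_on_add continuous_on_scaleR cf(2)
          continuous_on_compose2[OF D(4) cf(1,3)] continuous_on_compose2[OF D(5) cf(1,3)])
  qed
  have pt: "prol_pt T \<xi> c' q (X q + r *\<^sub>R Y q) \<in> {p \<in> prol_points T M \<xi>. fst p \<in> fst c \<and> prol_cos T c w p \<in> Q}
      \<longleftrightarrow> q \<in> S \<and> k (q, r) \<in> Q" and vec: "q \<in> S \<Longrightarrow> vec (q, r) \<noteq> 0" if q: "q \<in> V" for q r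
  proof -
    have qc: "q \<in> snd c' ` fst c'" using D(3) q by blast
    let ?x = "chart_inv c' q" and ?u = "X q + r *\<^sub>R Y q"
    let ?v = "lift \<xi> c' ?x ?u"
    note x = charts_at_chart_inv[OF T M \<xi> D(1) qc]
    have S: "q \<in> S \<longleftrightarrow> ?x \<in> fst c"
    proof
      assume "q \<in> S"
      then obtain y where "y \<in> fst c'" "y \<in> fst c" "q = snd c' y" unfolding S_def by blast
      then show "?x \<in> fst c" using chart_inv_chart[OF chart_inj[OF M D(1)]] by simp
    next
      assume "?x \<in> fst c"
      then show "q \<in> S"
        unfolding S_def using chart_inv_in[OF qc] x(3) by (intro image_eqI[of _ _ ?x]) simp_all
    qed
    have v: "?v \<in> \<xi> ?x" "?v c' = ?u" "?v \<noteq> tv_zero"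
      using lift_in[OF T M \<xi> qc nz(1)[OF q]] lift_nonzero[OF T M \<xi> D(1) qc nz[OF q]] by blast+
    have vc: "?v c = vec (q, r)" "?v c \<noteq> 0" if "q \<in> S"
    proof -
      have cx: "c \<in> charts_at M ?x" using c S that unfolding charts_at_def by blast
      have "?v \<in> tangent_space M ?x" using distribution_subset[OF M \<xi> x(2)] v(1) by blast
      from tangent_space_transition[OF M this x(1) cx]
      show "?v c = vec (q, r)" unfolding vec_def D'_def fst_conv snd_conv x(3) v(2) .
      show "?v c \<noteq> 0" using distribution_eq_zero_iff[OF M \<xi> cx v(1)] v(3) by blast
    qed
    then show "vec (q, r) \<noteq> 0" if "q \<in> S" using that by metis
    have "prol_cos T c w (prol_pt T \<xi> c' q ?u) = k (q, r)" if "q \<in> S"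
      unfolding prol_pt_def prol_cos_eq[OF T v(3)] k_def vc(1)[OF that] ..
    then show "prol_pt T \<xi> c' q (X q + r *\<^sub>R Y q) \<in> {p \<in> prol_points T M \<xi>. fst p \<in> fst c \<and> prol_cos T c w p \<in> Q}
      \<longleftrightarrow> q \<in> S \<and> k (q, r) \<in> Q"
      using S prol_pt_frame_in[OF T M \<xi> fr q] by (auto simp: prol_pt_def)
  qed
  have "continuous_on ?R (\<lambda>z. vec z \<bullet> w / norm (vec z))"
    by (intro continuous_intros cont) (use vec in auto)
  note t = this
  have "continuous_on ?R k"
  proof (cases "T = UNIV")
    case True
    show ?thesis unfolding k_def if_P[OF True] by (rule continuous_on_rabs[OF t])
  next
    case False
    show ?thesis unfolding k_def if_not_P[OF False] by (rule t)
  qed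
  then have "open (?R \<inter> k -` Q)" using R Q by (rule continuous_open_preimage)
  moreover have "?R \<inter> k -` Q = {(q, r). q \<in> V \<and> prol_pt T \<xi> c' q (X q + r *\<^sub>R Y q) \<in>
      {p \<in> prol_points T M \<xi>. fst p \<in> fst c \<and> prol_cos T c w p \<in> Q}}"
    using pt by (auto simp del: mem_Collect_eq)
  ultimately show "open {(q, r). q \<in> V \<and> prol_pt T \<xi> c' q (X q + r *\<^sub>R Y q) \<in>
      {p \<in> prol_points T M \<xi>. fst p \<in> fst c \<and> prol_cos T c w p \<in> Q}}" by simp
qed blast

text \<open>Directions over different points are separated by the base. Over one point the cosine
  against the direction of \<open>p\<close> itself is used; it takes its maximum only there.\<close>

lemma Hausdorff_prolongation: "Hausdorff_space (mtop (prolongation T M \<xi>))"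
  unfolding Hausdorff_space_def topspace_prolongation[OF T M \<xi>]
proof (intro allI impI)
  let ?P = "mtop (prolongation T M \<xi>)"
  fix p p' assume *: "p \<in> prol_points T M \<xi> \<and> p' \<in> prol_points T M \<xi> \<and> p \<noteq> p'"
  then have pts: "fst p \<in> points M" "fst p' \<in> points M" unfolding prol_points_def by auto
  show "\<exists>U V. openin ?P U \<and> openin ?P V \<and> p \<in> U \<and> p' \<in> V \<and> disjnt U V"
  proof (cases "fst p = fst p'")
    case False
    then obtain U V where UV: "openin (mtop M) U" "openin (mtop M) V" "fst p \<in> U" "fst p' \<in> V" "disjnt U V"
      using manifold_Hausdorff[OF M] pts unfolding Hausdorff_space_def manifold_topspace[OF M] by blast
    have o: "openin ?P {p \<in> prol_points T M \<xi>. fst p \<in> W}" if "openin (mtop M) W" for W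
      using openin_continuous_map_preimage[OF continuous_map_fst_prolongation[OF T M \<xi>] that]
      unfolding topspace_prolongation[OF T M \<xi>] .
    show ?thesis
      using o[OF UV(1)] o[OF UV(2)] UV(3-5) *
      by (intro exI[of _ "{p \<in> prol_points T M \<xi>. fst p \<in> U}"] exI[of _ "{p \<in> prol_points T M \<xi>. fst p \<in> V}"])
        (auto simp: disjnt_def)
  next
    case True
    obtain c where c: "c \<in> charts_at M (fst p)" using charts_at_ex[OF M pts(1)] by blast
    have C: "c \<in> charts M" "fst p \<in> fst c" "fst p' \<in> fst c" using charts_at_D[OF M c] True by auto
    obtain q u where u: "q \<in> snd c ` fst c" "q = snd c (fst p)" "u \<in> coord_distrib c \<xi> q" "u \<noteq> 0" "p = prol_pt T \<xi> c q u"
      by (rule prol_points_cases[OF T M \<xi> conjunct1[OF *] C(1,2)])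
    obtain q' u' where u': "q' \<in> snd c ` fst c" "q' = snd c (fst p')" "u' \<in> coord_distrib c \<xi> q'" "u' \<noteq> 0" "p' = prol_pt T \<xi> c q' u'"
      by (rule prol_points_cases[OF T M \<xi> conjunct1[OF conjunct2[OF *]] C(1,3)])
    have qq: "q' = q" using u(2) u'(2) True by simp
    have k: "prol_cos T c u (prol_pt T \<xi> c q y) = (if T = UNIV then \<bar>y \<bullet> u / norm y\<bar> else y \<bullet> u / norm y)"
      if y: "y \<in> coord_distrib c \<xi> q" "y \<noteq> 0" for y
      unfolding prol_pt_def prol_cos_eq[OF T lift_nonzero[OF T M \<xi> C(1) u(1) y]]
        lift_in(2)[OF T M \<xi> u(1) y(1)] ..
    have uu: "u \<bullet> u / norm u = norm u" using u(4) by (simp add: dot_square_norm power2_eq_square)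
    \<comment> \<open>Equal values mean equality in the Cauchy-Schwarz inequality, so
      \<open>u'\<close> is a multiple of \<open>u\<close>; without the absolute value the multiple
      is positive.\<close>
    have "prol_cos T c u p \<noteq> prol_cos T c u p'"
    proof
      assume "prol_cos T c u p = prol_cos T c u p'"
      then have eq: "norm u = (if T = UNIV then \<bar>u' \<bullet> u / norm u'\<bar> else u' \<bullet> u / norm u')"
        using uu unfolding u(5) u'(5) qq k[OF u(3,4)] k[OF u'(3,4)[unfolded qq]]
        by (auto split: if_splits)
      have "\<exists>a\<in>T. a \<noteq> 0 \<and> u' = a *\<^sub>R u"
      proof (cases "T = UNIV")
        case True
        then have "\<bar>u' \<bullet> u\<bar> = norm u' * norm u" using eq u'(4) by (simp add: field_simps)
        then have "norm u' *\<^sub>R u = norm u *\<^sub>R u' \<or> norm u' *\<^sub>R u = - norm u *\<^sub>R u'"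
          by (simp only: norm_cauchy_schwarz_abs_eq)
        then show ?thesis
        proof
          assume "norm u' *\<^sub>R u = norm u *\<^sub>R u'"
          from scaleR_solve[OF _ this] have "u' = (norm u' / norm u) *\<^sub>R u" using u(4) by simp
          then show ?thesis using True u(4) u'(4) by (intro bexI[of _ "norm u' / norm u"]) auto
        next
          assume "norm u' *\<^sub>R u = - norm u *\<^sub>R u'"
          from scaleR_solve[OF _ this] have "u' = (- (norm u' / norm u)) *\<^sub>R u" using u(4) by simp
          then show ?thesis using True u(4) u'(4) by (intro bexI[of _ "- (norm u' / norm u)"]) auto
        qed
      next
        case False
        then have "u' \<bullet> u = norm u' * norm u" using eq u'(4) by (simp add: field_simps)
        then have "norm u' *\<^sub>R u = norm u *\<^sub>R u'" by (simp only: norm_cauchy_schwarz_eq)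
        from scaleR_solve[OF _ this] have "u' = (norm u' / norm u) *\<^sub>R u" using u(4) by simp
        then show ?thesis using line_or_ray_scalars_pos[OF T, of "norm u' / norm u"] u(4) u'(4)
          by (intro bexI[of _ "norm u' / norm u"]) auto
      qed
      then have "p' = p" unfolding u(5) u'(5) qq using prol_pt_scale[OF T M \<xi> C(1) u(1,3)] by blast
      then show False using * by blast
    qed
    then obtain Q Q' where Q: "open Q" "open Q'" "prol_cos T c u p \<in> Q" "prol_cos T c u p' \<in> Q'" "Q \<inter> Q' = {}"
      using hausdorff by metis
    show ?thesis
    proof (intro exI conjI)
      show "openin ?P {p \<in> prol_points T M \<xi>. fst p \<in> fst c \<and> prol_cos T c u p \<in> Q}"
        by (rule openin_prol_cos[OF C(1) Q(1)])
      show "openin ?P {p \<in> prol_points T M \<xi>. fst p \<in> fst c \<and> prol_cos T c u p \<in> Q'}"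
        by (rule openin_prol_cos[OF C(1) Q(2)])
    qed (use * C Q in \<open>auto simp: disjnt_def\<close>)
  qed
qed

end

section \<open>Prolonged maps and their properness\<close>

lemma prol_map_prol_pt:
  assumes T: "line_or_ray_scalars T" and M: "manifold M" and N: "manifold N"
    and \<xi>: "distribution M 2 \<xi>" and \<eta>: "distribution N 2 \<eta>" and f: "smooth_map M N f"
    and pres: "\<forall>x\<in>points M. \<forall>v\<in>\<xi> x. differential M N f x v \<in> \<eta> (f x)"
    and inj: "\<forall>x\<in>points M. \<forall>v\<in>\<xi> x. differential M N f x v = tv_zero \<longrightarrow> v = tv_zero"
    and c: "c \<in> charts M" "q \<in> snd c ` fst c" and d: "d \<in> charts_at N (f (chart_inv c q))"
    and u: "u \<in> coord_distrib c \<xi> q" "u \<noteq> 0"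
  defines "q' \<equiv> snd d (f (chart_inv c q))"
    and "u' \<equiv> frechet_derivative (snd d \<circ> f \<circ> chart_inv c) (at q) u"
  shows "prol_map M N f (prol_pt T \<xi> c q u) = prol_pt T \<eta> d q' u'"
    and "u' \<in> coord_distrib d \<eta> q'" and "u' \<noteq> 0"
proof -
  let ?x = "chart_inv c q" and ?v = "lift \<xi> c (chart_inv c q) u"
  note x = charts_at_chart_inv[OF T M \<xi> c]
  have v: "?v \<in> \<xi> ?x" "?v c = u" "?v \<noteq> tv_zero"
    using lift_in[OF T M \<xi> c(2) u(1)] lift_nonzero[OF T M \<xi> c u] by blast+
  have vt: "?v \<in> tangent_space M ?x" using distribution_subset[OF M \<xi> x(2)] v(1) by blast
  have df: "diff_at M N f ?x" by (rule smooth_map_diff_at[OF M N f x(2)])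
  let ?w = "differential M N f ?x ?v"
  have w: "?w \<in> \<eta> (f ?x)" "?w \<noteq> tv_zero" using pres inj x(2) v(1,3) by blast+
  have wd: "?w d = u'"
    unfolding u'_def differential_eq[OF M N df vt x(1) d] x(3) v(2) ..
  have D: "d \<in> charts N" "f ?x \<in> fst d" using charts_at_D[OF N d] by blast+
  have fx: "chart_inv d q' = f ?x" unfolding q'_def by (rule chart_inv_chart[OF chart_inj[OF N D(1)] D(2)])
  show "u' \<in> coord_distrib d \<eta> q'"
    unfolding q'_def coord_distrib_chart[OF N \<eta> d] using w(1) wd by blast
  show "u' \<noteq> 0" using distribution_eq_zero_iff[OF N \<eta> d w(1)] w(2) wd by simp
  show "prol_map M N f (prol_pt T \<xi> c q u) = prol_pt T \<eta> d q' u'"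
    unfolding prol_map_def prol_pt_def split_conv fx differential_orbit[OF M N df vt]
      wd[symmetric] lift_coord[OF T N \<eta> d w(1)] ..
qed

text \<open>In homogeneous coordinates the prolonged map is \<open>f\<close> on the base and its
  derivative on the vector, both continuous. One chart of the target serves only near a given point,
  so continuity is first obtained locally and then patched.\<close>

lemma continuous_map_prol_map:
  assumes T: "line_or_ray_scalars T" and M: "manifold M" and N: "manifold N"
    and \<xi>: "distribution M 2 \<xi>" and \<eta>: "distribution N 2 \<eta>" and f: "smooth_map M N f"
    and pres: "\<forall>x\<in>points M. \<forall>v\<in>\<xi> x. differential M N f x v \<in> \<eta> (f x)"
    and inj: "\<forall>x\<in>points M. \<forall>v\<in>\<xi> x. differential M N f x v = tv_zero \<longrightarrow> v = tv_zero"
  shows "continuous_map (mtop (prolongation T M \<xi>)) (mtop (prolongation T N \<eta>)) (prol_map M N f)"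
proof -
  note pt = prol_map_prol_pt[OF T M N \<xi> \<eta> f pres inj]
  have image: "prol_map M N f (prol_pt T \<xi> c q u) \<in> prol_points T N \<eta>"
    if c: "c \<in> charts M" "q \<in> snd c ` fst c" and u: "u \<in> coord_distrib c \<xi> q" "u \<noteq> 0" for c q u
  proof -
    have "f (chart_inv c q) \<in> points N"
      using smooth_map_in_points[OF M N f charts_at_chart_inv(2)[OF T M \<xi> c]] .
    then obtain d where d: "d \<in> charts_at N (f (chart_inv c q))" using charts_at_ex[OF N] by blast
    have D: "d \<in> charts N" "snd d (f (chart_inv c q)) \<in> snd d ` fst d" using charts_at_D[OF N d] by blast+
    show ?thesis unfolding pt(1)[OF c d u]
      using prol_pt_in[OF T N \<eta> D] pt(2,3)[OF c d u] by blast
  qed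
  show ?thesis
  proof (rule continuous_map_from_prolongation[OF T M \<xi>])
    fix p assume p: "p \<in> prol_points T M \<xi>"
    then have "fst p \<in> points M" unfolding prol_points_def by auto
    then obtain c where c: "c \<in> charts_at M (fst p)" using charts_at_ex[OF M] by blast
    have C: "c \<in> charts M" "fst p \<in> fst c" using charts_at_D[OF M c] by blast+
    obtain q u where u: "q \<in> snd c ` fst c" "q = snd c (fst p)" "u \<in> coord_distrib c \<xi> q" "u \<noteq> 0" "p = prol_pt T \<xi> c q u"
      by (rule prol_points_cases[OF T M \<xi> p C])
    show "prol_map M N f p \<in> topspace (mtop (prolongation T N \<eta>))"
      unfolding topspace_prolongation[OF T N \<eta>] u(5) by (rule image[OF C(1) u(1,3,4)])
  next
    fix c V X Z assume fr: "local_frame_on M \<xi> c V X Z"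
    note D = local_frame_onD[OF fr] and nz = local_frame_on_nonzero[OF fr]
    let ?u = "\<lambda>z :: 'b \<times> real. X (fst z) + snd z *\<^sub>R Z (fst z)"
    let ?F = "\<lambda>z. prol_map M N f (prol_pt T \<xi> c (fst z) (?u z))"
    have loc: "\<exists>S. openin (top_of_set (V \<times> (UNIV :: real set))) S \<and> z0 \<in> S \<and>
        continuous_map (subtopology (top_of_set (V \<times> UNIV)) S) (mtop (prolongation T N \<eta>)) ?F"
      if z0: "z0 \<in> V \<times> (UNIV :: real set)" for z0
    proof -
      have q0: "fst z0 \<in> V" "fst z0 \<in> snd c ` fst c" using z0 D(3) by auto
      have "f (chart_inv c (fst z0)) \<in> points N"
        using smooth_map_in_points[OF M N f charts_at_chart_inv(2)[OF T M \<xi> D(1) q0(2)]] .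
      then obtain d where d: "d \<in> charts_at N (f (chart_inv c (fst z0)))" using charts_at_ex[OF N] by blast
      have dN: "d \<in> charts N" "f (chart_inv c (fst z0)) \<in> fst d" using charts_at_D[OF N d] by blast+
      define W where "W = V \<inter> snd c ` (fst c \<inter> f -` fst d)"
      have C2: "C2_on W (snd d \<circ> f \<circ> chart_inv c)"
        using smooth_map_rep[OF M N f D(1) dN(1)] D(2) C2_on_open[OF smooth_map_rep[OF M N f D(1) dN(1)]]
        unfolding W_def by (auto intro: C2_on_subset)
      have Wd: "q \<in> V" "q \<in> snd c ` fst c" "d \<in> charts_at N (f (chart_inv c q))" if "q \<in> W" for q
        using that D(3) dN(1) chart_inv_chart[OF chart_inj[OF M D(1)]] unfolding W_def charts_at_def by auto
      have "fst z0 \<in> W"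
        unfolding W_def using q0(1) dN(2) chart_inv_in[OF q0(2)] chart_chart_inv[OF q0(2)]
        by (intro IntI image_eqI[of _ _ "chart_inv c (fst z0)"]) simp_all
      let ?S = "W \<times> (UNIV :: real set)"
      have sub: "?S \<subseteq> V \<times> UNIV" unfolding W_def by blast
      have "open ?S" using C2_on_open[OF C2] by (intro open_Times open_UNIV)
      then have "openin (top_of_set (V \<times> UNIV)) ?S" using sub openin_open_eq[OF open_Times[OF D(2) open_UNIV]] by blast
      moreover have "z0 \<in> ?S" using \<open>fst z0 \<in> W\<close> by (simp add: mem_Times_iff)
      moreover have "subtopology (top_of_set (V \<times> UNIV)) ?S = top_of_set ?S"
        using sub by (simp add: subtopology_subtopology Int_absorb1)
      moreover have "continuous_map (top_of_set ?S) (mtop (prolongation T N \<eta>)) ?F"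
      proof -
        let ?q = "\<lambda>z :: 'b \<times> real. (snd d \<circ> f \<circ> chart_inv c) (fst z)"
        let ?v = "\<lambda>z. frechet_derivative (snd d \<circ> f \<circ> chart_inv c) (at (fst z)) (?u z)"
        have cf: "continuous_on ?S fst" "continuous_on ?S snd" "fst ` ?S \<subseteq> W" "fst ` ?S \<subseteq> V"
          using sub by (auto intro: continuous_on_fst continuous_on_snd continuous_on_id)
        have "continuous_map (top_of_set ?S) (mtop (prolongation T N \<eta>)) (\<lambda>z. prol_pt T \<eta> d (?q z) (?v z))"
        proof (rule continuous_map_prol_pt[OF T N \<eta> dN(1)])
          show "continuous_on ?S ?q"
            by (rule continuous_on_compose2[OF C2_on_continuous[OF C2] cf(1,3)])
          show "continuous_on ?S ?v"
          proof (rule continuous_on_apply_linear[where w = ?u and L = "\<lambda>z. frechet_derivative (snd d \<circ> f \<circ> chart_inv c) (at (fst z))"])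
            show "linear (frechet_derivative (snd d \<circ> f \<circ> chart_inv c) (at (fst z)))" if "z \<in> ?S" for z
              using that by (intro C2_on_linear[OF C2]) auto
            show "continuous_on ?S (\<lambda>z. frechet_derivative (snd d \<circ> f \<circ> chart_inv c) (at (fst z)) v)" for v
              by (rule continuous_on_compose2[OF C2_on_continuous_derivative[OF C2] cf(1,3)])
            show "continuous_on ?S ?u"
              by (intro continuous_on_add continuous_on_scaleR cf(2)
                  continuous_on_compose2[OF D(4) cf(1,4)] continuous_on_compose2[OF D(5) cf(1,4)])
          qed
          fix z assume "z \<in> ?S"
          then have z: "fst z \<in> W" by auto
          note zW = Wd[OF z]
          show "?q z \<in> snd d ` fst d" using charts_at_D[OF N zW(3)] by simp
          show "?v z \<in> coord_distrib d \<eta> (?q z)" "?v z \<noteq> 0"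
            using pt(2,3)[OF D(1) zW(2,3) nz[OF zW(1)]] by simp_all
        qed
        note cm = this
        have e: "?F z = prol_pt T \<eta> d (?q z) (?v z)" if "z \<in> ?S" for z
        proof -
          have z: "fst z \<in> W" using that by auto
          note zW = Wd[OF z]
          show ?thesis using pt(1)[OF D(1) zW(2,3) nz[OF zW(1)]] by simp
        qed
        show ?thesis by (rule continuous_map_eq[OF cm]) (rule e[symmetric], simp)
      qed
      ultimately show ?thesis by (intro exI[of _ ?S]) simp
    qed
    show "continuous_map (top_of_set (V \<times> UNIV)) (mtop (prolongation T N \<eta>)) ?F"
      unfolding continuous_map_def
    proof (intro conjI allI impI)
      show "?F \<in> topspace (top_of_set (V \<times> UNIV)) \<rightarrow> topspace (mtop (prolongation T N \<eta>))"
        unfolding topspace_prolongation[OF T N \<eta>]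
        by (rule Pi_I) (use image[OF D(1)] D(3) nz in auto)
      fix U assume U: "openin (mtop (prolongation T N \<eta>)) U"
      have "\<exists>S. openin (top_of_set (V \<times> (UNIV :: real set))) S \<and> z0 \<in> S \<and> S \<subseteq> {z \<in> V \<times> UNIV. ?F z \<in> U}"
        if z0: "z0 \<in> V \<times> (UNIV :: real set)" "?F z0 \<in> U" for z0
      proof -
        obtain S where S: "openin (top_of_set (V \<times> (UNIV :: real set))) S" "z0 \<in> S"
          "continuous_map (subtopology (top_of_set (V \<times> UNIV)) S) (mtop (prolongation T N \<eta>)) ?F"
          using loc[OF z0(1)] by blast
        let ?S' = "{z \<in> topspace (subtopology (top_of_set (V \<times> UNIV)) S). ?F z \<in> U}"
        have "openin (top_of_set (V \<times> UNIV)) ?S'"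
          using openin_trans_full[OF openin_continuous_map_preimage[OF S(3) U] S(1)] .
        moreover have "z0 \<in> ?S'" "?S' \<subseteq> {z \<in> V \<times> UNIV. ?F z \<in> U}" using S(2) z0 by auto
        ultimately show ?thesis by blast
      qed
      then have "openin (top_of_set (V \<times> UNIV)) {z \<in> V \<times> UNIV. ?F z \<in> U}"
        by (subst openin_subopen) blast
      then show "openin (top_of_set (V \<times> UNIV)) {z \<in> topspace (top_of_set (V \<times> UNIV)). ?F z \<in> U}" by simp
    qed
  qed
qed

text \<open>The paired map and its prolongation form a commuting square with the bundle projections,
  which are proper. Downwards, the surjective projection \<open>fst\<close> is cancelled on the
  right of a proper composite. Upwards, the projection \<open>?\<pi>\<close> is cancelled on the
  left, which is allowed because its domain is Hausdorff.\<close>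

lemma proper_map_prolongation_iff:
  assumes T: "line_or_ray_scalars T" and M: "manifold M" and N: "manifold N"
    and \<xi>: "distribution M 2 \<xi>" and \<eta>: "distribution N 2 \<eta>"
    and s: "continuous_map (mtop (prolongation T M \<xi>)) (mtop (prolongation T N \<eta>)) (prol_map M N s)"
    and t: "continuous_map (mtop (prolongation T M \<xi>)) (mtop (prolongation T N \<eta>)) (prol_map M N t)"
  shows "proper_map (mtop (prolongation T M \<xi>)) (prod_topology (mtop (prolongation T N \<eta>)) (mtop (prolongation T N \<eta>)))
      (\<lambda>p. (prol_map M N s p, prol_map M N t p)) \<longleftrightarrow>
    proper_map (mtop M) (prod_topology (mtop N) (mtop N)) (\<lambda>x. (s x, t x))"
proof
  let ?P = "mtop (prolongation T M \<xi>)" and ?Q = "mtop (prolongation T N \<eta>)"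
  let ?F = "\<lambda>p. (prol_map M N s p, prol_map M N t p)" and ?f = "\<lambda>x. (s x, t x)"
  let ?\<pi> = "\<lambda>(p, p'). (fst p, fst p')"
  have eq: "?\<pi> \<circ> ?F = ?f \<circ> fst" by (auto simp: fun_eq_iff prol_map_def split: prod.splits)
  note proj = continuous_map_fst_prolongation[OF T M \<xi>] proper_map_fst_prolongation[OF T M \<xi>]
  note proj' = continuous_map_fst_prolongation[OF T N \<eta>] proper_map_fst_prolongation[OF T N \<eta>]
  {
    assume "proper_map ?P (prod_topology ?Q ?Q) ?F"
    moreover have "proper_map (prod_topology ?Q ?Q) (prod_topology (mtop N) (mtop N)) ?\<pi>"
      using proper_map_prod proj'(2) by blast
    ultimately have "proper_map ?P (prod_topology (mtop N) (mtop N)) (?\<pi> \<circ> ?F)" by (rule proper_map_compose)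
    then have "proper_map ?P (prod_topology (mtop N) (mtop N)) (?f \<circ> fst)" unfolding eq .
    then show "proper_map (mtop M) (prod_topology (mtop N) (mtop N)) ?f"
      using proj(1) by (rule proper_map_from_composition_left)
        (simp add: topspace_prolongation[OF T M \<xi>] fst_prol_points[OF T M \<xi>] manifold_topspace[OF M])
  }
  assume f: "proper_map (mtop M) (prod_topology (mtop N) (mtop N)) ?f"
  have "proper_map ?P (prod_topology (mtop N) (mtop N)) (?f \<circ> fst)" using proj(2) f by (rule proper_map_compose)
  then have 1: "proper_map ?P (prod_topology (mtop N) (mtop N)) (?\<pi> \<circ> ?F)" unfolding eq .
  have 2: "Hausdorff_space (prod_topology ?Q ?Q)"
    using Hausdorff_prolongation[OF T N \<eta>] Hausdorff_space_prod_topology by blast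
  have 3: "continuous_map ?P (prod_topology ?Q ?Q) ?F" using s t by (rule continuous_map_pairedI)
  have "continuous_map (prod_topology ?Q ?Q) (prod_topology (mtop N) (mtop N)) (\<lambda>z. (fst (fst z), fst (snd z)))"
    using continuous_map_compose[OF continuous_map_fst proj'(1)] continuous_map_compose[OF continuous_map_snd proj'(1)]
    by (intro continuous_map_pairedI) (simp_all add: o_def)
  then have 4: "continuous_map (prod_topology ?Q ?Q) (prod_topology (mtop N) (mtop N)) ?\<pi>"
    by (simp add: case_prod_unfold)
  show "proper_map ?P (prod_topology ?Q ?Q) ?F" by (rule proper_map_from_composition_right[OF 2 1 3 4])
qed


section \<open>Local sections of the source map\<close>

lemma openin_open_submfd:
  assumes M: "manifold M"
  shows "openin (mtop (open_submfd M W)) U \<longleftrightarrow> U \<subseteq> W \<and> openin (mtop M) U"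
proof -
  have "inj_on (snd c) (fst c)" if "c \<in> charts (open_submfd M W)" for c
    using that chart_inj[OF M] inj_on_subset unfolding open_submfd_def by fastforce
  then have "openin (mtop (open_submfd M W)) U \<longleftrightarrow> U \<subseteq> points (open_submfd M W) \<and>
      (\<forall>c\<in>charts (open_submfd M W). open (snd c ` (U \<inter> fst c)))"
    by (rule openin_mtop)
  also have "\<dots> \<longleftrightarrow> U \<subseteq> points M \<inter> W \<and> (\<forall>c\<in>charts M. open (snd c ` (U \<inter> (fst c \<inter> W))))"
    unfolding open_submfd_def by simp
  also have "\<dots> \<longleftrightarrow> U \<subseteq> points M \<inter> W \<and> (\<forall>c\<in>charts M. open (snd c ` (U \<inter> fst c)))"
  proof -
    have "U \<inter> (D \<inter> W) = U \<inter> D" if "U \<subseteq> points M \<inter> W" for D using that by blast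
    then show ?thesis by (intro conj_cong refl) simp
  qed
  finally show ?thesis unfolding manifold_openin[OF M] by blast
qed

lemma topspace_open_submfd:
  assumes M: "manifold M" and W: "openin (mtop M) W"
  shows "topspace (mtop (open_submfd M W)) = W"
proof
  show "topspace (mtop (open_submfd M W)) \<subseteq> W"
    using openin_open_submfd[OF M] openin_topspace by blast
  show "W \<subseteq> topspace (mtop (open_submfd M W))"
    using openin_open_submfd[OF M, of W W] W openin_subset by blast
qed

text \<open>Restates a local diffeomorphism through the charts of \<open>M\<close> and
  \<open>N\<close> themselves, eliminating the restricted charts of the open submanifolds, and
  records that it maps small open sets to open sets.\<close>

lemma local_diffeo_nbhd:
  assumes M: "manifold M" and N: "manifold N" and f: "local_diffeo M N f" and x: "x \<in> points M"
  obtains W where "x \<in> W" "openin (mtop M) W" "inj_on f W"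
    "\<forall>U. U \<subseteq> W \<longrightarrow> openin (mtop M) U \<longrightarrow> openin (mtop N) (f ` U)"
    "\<forall>c\<in>charts M. \<forall>d\<in>charts N. C2_on (snd d ` (fst d \<inter> f ` (W \<inter> fst c))) (snd c \<circ> inv_into W f \<circ> chart_inv d)"
proof -
  obtain W where W: "x \<in> W" "openin (mtop M) W" "openin (mtop N) (f ` W)"
    and df: "diffeo (open_submfd M W) (open_submfd N (f ` W)) f"
    using f x unfolding local_diffeo_def by blast
  have WM: "W \<subseteq> points M" using openin_subset[OF W(2)] manifold_topspace[OF M] by simp
  have pM: "points (open_submfd M W) = W" using WM unfolding open_submfd_def by auto
  let ?g = "inv_into W f"
  have inj: "inj_on f W" using df unfolding diffeo_def pM bij_betw_def by blast
  have g: "smooth_map (open_submfd N (f ` W)) (open_submfd M W) ?g"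
    using df unfolding diffeo_def pM by blast
  have op: "openin (mtop N) (f ` U)" if U: "U \<subseteq> W" "openin (mtop M) U" for U
  proof -
    have "openin (mtop (open_submfd M W)) U" using U openin_open_submfd[OF M] by blast
    from openin_continuous_map_preimage[OF smooth_map_continuous[OF g] this]
    have "openin (mtop (open_submfd N (f ` W))) {y \<in> f ` W. ?g y \<in> U}"
      unfolding topspace_open_submfd[OF N W(3)] .
    moreover have "{y \<in> f ` W. ?g y \<in> U} = f ` U"
      using U(1) inv_into_f_f[OF inj] by (auto simp: subset_iff)
    ultimately show ?thesis using openin_open_submfd[OF N] by simp
  qed
  have "C2_on (snd d ` (fst d \<inter> f ` (W \<inter> fst c))) (snd c \<circ> ?g \<circ> chart_inv d)"
    if c: "c \<in> charts M" and d: "d \<in> charts N" for c d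
  proof -
    let ?c = "(fst c \<inter> W, snd c)" and ?d = "(fst d \<inter> f ` W, snd d)"
    have "?c \<in> charts (open_submfd M W)" "?d \<in> charts (open_submfd N (f ` W))"
      using c d unfolding open_submfd_def by auto
    then have "smooth_on (snd ?d ` (fst ?d \<inter> ?g -` fst ?c)) (snd ?c \<circ> ?g \<circ> chart_inv ?d)"
      using g unfolding smooth_map_def by blast
    moreover have "fst ?d \<inter> ?g -` fst ?c = fst d \<inter> f ` (W \<inter> fst c)"
      using inv_into_f_f[OF inj] by (auto intro: inv_into_into)
    moreover have "open (snd d ` (fst d \<inter> f ` (W \<inter> fst c)))"
      using op[of "W \<inter> fst c"] openin_Int[OF W(2) openin_chart_dom[OF M c]] open_chart_image_of[OF N d] by blast
    ultimately have C2: "C2_on (snd d ` (fst d \<inter> f ` (W \<inter> fst c))) (snd c \<circ> ?g \<circ> chart_inv ?d)"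
      by (simp add: smooth_on_imp_C2_on)
    \<comment> \<open>The inverse of a restricted chart is a different choice function, but both
      inverses agree on the image of the restricted domain.\<close>
    show ?thesis
    proof (rule C2_on_cong[OF C2])
      fix q assume "q \<in> snd d ` (fst d \<inter> f ` (W \<inter> fst c))"
      then obtain y where y: "y \<in> fst d" "y \<in> f ` W" "q = snd d y" by blast
      have i: "inj_on (snd d) (fst d)" by (rule chart_inj[OF N d])
      have "chart_inv d q = y" using chart_inv_chart[OF i y(1)] y(3) by simp
      moreover have "chart_inv ?d q = y"
        using chart_inv_chart[of ?d y] inj_on_subset[OF i, of "fst d \<inter> f ` W"] y by simp
      ultimately show "(snd c \<circ> ?g \<circ> chart_inv ?d) q = (snd c \<circ> ?g \<circ> chart_inv d) q" by simp
    qed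
  qed
  then show thesis using that[OF W(1,2) inj] op by blast
qed

text \<open>Chain rule for the local inverse composed with \<open>f\<close>, which is the identity
  near \<open>snd c x\<close>.\<close>

lemma local_diffeo_left_inverse:
  assumes M: "manifold M" and N: "manifold N" and f: "smooth_map M N f"
    and W: "openin (mtop M) W" "inj_on f W"
    and h: "C2_on (snd d ` (fst d \<inter> f ` (W \<inter> fst c))) (snd c \<circ> inv_into W f \<circ> chart_inv d)"
    and x: "x \<in> W" "c \<in> charts_at M x" "d \<in> charts_at N (f x)"
  shows "frechet_derivative (snd c \<circ> inv_into W f \<circ> chart_inv d) (at (snd d (f x)))
    (frechet_derivative (snd d \<circ> f \<circ> chart_inv c) (at (snd c x)) u) = u"
proof -
  let ?h = "snd c \<circ> inv_into W f \<circ> chart_inv d" and ?r = "snd d \<circ> f \<circ> chart_inv c"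
  have C: "c \<in> charts M" "x \<in> fst c" "x \<in> points M" using charts_at_D[OF M x(2)] by blast+
  have D: "d \<in> charts N" "f x \<in> fst d" using charts_at_D[OF N x(3)] by blast+
  note df = smooth_map_diff_at[OF M N f C(3)]
  note rep = diff_at_rep[OF M N df x(2,3)]
  have rx: "?r (snd c x) = snd d (f x)" using chart_inv_chart[OF chart_inj[OF M C(1)] C(2)] by simp
  have "snd d (f x) \<in> snd d ` (fst d \<inter> f ` (W \<inter> fst c))" using D(2) x(1) C(2) by blast
  then have "?h differentiable (at (snd d (f x)))" using h unfolding C2_on_def by blast
  then have hd: "?h differentiable (at (?r (snd c x)))" unfolding rx .
  have eq: "\<forall>\<^sub>F q in nhds (snd c x). q = (?h \<circ> ?r) q"
    using rep(1) eventually_chart_inv[OF M x(2) W(1) x(1)]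
  proof eventually_elim
    case (elim q)
    then show ?case
      using chart_inv_chart[OF chart_inj[OF N D(1)]] inv_into_f_f[OF W(2)] chart_chart_inv[of q c] by simp
  qed
  have "frechet_derivative (?h \<circ> ?r) (at (snd c x)) u = frechet_derivative (\<lambda>q. q) (at (snd c x)) u"
    by (subst differentiable_cong_nhds(2)[OF eq]) simp_all
  then show ?thesis unfolding frechet_derivative_comp[OF rep(2) hd] rx by simp
qed

lemma local_diffeo_differential_inj:
  assumes M: "manifold M" and N: "manifold N" and f: "smooth_map M N f" "local_diffeo M N f"
    and v: "v \<in> tangent_space M x" "w \<in> tangent_space M x" "x \<in> points M"
    and eq: "differential M N f x v = differential M N f x w"
  shows "v = w"
proof -
  obtain W where W: "x \<in> W" "openin (mtop M) W" "inj_on f W"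
    "\<forall>U. U \<subseteq> W \<longrightarrow> openin (mtop M) U \<longrightarrow> openin (mtop N) (f ` U)"
    "\<forall>c\<in>charts M. \<forall>d\<in>charts N. C2_on (snd d ` (fst d \<inter> f ` (W \<inter> fst c))) (snd c \<circ> inv_into W f \<circ> chart_inv d)"
    using local_diffeo_nbhd[OF M N f(2) v(3)] .
  obtain c where c: "c \<in> charts_at M x" using charts_at_ex[OF M v(3)] by blast
  obtain d where d: "d \<in> charts_at N (f x)" using charts_at_ex[OF N smooth_map_in_points[OF M N f(1) v(3)]] by blast
  have C2: "C2_on (snd d ` (fst d \<inter> f ` (W \<inter> fst c))) (snd c \<circ> inv_into W f \<circ> chart_inv d)"
    using W(5) charts_at_D[OF M c] charts_at_D[OF N d] by blast
  note df = smooth_map_diff_at[OF M N f(1) v(3)]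
  note inverse = local_diffeo_left_inverse[OF M N f(1) W(2,3) C2 W(1) c d]
  have "v c = w c"
    using inverse[of "v c"] inverse[of "w c"] eq
    unfolding differential_eq[OF M N df v(1) c d, symmetric] differential_eq[OF M N df v(2) c d, symmetric] by simp
  then show ?thesis by (rule tangent_space_eqI[OF M v(1,2) c])
qed

text \<open>A branch of the inverse of the source, parametrised by coordinates. In contrast to
  \<open>germ_map\<close> it keeps the arrows, so that sections can be multiplied.\<close>

definition local_section ::
  "('a, 'b, 'e::euclidean_space, 'm) groupoid_scheme \<Rightarrow> ('a, 'e) chart \<Rightarrow> 'e set \<Rightarrow> ('e \<Rightarrow> 'b) \<Rightarrow> bool" where
  "local_section G c U S \<longleftrightarrow> c \<in> charts (Obj G) \<and> open U \<and> U \<subseteq> snd c ` fst c \<and>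
     continuous_map (top_of_set U) (mtop (Arr G)) S \<and> (\<forall>q\<in>U. src G (S q) = chart_inv c q)"

section \<open>Groupoid operations and sections of the source\<close>

context
  fixes G :: "('a, 'b, 'e::euclidean_space, 'm) groupoid_scheme"
  assumes G: "etale_lie_groupoid G"
begin

lemma manifold_Obj: "manifold (Obj G)" and manifold_Arr: "manifold (Arr G)"
  and smooth_src: "smooth_map (Arr G) (Obj G) (src G)" and smooth_tgt: "smooth_map (Arr G) (Obj G) (tgt G)"
  and smooth_ident: "smooth_map (Obj G) (Arr G) (ident G)"
  and smooth_gmult: "smooth_map (composable G) (Arr G) (\<lambda>(\<sigma>, \<tau>). gmult G \<sigma> \<tau>)"
  and local_diffeo_src: "local_diffeo (Arr G) (Obj G) (src G)"
  using G unfolding etale_lie_groupoid_def by blast+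

lemma src_in: "\<sigma> \<in> points (Arr G) \<Longrightarrow> src G \<sigma> \<in> points (Obj G)"
  and tgt_in: "\<sigma> \<in> points (Arr G) \<Longrightarrow> tgt G \<sigma> \<in> points (Obj G)"
  and ident_in: "x \<in> points (Obj G) \<Longrightarrow> ident G x \<in> points (Arr G)"
  and src_ident: "x \<in> points (Obj G) \<Longrightarrow> src G (ident G x) = x"
  and tgt_ident: "x \<in> points (Obj G) \<Longrightarrow> tgt G (ident G x) = x"
  using G unfolding etale_lie_groupoid_def groupoid_axioms_def by blast+

lemma gmult_in: "(\<sigma>, \<tau>) \<in> composable_pairs G \<Longrightarrow> gmult G \<sigma> \<tau> \<in> points (Arr G)"
  and src_gmult: "(\<sigma>, \<tau>) \<in> composable_pairs G \<Longrightarrow> src G (gmult G \<sigma> \<tau>) = src G \<tau>"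
  and tgt_gmult: "(\<sigma>, \<tau>) \<in> composable_pairs G \<Longrightarrow> tgt G (gmult G \<sigma> \<tau>) = tgt G \<sigma>"
  using G unfolding etale_lie_groupoid_def groupoid_axioms_def by blast+

lemma gmult_assoc:
  assumes "(\<rho>, \<sigma>) \<in> composable_pairs G" "(\<sigma>, \<tau>) \<in> composable_pairs G"
  shows "gmult G (gmult G \<rho> \<sigma>) \<tau> = gmult G \<rho> (gmult G \<sigma> \<tau>)"
proof -
  have "\<forall>\<rho> \<sigma> \<tau>. (\<rho>, \<sigma>) \<in> composable_pairs G \<and> (\<sigma>, \<tau>) \<in> composable_pairs G \<longrightarrow>
        gmult G (gmult G \<rho> \<sigma>) \<tau> = gmult G \<rho> (gmult G \<sigma> \<tau>)"
    using G unfolding etale_lie_groupoid_def groupoid_axioms_def by (elim conjE)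
  then show ?thesis using assms by blast
qed

lemma gmult_ident_right: "\<sigma> \<in> points (Arr G) \<Longrightarrow> gmult G \<sigma> (ident G (src G \<sigma>)) = \<sigma>"
  and gmult_ident_left: "\<sigma> \<in> points (Arr G) \<Longrightarrow> gmult G (ident G (tgt G \<sigma>)) \<sigma> = \<sigma>"
  and ginv_in: "\<sigma> \<in> points (Arr G) \<Longrightarrow> ginv G \<sigma> \<in> points (Arr G)"
  and src_ginv: "\<sigma> \<in> points (Arr G) \<Longrightarrow> src G (ginv G \<sigma>) = tgt G \<sigma>"
  and tgt_ginv: "\<sigma> \<in> points (Arr G) \<Longrightarrow> tgt G (ginv G \<sigma>) = src G \<sigma>"
  and gmult_ginv_left: "\<sigma> \<in> points (Arr G) \<Longrightarrow> gmult G (ginv G \<sigma>) \<sigma> = ident G (src G \<sigma>)"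
  and gmult_ginv_right: "\<sigma> \<in> points (Arr G) \<Longrightarrow> gmult G \<sigma> (ginv G \<sigma>) = ident G (tgt G \<sigma>)"
  using G unfolding etale_lie_groupoid_def groupoid_axioms_def by (elim conjE; blast)+

lemma src_nbhd:
  assumes "\<sigma> \<in> points (Arr G)"
  obtains W where "\<sigma> \<in> W" "openin (mtop (Arr G)) W" "inj_on (src G) W"
    "\<forall>U. U \<subseteq> W \<longrightarrow> openin (mtop (Arr G)) U \<longrightarrow> openin (mtop (Obj G)) (src G ` U)"
  using local_diffeo_nbhd[OF manifold_Arr manifold_Obj local_diffeo_src assms] .

lemma local_sectionD:
  assumes "local_section G c U S"
  shows "c \<in> charts (Obj G)" "open U" "U \<subseteq> snd c ` fst c" "continuous_map (top_of_set U) (mtop (Arr G)) S"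
    "\<And>q. q \<in> U \<Longrightarrow> src G (S q) = chart_inv c q" "\<And>q. q \<in> U \<Longrightarrow> S q \<in> points (Arr G)"
proof -
  show S: "c \<in> charts (Obj G)" "open U" "U \<subseteq> snd c ` fst c" "continuous_map (top_of_set U) (mtop (Arr G)) S"
    "\<And>q. q \<in> U \<Longrightarrow> src G (S q) = chart_inv c q" using assms unfolding local_section_def by blast+
  have "S \<in> U \<rightarrow> points (Arr G)"
    using continuous_map_funspace[OF S(4)] manifold_topspace[OF manifold_Arr] by simp
  then show "S q \<in> points (Arr G)" if "q \<in> U" for q using that by blast
qed

lemma local_section_open:
  assumes "local_section G c U S" "openin (mtop (Arr G)) W"
  shows "open {q \<in> U. S q \<in> W}"
proof -
  have "openin (top_of_set U) {q \<in> topspace (top_of_set U). S q \<in> W}"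
    by (rule openin_continuous_map_preimage[OF local_sectionD(4)[OF assms(1)] assms(2)])
  then show ?thesis using openin_open_trans[OF _ local_sectionD(2)[OF assms(1)]] by simp
qed

lemma eventually_local_section:
  assumes "local_section G c U S" "p \<in> U" "openin (mtop (Arr G)) W" "S p \<in> W"
  shows "\<forall>\<^sub>F q in nhds p. q \<in> U \<and> S q \<in> W"
  using eventually_nhds_in_open[OF local_section_open[OF assms(1,3)], of p] assms(2,4) by simp

text \<open>Both sections stay in a neighbourhood on which the source is injective, and they have
  the same source there.\<close>

lemma local_section_unique:
  assumes S: "local_section G c U S" and S': "local_section G c U' S'"
    and p: "p \<in> U" "p \<in> U'" "S p = S' p"
  shows "\<forall>\<^sub>F q in nhds p. S q = S' q"
proof -
  obtain W where W: "S p \<in> W" "openin (mtop (Arr G)) W" "inj_on (src G) W"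
    "\<forall>U. U \<subseteq> W \<longrightarrow> openin (mtop (Arr G)) U \<longrightarrow> openin (mtop (Obj G)) (src G ` U)"
    using src_nbhd[OF local_sectionD(6)[OF S p(1)]] .
  have "S' p \<in> W" using W(1) p(3) by simp
  from eventually_local_section[OF S p(1) W(2,1)] eventually_local_section[OF S' p(2) W(2) this]
  show ?thesis
  proof eventually_elim
    case (elim q)
    then have "src G (S q) = src G (S' q)" using local_sectionD(5)[OF S] local_sectionD(5)[OF S'] by simp
    then show ?case using inj_onD[OF W(3)] elim by blast
  qed
qed

lemma local_section_ident:
  assumes "c \<in> charts (Obj G)"
  shows "local_section G c (snd c ` fst c) (\<lambda>q. ident G (chart_inv c q))"
proof -
  have "continuous_map (top_of_set (snd c ` fst c)) (mtop (Arr G)) (ident G \<circ> chart_inv c)"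
    by (rule continuous_map_compose[OF continuous_map_chart_inv[OF manifold_Obj assms] smooth_map_continuous[OF smooth_ident]])
  moreover have "src G (ident G (chart_inv c q)) = chart_inv c q" if "q \<in> snd c ` fst c" for q
    using src_ident chart_inv_in[OF that] chart_dom_subset[OF manifold_Obj assms] by blast
  ultimately show ?thesis
    using assms open_chart_image[OF manifold_Obj assms] unfolding local_section_def by (simp add: o_def)
qed

lemma composable_chart_inj:
  assumes "ch \<in> charts (composable G)"
  shows "inj_on (snd ch) (fst ch)"
proof -
  obtain W c where ch: "ch = (W, snd c \<circ> snd)" "c \<in> charts (Arr G)" "inj_on snd W" "snd ` W \<subseteq> fst c"
    using assms unfolding composable_def by auto
  have "inj_on (snd c \<circ> snd) W"
    using ch(3) inj_on_subset[OF chart_inj[OF manifold_Arr ch(2)] ch(4)] by (rule comp_inj_on)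
  then show ?thesis using ch(1) by simp
qed

lemma openin_composable:
  "openin (mtop (composable G)) W \<longleftrightarrow> W \<subseteq> composable_pairs G \<and> (\<forall>ch\<in>charts (composable G). open (snd ch ` (W \<inter> fst ch)))"
proof -
  have "points (composable G) = composable_pairs G" by (simp add: composable_def)
  then show ?thesis using openin_mtop[of "composable G" W] composable_chart_inj by simp
qed

text \<open>The second projection of the fibre product is open: for an arrow near
  \<open>\<tau>\<close> the target lies in the open image under the source of a neighbourhood of
  \<open>\<sigma>\<close>, so a composable first component close to \<open>\<sigma>\<close>
  exists.\<close>

lemma topspace_composable_aux:
  assumes W: "openin (subtopology (prod_topology (mtop (Arr G)) (mtop (Arr G))) (composable_pairs G)) W"
  shows "openin (mtop (Arr G)) (snd ` W)"
proof (subst openin_subopen, intro ballI)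
  let ?A = "mtop (Arr G)"
  fix \<tau> assume "\<tau> \<in> snd ` W"
  then obtain \<sigma> where \<sigma>: "(\<sigma>, \<tau>) \<in> W" by force
  obtain W' where W': "openin (prod_topology ?A ?A) W'" "W = W' \<inter> composable_pairs G"
    using W unfolding openin_subtopology by blast
  then have "(\<sigma>, \<tau>) \<in> W'" and comp: "(\<sigma>, \<tau>) \<in> composable_pairs G" using \<sigma> by auto
  then obtain P Q where PQ: "openin ?A P" "openin ?A Q" "\<sigma> \<in> P" "\<tau> \<in> Q" "P \<times> Q \<subseteq> W'"
    using W'(1) unfolding openin_prod_topology_alt by metis
  have pts: "\<sigma> \<in> points (Arr G)" "\<tau> \<in> points (Arr G)" "src G \<sigma> = tgt G \<tau>"
    using comp unfolding composable_pairs_def by auto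
  obtain V where V: "\<sigma> \<in> V" "openin ?A V" "inj_on (src G) V"
    "\<forall>U. U \<subseteq> V \<longrightarrow> openin ?A U \<longrightarrow> openin (mtop (Obj G)) (src G ` U)"
    using src_nbhd[OF pts(1)] .
  have "openin (mtop (Obj G)) (src G ` (V \<inter> P))"
    using V(4) openin_Int[OF V(2) PQ(1)] by blast
  from openin_continuous_map_preimage[OF smooth_map_continuous[OF smooth_tgt] this]
  have "openin ?A ({\<tau>' \<in> topspace ?A. tgt G \<tau>' \<in> src G ` (V \<inter> P)} \<inter> Q)"
    using PQ(2) by (rule openin_Int)
  moreover have "\<tau> \<in> {\<tau>' \<in> topspace ?A. tgt G \<tau>' \<in> src G ` (V \<inter> P)} \<inter> Q"
    using pts(2) V(1) PQ(3,4) by (simp add: manifold_topspace[OF manifold_Arr] pts(3)[symmetric])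
  moreover have "{\<tau>' \<in> topspace ?A. tgt G \<tau>' \<in> src G ` (V \<inter> P)} \<inter> Q \<subseteq> snd ` W"
  proof
    fix \<tau>' assume "\<tau>' \<in> {\<tau>' \<in> topspace ?A. tgt G \<tau>' \<in> src G ` (V \<inter> P)} \<inter> Q"
    then obtain \<sigma>' where \<sigma>': "\<tau>' \<in> points (Arr G)" "\<tau>' \<in> Q" "\<sigma>' \<in> P" "tgt G \<tau>' = src G \<sigma>'"
      unfolding manifold_topspace[OF manifold_Arr] by blast
    have "\<sigma>' \<in> points (Arr G)" using \<sigma>'(3) openin_subset[OF PQ(1)] manifold_topspace[OF manifold_Arr] by blast
    then have "(\<sigma>', \<tau>') \<in> W" unfolding W'(2) composable_pairs_def using \<sigma>' PQ(5) by auto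
    then show "\<tau>' \<in> snd ` W" by force
  qed
  ultimately show "\<exists>Q. openin ?A Q \<and> \<tau> \<in> Q \<and> Q \<subseteq> snd ` W" by blast
qed

text \<open>The charts of the fibre product only give back its topology once small neighbourhoods of its
  points are known to be chart domains; this uses that the source is locally injective.\<close>

lemma continuous_map_to_composable:
  "continuous_map (subtopology (prod_topology (mtop (Arr G)) (mtop (Arr G))) (composable_pairs G)) (mtop (composable G)) (\<lambda>z. z)"
proof -
  let ?A = "mtop (Arr G)"
  let ?P = "subtopology (prod_topology ?A ?A) (composable_pairs G)"
  have sub: "composable_pairs G \<subseteq> topspace (prod_topology ?A ?A)"
    unfolding composable_pairs_def using manifold_topspace[OF manifold_Arr] by auto
  have topP: "topspace ?P = composable_pairs G" using sub by (simp add: Int_absorb1)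
  have "openin (mtop (composable G)) (composable_pairs G)"
    unfolding openin_composable
  proof (intro conjI ballI)
    fix ch assume "ch \<in> charts (composable G)"
    then obtain W c where ch: "ch = (W, snd c \<circ> snd)" "c \<in> charts (Arr G)" "openin ?P W" "inj_on snd W" "snd ` W \<subseteq> fst c"
      unfolding composable_def by auto
    have "W \<subseteq> composable_pairs G" using openin_subset[OF ch(3)] topP by simp
    then have "snd ch ` (composable_pairs G \<inter> fst ch) = snd c ` (fst c \<inter> snd ` W)"
      using ch(1,5) by (auto simp: image_comp Int_absorb1 Int_absorb2 simp del: o_apply)
    then show "open (snd ch ` (composable_pairs G \<inter> fst ch))"
      using open_chart_image_of[OF manifold_Arr ch(2) topspace_composable_aux[OF ch(3)]] by simp
  qed simp
  then have top: "topspace (mtop (composable G)) = composable_pairs G"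
    using openin_composable openin_subset openin_topspace by blast
  show ?thesis
    unfolding continuous_map_def top topP
  proof (intro conjI allI impI)
    fix O' assume O': "openin (mtop (composable G)) O'"
    then have O'sub: "O' \<subseteq> composable_pairs G" using openin_composable by blast
    have "openin ?P O'"
    proof (subst openin_subopen, intro ballI)
      fix z assume z: "z \<in> O'"
      then obtain \<sigma> \<tau> where z': "z = (\<sigma>, \<tau>)" "(\<sigma>, \<tau>) \<in> composable_pairs G" using O'sub by (cases z) auto
      have pts: "\<sigma> \<in> points (Arr G)" "\<tau> \<in> points (Arr G)" "src G \<sigma> = tgt G \<tau>"
        using z'(2) unfolding composable_pairs_def by auto
      obtain V where V: "\<sigma> \<in> V" "openin ?A V" "inj_on (src G) V"
        "\<forall>U. U \<subseteq> V \<longrightarrow> openin ?A U \<longrightarrow> openin (mtop (Obj G)) (src G ` U)"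
        using src_nbhd[OF pts(1)] .
      obtain c where c: "c \<in> charts (Arr G)" "\<tau> \<in> fst c"
        using charts_at_ex[OF manifold_Arr pts(2)] charts_at_D[OF manifold_Arr] by blast
      define W where "W = (V \<times> fst c) \<inter> composable_pairs G"
      have W: "openin ?P W"
        unfolding W_def openin_subtopology
        using openin_prod_Times_iff[of ?A ?A V "fst c"] V(2) openin_chart_dom[OF manifold_Arr c(1)] by blast
      \<comment> \<open>The source of the first component is the target of the second, and the
        source is injective on \<open>V\<close>; hence the second component determines the
        pair.\<close>
      have inj: "inj_on snd W"
      proof (rule inj_onI)
        fix a b assume ab: "a \<in> W" "b \<in> W" "snd a = snd b"
        then have "src G (fst a) = src G (fst b)" "fst a \<in> V" "fst b \<in> V"
          unfolding W_def composable_pairs_def by auto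
        then have "fst a = fst b" using inj_onD[OF V(3)] by blast
        then show "a = b" using ab(3) by (simp add: prod_eq_iff)
      qed
      have sW: "snd ` W \<subseteq> fst c" unfolding W_def by auto
      let ?ch = "(W, snd c \<circ> snd)"
      have ch: "?ch \<in> charts (composable G)" unfolding composable_def mfd.select_convs mem_Collect_eq
        using c(1) W inj sW by (intro exI[of _ W] exI[of _ c]) blast
      define Q where "Q = (snd c \<circ> snd) ` (O' \<inter> W)"
      have Q: "open Q" using bspec[OF conjunct2[OF O'[unfolded openin_composable]] ch] unfolding Q_def by simp
      have "openin ?A (fst c \<inter> snd c -` Q)" by (rule openin_chart_preimage[OF manifold_Arr c(1) Q])
      then have "openin ?P ((V \<times> (fst c \<inter> snd c -` Q)) \<inter> composable_pairs G)"
        unfolding openin_subtopology using openin_prod_Times_iff[of ?A ?A V "fst c \<inter> snd c -` Q"] V(2) by blast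
      moreover have zW: "z \<in> W" using z' V(1) c(2) unfolding W_def by simp
      then have "snd c \<tau> \<in> Q"
        unfolding Q_def using z z'(1) by (intro image_eqI[of _ _ z]) simp_all
      then have "z \<in> (V \<times> (fst c \<inter> snd c -` Q)) \<inter> composable_pairs G"
        using z' V(1) c(2) by simp
      moreover have "(V \<times> (fst c \<inter> snd c -` Q)) \<inter> composable_pairs G \<subseteq> O'"
      proof
        fix w assume w: "w \<in> (V \<times> (fst c \<inter> snd c -` Q)) \<inter> composable_pairs G"
        then have wW: "w \<in> W" and "snd c (snd w) \<in> Q" unfolding W_def by auto
        then obtain w' where w': "w' \<in> O'" "w' \<in> W" "(snd c \<circ> snd) w' = (snd c \<circ> snd) w" unfolding Q_def by auto
        then have "w' = w" using inj_onD[OF composable_chart_inj[OF ch]] wW by simp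
        then show "w \<in> O'" using w'(1) by simp
      qed
      ultimately show "\<exists>Z. openin ?P Z \<and> z \<in> Z \<and> Z \<subseteq> O'" by blast
    qed
    moreover have "{z \<in> composable_pairs G. z \<in> O'} = O'" using O'sub by blast
    ultimately show "openin ?P {z \<in> composable_pairs G. z \<in> O'}" by simp
  qed simp
qed

text \<open>The product section follows \<open>S\<close> first and evaluates \<open>S'\<close> at
  the coordinates of the target reached. On targets this is the composition of the two coordinate
  maps, which gives the chain rule and the iterates used for powers.\<close>

lemma local_section_gmult:
  assumes S: "local_section G c U S" and S': "local_section G d U' S'"
    and p: "p \<in> U" "tgt G (S p) \<in> fst d" "snd d (tgt G (S p)) \<in> U'"
  obtains U'' where "p \<in> U''" "U'' \<subseteq> U" "\<forall>q\<in>U''. tgt G (S q) \<in> fst d \<and> snd d (tgt G (S q)) \<in> U'"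
    "\<forall>q\<in>U''. (S' (snd d (tgt G (S q))), S q) \<in> composable_pairs G"
    "local_section G c U'' (\<lambda>q. gmult G (S' (snd d (tgt G (S q)))) (S q))"
proof -
  let ?A = "mtop (Arr G)"
  note D = local_sectionD[OF S] and D' = local_sectionD[OF S']
  define U'' where "U'' = {q \<in> U. S q \<in> {\<tau> \<in> topspace ?A. tgt G \<tau> \<in> fst d \<inter> snd d -` U'}}"
  have U'': "q \<in> U \<and> tgt G (S q) \<in> fst d \<and> snd d (tgt G (S q)) \<in> U'" if "q \<in> U''" for q
    using that unfolding U''_def by blast
  have "openin ?A {\<tau> \<in> topspace ?A. tgt G \<tau> \<in> fst d \<inter> snd d -` U'}"
    by (rule openin_continuous_map_preimage[OF smooth_map_continuous[OF smooth_tgt] openin_chart_preimage[OF manifold_Obj D'(1,2)]])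
  from local_section_open[OF S this] have "open U''" unfolding U''_def .
  have "p \<in> U''" using p D(6)[OF p(1)] manifold_topspace[OF manifold_Arr] unfolding U''_def by simp
  have sub: "U'' \<subseteq> U" unfolding U''_def by blast
  let ?S = "\<lambda>q. S' (snd d (tgt G (S q)))"
  have comp: "(?S q, S q) \<in> composable_pairs G" if "q \<in> U''" for q
  proof -
    note q = U''[OF that]
    have "chart_inv d (snd d (tgt G (S q))) = tgt G (S q)"
      using chart_inv_chart[OF chart_inj[OF manifold_Obj D'(1)]] q by blast
    then show ?thesis unfolding composable_pairs_def using D'(5,6) D(6) q by auto
  qed
  have S1: "continuous_map (top_of_set U'') ?A S"
    using continuous_map_from_subtopology[OF D(4), of U''] sub by (simp add: subtopology_subtopology Int_absorb1)
  have "continuous_map (top_of_set U'') (subtopology (mtop (Obj G)) (fst d)) (tgt G \<circ> S)"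
    using continuous_map_compose[OF S1 smooth_map_continuous[OF smooth_tgt]] U''
    by (auto simp: continuous_map_in_subtopology)
  from continuous_map_compose[OF this continuous_map_chart[OF manifold_Obj D'(1)]]
  have "continuous_map (top_of_set U'') (top_of_set U') (snd d \<circ> (tgt G \<circ> S))"
    using U'' by (auto simp: continuous_map_in_subtopology)
  from continuous_map_compose[OF this D'(4)]
  have S2: "continuous_map (top_of_set U'') ?A ?S" by (simp add: o_def)
  have "continuous_map (top_of_set U'') (subtopology (prod_topology ?A ?A) (composable_pairs G)) (\<lambda>q. (?S q, S q))"
    using continuous_map_pairedI[OF S2 S1] comp by (auto simp: continuous_map_in_subtopology)
  from continuous_map_compose[OF continuous_map_compose[OF this continuous_map_to_composable] smooth_map_continuous[OF smooth_gmult]]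
  have "continuous_map (top_of_set U'') ?A (\<lambda>q. gmult G (?S q) (S q))" by (simp add: o_def)
  then have "local_section G c U'' (\<lambda>q. gmult G (?S q) (S q))"
    using D(1,3,5) \<open>open U''\<close> sub src_gmult[OF comp] unfolding local_section_def by (auto simp: subset_iff)
  then show thesis using that[OF \<open>p \<in> U''\<close> sub] U'' comp by blast
qed

end


section \<open>Derivatives of arrows and isotropy groups\<close>

text \<open>Local sections through the same arrow agree near its source, so that the germ of \<open>arrow_coord\<close> there
  does not depend on the choice.\<close>

definition arrow_coord ::
  "('a, 'b, 'e::euclidean_space, 'm) groupoid_scheme \<Rightarrow> ('a, 'e) chart \<Rightarrow> ('a, 'e) chart \<Rightarrow> 'b \<Rightarrow> 'e \<Rightarrow> 'e" where
  "arrow_coord G c d \<sigma> = (\<lambda>q. snd d (tgt G ((SOME S. \<exists>U. local_section G c U S \<and>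
     snd c (src G \<sigma>) \<in> U \<and> S (snd c (src G \<sigma>)) = \<sigma>) q)))"

text \<open>Coordinate form of the differential of the germ of an arrow. For an isotropy element and
  \<open>c = d\<close> it restricts to the linear action on the contact plane.\<close>

definition arrow_deriv ::
  "('a, 'b, 'e::euclidean_space, 'm) groupoid_scheme \<Rightarrow> ('a, 'e) chart \<Rightarrow> ('a, 'e) chart \<Rightarrow> 'b \<Rightarrow> 'e \<Rightarrow> 'e" where
  "arrow_deriv G c d \<sigma> = frechet_derivative (arrow_coord G c d \<sigma>) (at (snd c (src G \<sigma>)))"

context
  fixes G :: "('a, 'b, 'e::euclidean_space, 'm) groupoid_scheme"
  assumes G: "etale_lie_groupoid G"
begin

lemma arrow_coord_eq:
  assumes S: "local_section G c U S" "snd c (src G \<sigma>) \<in> U" "S (snd c (src G \<sigma>)) = \<sigma>"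
  shows "\<forall>\<^sub>F q in nhds (snd c (src G \<sigma>)). snd d (tgt G (S q)) = arrow_coord G c d \<sigma> q"
proof -
  let ?P = "\<lambda>S. \<exists>U. local_section G c U S \<and> snd c (src G \<sigma>) \<in> U \<and> S (snd c (src G \<sigma>)) = \<sigma>"
  define S' where "S' = (SOME S. ?P S)"
  have "?P S" using S by blast
  then have "?P S'" unfolding S'_def by (rule someI[of ?P])
  then obtain U' where S': "local_section G c U' S'" "snd c (src G \<sigma>) \<in> U'" "S' (snd c (src G \<sigma>)) = \<sigma>" by blast
  have "\<forall>\<^sub>F q in nhds (snd c (src G \<sigma>)). S q = S' q"
    using local_section_unique[OF G S(1) S'(1) S(2) S'(2)] S(3) S'(3) by simp
  then show ?thesis
    unfolding arrow_coord_def S'_def[symmetric] by (rule eventually_mono) simp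
qed

text \<open>The coordinate map is the target after the local inverse of the source, both of class
  C^2 in charts. Its derivative carries the differential of the source to that of the target at
  every point of \<open>U\<close>, not only over \<open>\<sigma>\<close>; this is what later shows
  that the map preserves the contact planes near a fixed point.\<close>

lemma arrow_section:
  assumes \<sigma>: "\<sigma> \<in> points (Arr G)" and c: "c \<in> charts_at (Obj G) (src G \<sigma>)" and d: "d \<in> charts_at (Obj G) (tgt G \<sigma>)"
  obtains U S where "local_section G c U S" "snd c (src G \<sigma>) \<in> U" "S (snd c (src G \<sigma>)) = \<sigma>"
    "\<forall>q\<in>U. tgt G (S q) \<in> fst d" "C2_on U (\<lambda>q. snd d (tgt G (S q)))"
    "\<forall>q\<in>U. \<forall>z\<in>tangent_space (Arr G) (S q). frechet_derivative (\<lambda>q. snd d (tgt G (S q))) (at q)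
       (differential (Arr G) (Obj G) (src G) (S q) z c) = differential (Arr G) (Obj G) (tgt G) (S q) z d"
proof -
  let ?A = "mtop (Arr G)"
  note mA = manifold_Arr[OF G] and mO = manifold_Obj[OF G]
  obtain W where W: "\<sigma> \<in> W" "openin ?A W" "inj_on (src G) W"
    "\<forall>U. U \<subseteq> W \<longrightarrow> openin ?A U \<longrightarrow> openin (mtop (Obj G)) (src G ` U)"
    "\<forall>c\<in>charts (Arr G). \<forall>d\<in>charts (Obj G). C2_on (snd d ` (fst d \<inter> src G ` (W \<inter> fst c))) (snd c \<circ> inv_into W (src G) \<circ> chart_inv d)"
    using local_diffeo_nbhd[OF mA mO local_diffeo_src[OF G] \<sigma>] .
  obtain e where e: "e \<in> charts_at (Arr G) \<sigma>" using charts_at_ex[OF mA \<sigma>] by blast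
  have E: "e \<in> charts (Arr G)" "\<sigma> \<in> fst e" using charts_at_D[OF mA e] by blast+
  have C: "c \<in> charts (Obj G)" "src G \<sigma> \<in> fst c" using charts_at_D[OF mO c] by blast+
  have D: "d \<in> charts (Obj G)" "tgt G \<sigma> \<in> fst d" using charts_at_D[OF mO d] by blast+
  define W' where "W' = W \<inter> (fst e \<inter> {\<tau> \<in> topspace ?A. tgt G \<tau> \<in> fst d})"
  have W': "openin ?A W'"
    unfolding W'_def
    by (intro openin_Int W(2) openin_chart_dom[OF mA E(1)]
        openin_continuous_map_preimage[OF smooth_map_continuous[OF smooth_tgt[OF G]] openin_chart_dom[OF mO D(1)]])
  have W'D: "\<tau> \<in> W" "\<tau> \<in> fst e" "\<tau> \<in> points (Arr G)" "tgt G \<tau> \<in> fst d" if "\<tau> \<in> W'" for \<tau>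
    using that unfolding W'_def manifold_topspace[OF mA] by auto
  let ?g = "inv_into W (src G)"
  define U where "U = snd c ` (fst c \<inter> src G ` W')"
  define S where "S q = ?g (chart_inv c q)" for q
  have U: "\<exists>\<tau>\<in>W'. S q = \<tau> \<and> chart_inv c q = src G \<tau> \<and> q = snd c (src G \<tau>) \<and> src G \<tau> \<in> fst c" if qU: "q \<in> U" for q
  proof -
    obtain \<tau> where \<tau>: "\<tau> \<in> W'" "src G \<tau> \<in> fst c" "q = snd c (src G \<tau>)" using qU unfolding U_def by blast
    then have "chart_inv c q = src G \<tau>" using chart_inv_chart[OF chart_inj[OF mO C(1)]] by simp
    then have "S q = \<tau>" unfolding S_def using inv_into_f_f[OF W(3)] W'D(1)[OF \<tau>(1)] by simp
    then show ?thesis using \<tau> \<open>chart_inv c q = src G \<tau>\<close> by blast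
  qed
  have Sq: "S (snd c (src G \<tau>)) = \<tau>" if "\<tau> \<in> W'" "src G \<tau> \<in> fst c" for \<tau>
    unfolding S_def using chart_inv_chart[OF chart_inj[OF mO C(1)] that(2)] inv_into_f_f[OF W(3) W'D(1)[OF that(1)]] by simp
  have "\<sigma> \<in> W'" using W(1) E(2) \<sigma> D(2) unfolding W'_def manifold_topspace[OF mA] by simp
  have openU: "open (snd c ` (fst c \<inter> src G ` (W' \<inter> Z)))" if "openin ?A Z" for Z
  proof -
    have "W' \<inter> Z \<subseteq> W" unfolding W'_def by blast
    then have "openin (mtop (Obj G)) (src G ` (W' \<inter> Z))" using W(4) openin_Int[OF W' that] by blast
    then show ?thesis by (rule open_chart_image_of[OF mO C(1)])
  qed
  have "open U" using openU[OF openin_topspace] openin_subset[OF W'] unfolding U_def by (simp add: Int_absorb2)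
  have cont: "continuous_map (top_of_set U) ?A S"
    unfolding continuous_map_def
  proof (intro conjI allI impI)
    show "S \<in> topspace (top_of_set U) \<rightarrow> topspace ?A"
    proof (rule Pi_I)
      fix q assume "q \<in> topspace (top_of_set U)"
      then show "S q \<in> topspace ?A" using U[of q] W'D(3) unfolding manifold_topspace[OF mA] by auto
    qed
    fix Z assume Z: "openin ?A Z"
    have "{q \<in> U. S q \<in> Z} = snd c ` (fst c \<inter> src G ` (W' \<inter> Z))"
    proof (intro equalityI subsetI)
      fix q assume "q \<in> {q \<in> U. S q \<in> Z}"
      then show "q \<in> snd c ` (fst c \<inter> src G ` (W' \<inter> Z))" using U[of q] by blast
    next
      fix q assume "q \<in> snd c ` (fst c \<inter> src G ` (W' \<inter> Z))"
      then obtain \<tau> where \<tau>: "\<tau> \<in> W'" "\<tau> \<in> Z" "src G \<tau> \<in> fst c" "q = snd c (src G \<tau>)" by blast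
      then have "S q = \<tau>" using Sq[of \<tau>] by simp
      moreover have "q \<in> U" unfolding U_def using \<tau> by blast
      ultimately show "q \<in> {q \<in> U. S q \<in> Z}" using \<tau>(2) by simp
    qed
    then have "open {q \<in> U. S q \<in> Z}" using openU[OF Z] by simp
    then show "openin (top_of_set U) {q \<in> topspace (top_of_set U). S q \<in> Z}"
      by (auto simp: openin_open_eq[OF \<open>open U\<close>])
  qed
  have sec: "local_section G c U S"
    unfolding local_section_def
  proof (intro conjI ballI)
    show "U \<subseteq> snd c ` fst c" unfolding U_def by blast
    show "src G (S q) = chart_inv c q" if "q \<in> U" for q using U[OF that] by auto
  qed (fact C(1) \<open>open U\<close> cont)+
  let ?h = "snd e \<circ> ?g \<circ> chart_inv c" and ?r = "snd d \<circ> tgt G \<circ> chart_inv e"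
  have h0: "C2_on (snd c ` (fst c \<inter> src G ` (W \<inter> fst e))) ?h" using W(5) E(1) C(1) by blast
  have h: "C2_on U ?h"
    by (rule C2_on_subset[OF h0 \<open>open U\<close>]) (unfold U_def, rule image_mono, use W'D in blast)
  have r: "C2_on (snd e ` (fst e \<inter> tgt G -` fst d)) ?r" by (rule smooth_map_rep[OF mA mO smooth_tgt[OF G] E(1) D(1)])
  have hq: "?h q = snd e (S q)" for q by (simp add: S_def)
  have h_in: "?h q \<in> snd e ` (fst e \<inter> tgt G -` fst d)" if "q \<in> U" for q
    using U[OF that] W'D unfolding hq by blast
  have rh: "C2_on U (?r \<circ> ?h)" by (rule C2_on_comp[OF h r h_in])
  let ?F = "\<lambda>q. snd d (tgt G (S q))"
  have eq: "(?r \<circ> ?h) q = ?F q" if "q \<in> U" for q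
  proof -
    have "S q \<in> fst e" using U[OF that] W'D by blast
    then show ?thesis using hq[of q] chart_inv_chart[OF chart_inj[OF mA E(1)]] by simp
  qed
  have F: "C2_on U ?F" by (rule C2_on_cong[OF rh eq])
  have "frechet_derivative ?F (at q) (differential (Arr G) (Obj G) (src G) (S q) z c) = differential (Arr G) (Obj G) (tgt G) (S q) z d"
    if q: "q \<in> U" and z: "z \<in> tangent_space (Arr G) (S q)" for q z
  proof -
    obtain \<tau> where \<tau>: "\<tau> \<in> W'" "S q = \<tau>" "chart_inv c q = src G \<tau>" "q = snd c (src G \<tau>)" "src G \<tau> \<in> fst c"
      using U[OF q] by blast
    note \<tau>W = W'D[OF \<tau>(1)]
    have z: "z \<in> tangent_space (Arr G) \<tau>" using z \<tau>(2) by simp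
    have ch: "e \<in> charts_at (Arr G) \<tau>" "c \<in> charts_at (Obj G) (src G \<tau>)" "d \<in> charts_at (Obj G) (tgt G \<tau>)"
      using E(1) C(1) D(1) \<tau>(5) \<tau>W unfolding charts_at_def by blast+
    have "\<forall>\<^sub>F y in nhds q. (?r \<circ> ?h) y = ?F y"
      using eventually_nhds_in_open[OF \<open>open U\<close> q] by (rule eventually_mono) (rule eq)
    from differentiable_cong_nhds(2)[OF this]
    have "frechet_derivative ?F (at q) = frechet_derivative (?r \<circ> ?h) (at q)"
      using rh q unfolding C2_on_def by blast
    moreover have "frechet_derivative (?r \<circ> ?h) (at q) u = frechet_derivative ?r (at (?h q)) (frechet_derivative ?h (at q) u)" for u
      using h r q h_in[OF q] unfolding C2_on_def by (intro frechet_derivative_comp) blast+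
    moreover have "frechet_derivative ?h (at q) (differential (Arr G) (Obj G) (src G) \<tau> z c) = z e"
      unfolding differential_eq[OF mA mO smooth_map_diff_at[OF mA mO smooth_src[OF G] \<tau>W(3)] z ch(1,2)] \<tau>(4)
      by (rule local_diffeo_left_inverse[OF mA mO smooth_src[OF G] W(2,3) h0 \<tau>W(1) ch(1,2)])
    moreover have "frechet_derivative ?r (at (snd e \<tau>)) (z e) = differential (Arr G) (Obj G) (tgt G) \<tau> z d"
      by (rule differential_eq[OF mA mO smooth_map_diff_at[OF mA mO smooth_tgt[OF G] \<tau>W(3)] z ch(1,3), symmetric])
    ultimately show ?thesis using hq[of q] \<tau>(2) by simp
  qed
  then show thesis
  proof (intro that[OF sec _ _ _ F] ballI)
    show "snd c (src G \<sigma>) \<in> U" unfolding U_def using C(2) \<open>\<sigma> \<in> W'\<close> by blast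
    show "S (snd c (src G \<sigma>)) = \<sigma>" by (rule Sq[OF \<open>\<sigma> \<in> W'\<close> C(2)])
    show "tgt G (S q) \<in> fst d" if "q \<in> U" for q using U[OF that] W'D(4) by auto
  qed blast
qed

lemma arrow_deriv_section:
  assumes S: "local_section G c U S" "snd c (src G \<sigma>) \<in> U" "S (snd c (src G \<sigma>)) = \<sigma>"
    and F: "(\<lambda>q. snd d (tgt G (S q))) differentiable (at (snd c (src G \<sigma>)))"
  shows "arrow_deriv G c d \<sigma> = frechet_derivative (\<lambda>q. snd d (tgt G (S q))) (at (snd c (src G \<sigma>)))"
  unfolding arrow_deriv_def by (rule differentiable_cong_nhds(2)[OF arrow_coord_eq[OF S] F])

lemma arrow_deriv_differential:
  assumes \<sigma>: "\<sigma> \<in> points (Arr G)" and c: "c \<in> charts_at (Obj G) (src G \<sigma>)" and d: "d \<in> charts_at (Obj G) (tgt G \<sigma>)"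
  shows "linear (arrow_deriv G c d \<sigma>)"
    and "z \<in> tangent_space (Arr G) \<sigma> \<Longrightarrow> arrow_deriv G c d \<sigma> (differential (Arr G) (Obj G) (src G) \<sigma> z c) =
      differential (Arr G) (Obj G) (tgt G) \<sigma> z d"
proof -
  obtain U S where S: "local_section G c U S" "snd c (src G \<sigma>) \<in> U" "S (snd c (src G \<sigma>)) = \<sigma>"
    "\<forall>q\<in>U. tgt G (S q) \<in> fst d" "C2_on U (\<lambda>q. snd d (tgt G (S q)))"
    "\<forall>q\<in>U. \<forall>z\<in>tangent_space (Arr G) (S q). frechet_derivative (\<lambda>q. snd d (tgt G (S q))) (at q)
       (differential (Arr G) (Obj G) (src G) (S q) z c) = differential (Arr G) (Obj G) (tgt G) (S q) z d"
    using arrow_section[OF \<sigma> c d] .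
  have "(\<lambda>q. snd d (tgt G (S q))) differentiable (at (snd c (src G \<sigma>)))"
    using S(2,5) unfolding C2_on_def by blast
  note D = arrow_deriv_section[OF S(1-3) this]
  show "linear (arrow_deriv G c d \<sigma>)" unfolding D by (rule C2_on_linear[OF S(5,2)])
  show "arrow_deriv G c d \<sigma> (differential (Arr G) (Obj G) (src G) \<sigma> z c) = differential (Arr G) (Obj G) (tgt G) \<sigma> z d"
    if "z \<in> tangent_space (Arr G) \<sigma>"
    using S(6)[rule_format, OF S(2), of z] that unfolding D S(3) by blast
qed

lemma arrow_deriv_ident:
  assumes c: "c \<in> charts_at (Obj G) x"
  shows "arrow_deriv G c c (ident G x) u = u"
proof -
  note mO = manifold_Obj[OF G]
  have C: "c \<in> charts (Obj G)" "x \<in> fst c" "x \<in> points (Obj G)" using charts_at_D[OF mO c] by blast+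
  note sx = src_ident[OF G C(3)]
  let ?S = "\<lambda>q. ident G (chart_inv c q)"
  have eq: "\<forall>\<^sub>F q in nhds (snd c x). q = snd c (tgt G (?S q))"
    using eventually_nhds_in_open[OF open_chart_image[OF mO C(1)] imageI[OF C(2)]]
  proof (rule eventually_mono)
    fix q assume q: "q \<in> snd c ` fst c"
    then have "chart_inv c q \<in> points (Obj G)" using chart_inv_in[OF q] chart_dom_subset[OF mO C(1)] by blast
    then show "q = snd c (tgt G (?S q))" using tgt_ident[OF G] chart_chart_inv[OF q] by simp
  qed
  have "arrow_deriv G c c (ident G x) = frechet_derivative (\<lambda>q. snd c (tgt G (?S q))) (at (snd c (src G (ident G x))))"
    using differentiable_cong_nhds(1)[OF eq] local_section_ident[OF G C(1)] C(2) chart_inv_chart[OF chart_inj[OF mO C(1)] C(2)]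
    by (intro arrow_deriv_section[where U = "snd c ` fst c"]) (simp_all add: sx)
  also have "\<dots> = frechet_derivative (\<lambda>q. q) (at (snd c x))"
    unfolding sx by (rule differentiable_cong_nhds(2)[OF eq]) simp
  finally show ?thesis by simp
qed

text \<open>Functoriality of the linear action: the section through the product has as target map
  the composite of the two target maps, so the chain rule applies.\<close>

lemma arrow_deriv_gmult:
  assumes comp: "(\<sigma>, \<tau>) \<in> composable_pairs G" and c: "c \<in> charts_at (Obj G) (src G \<tau>)"
    and d: "d \<in> charts_at (Obj G) (tgt G \<tau>)" and e: "e \<in> charts_at (Obj G) (tgt G \<sigma>)"
  shows "arrow_deriv G c e (gmult G \<sigma> \<tau>) u = arrow_deriv G d e \<sigma> (arrow_deriv G c d \<tau> u)"
proof -
  note mO = manifold_Obj[OF G]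
  have pts: "\<sigma> \<in> points (Arr G)" "\<tau> \<in> points (Arr G)" "src G \<sigma> = tgt G \<tau>"
    using comp unfolding composable_pairs_def by auto
  have d': "d \<in> charts_at (Obj G) (src G \<sigma>)" using d pts(3) by simp
  obtain U S where S: "local_section G c U S" "snd c (src G \<tau>) \<in> U" "S (snd c (src G \<tau>)) = \<tau>"
    "\<forall>q\<in>U. tgt G (S q) \<in> fst d" "C2_on U (\<lambda>q. snd d (tgt G (S q)))"
    "\<forall>q\<in>U. \<forall>z\<in>tangent_space (Arr G) (S q). frechet_derivative (\<lambda>q. snd d (tgt G (S q))) (at q)
       (differential (Arr G) (Obj G) (src G) (S q) z c) = differential (Arr G) (Obj G) (tgt G) (S q) z d"
    using arrow_section[OF pts(2) c d] .
  obtain U' S' where S': "local_section G d U' S'" "snd d (src G \<sigma>) \<in> U'" "S' (snd d (src G \<sigma>)) = \<sigma>"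
    "\<forall>q\<in>U'. tgt G (S' q) \<in> fst e" "C2_on U' (\<lambda>q. snd e (tgt G (S' q)))"
    "\<forall>q\<in>U'. \<forall>z\<in>tangent_space (Arr G) (S' q). frechet_derivative (\<lambda>q. snd e (tgt G (S' q))) (at q)
       (differential (Arr G) (Obj G) (src G) (S' q) z d) = differential (Arr G) (Obj G) (tgt G) (S' q) z e"
    using arrow_section[OF pts(1) d' e] .
  let ?p = "snd c (src G \<tau>)" and ?F = "\<lambda>q. snd d (tgt G (S q))" and ?F' = "\<lambda>q. snd e (tgt G (S' q))"
  have Fp: "?F ?p = snd d (src G \<sigma>)" using S(3) pts(3) by simp
  have FU: "snd d (tgt G (S ?p)) \<in> U'" using Fp S'(2) by simp
  have Fd: "tgt G (S ?p) \<in> fst d" using S(4,2) by blast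
  obtain U'' where U'': "?p \<in> U''" "U'' \<subseteq> U" "\<forall>q\<in>U''. tgt G (S q) \<in> fst d \<and> snd d (tgt G (S q)) \<in> U'"
    "\<forall>q\<in>U''. (S' (snd d (tgt G (S q))), S q) \<in> composable_pairs G"
    "local_section G c U'' (\<lambda>q. gmult G (S' (snd d (tgt G (S q)))) (S q))"
    using local_section_gmult[OF G S(1) S'(1) S(2) Fd FU] .
  let ?S = "\<lambda>q. gmult G (S' (snd d (tgt G (S q)))) (S q)"
  have sp: "src G (gmult G \<sigma> \<tau>) = src G \<tau>" by (rule src_gmult[OF G comp])
  have Sp: "?S ?p = gmult G \<sigma> \<tau>" using S(3) S'(3) pts(3) by simp
  have dF: "?F differentiable (at ?p)" using S(2,5) unfolding C2_on_def by blast
  have dF': "?F' differentiable (at (snd d (src G \<sigma>)))" using S'(2,5) unfolding C2_on_def by blast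
  then have dF'': "?F' differentiable (at (?F ?p))" unfolding Fp .
  have eq: "\<forall>\<^sub>F q in nhds ?p. (?F' \<circ> ?F) q = snd e (tgt G (?S q))"
    using eventually_nhds_in_open[OF local_sectionD(2)[OF G U''(5)] U''(1)]
    by (rule eventually_mono) (use tgt_gmult[OF G] U''(4) in simp)
  have dFF: "(?F' \<circ> ?F) differentiable (at ?p)" using dF dF'' by (rule differentiable_chain_at)
  have "arrow_deriv G c e (gmult G \<sigma> \<tau>) = frechet_derivative (\<lambda>q. snd e (tgt G (?S q))) (at (snd c (src G (gmult G \<sigma> \<tau>))))"
  proof (rule arrow_deriv_section[OF U''(5)])
    show "snd c (src G (gmult G \<sigma> \<tau>)) \<in> U''" using U''(1) unfolding sp .
    show "?S (snd c (src G (gmult G \<sigma> \<tau>))) = gmult G \<sigma> \<tau>" using Sp unfolding sp .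
    show "(\<lambda>q. snd e (tgt G (?S q))) differentiable (at (snd c (src G (gmult G \<sigma> \<tau>))))"
      unfolding sp by (rule differentiable_cong_nhds(1)[OF eq dFF])
  qed
  also have "\<dots> = frechet_derivative (?F' \<circ> ?F) (at ?p)"
    unfolding sp by (rule differentiable_cong_nhds(2)[OF eq dFF])
  finally have "arrow_deriv G c e (gmult G \<sigma> \<tau>) u = frechet_derivative ?F' (at (?F ?p)) (frechet_derivative ?F (at ?p) u)"
    using frechet_derivative_comp[OF dF dF'', of u] by simp
  then show ?thesis
    unfolding Fp arrow_deriv_section[OF S(1-3) dF] arrow_deriv_section[OF S'(1-3) dF'] .
qed

section \<open>Isotropy groups and their local action\<close>

definition isotropy_group :: "'a \<Rightarrow> 'b monoid" where
  "isotropy_group x = \<lparr>carrier = isotropy G x, mult = gmult G, one = ident G x\<rparr>"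

lemma isotropyD:
  assumes "\<sigma> \<in> isotropy G x"
  shows "\<sigma> \<in> points (Arr G)" "src G \<sigma> = x" "tgt G \<sigma> = x" "x \<in> points (Obj G)"
  using assms src_in[OF G] unfolding isotropy_def by auto

lemma isotropy_composable: "\<sigma> \<in> isotropy G x \<Longrightarrow> \<tau> \<in> isotropy G x \<Longrightarrow> (\<sigma>, \<tau>) \<in> composable_pairs G"
  unfolding isotropy_def composable_pairs_def by auto

lemma ident_isotropy: "x \<in> points (Obj G) \<Longrightarrow> ident G x \<in> isotropy G x"
  using ident_in[OF G] src_ident[OF G] tgt_ident[OF G] unfolding isotropy_def by blast

lemma group_isotropy:
  assumes x: "x \<in> points (Obj G)"
  shows "group (isotropy_group x)"
proof (rule groupI)
  show "\<one>\<^bsub>isotropy_group x\<^esub> \<in> carrier (isotropy_group x)" using ident_isotropy[OF x] by (simp add: isotropy_group_def)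
  fix \<sigma> \<tau> assume "\<sigma> \<in> carrier (isotropy_group x)" "\<tau> \<in> carrier (isotropy_group x)"
  then have st: "\<sigma> \<in> isotropy G x" "\<tau> \<in> isotropy G x" by (simp_all add: isotropy_group_def)
  note comp = isotropy_composable[OF st]
  show "\<sigma> \<otimes>\<^bsub>isotropy_group x\<^esub> \<tau> \<in> carrier (isotropy_group x)"
    using gmult_in[OF G comp] src_gmult[OF G comp] tgt_gmult[OF G comp] isotropyD[OF st(1)] isotropyD[OF st(2)]
    by (simp add: isotropy_group_def isotropy_def)
  fix \<rho> assume "\<rho> \<in> carrier (isotropy_group x)"
  then have "\<rho> \<in> isotropy G x" by (simp add: isotropy_group_def)
  then show "\<sigma> \<otimes>\<^bsub>isotropy_group x\<^esub> \<tau> \<otimes>\<^bsub>isotropy_group x\<^esub> \<rho> = \<sigma> \<otimes>\<^bsub>isotropy_group x\<^esub> (\<tau> \<otimes>\<^bsub>isotropy_group x\<^esub> \<rho>)"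
    using gmult_assoc[OF G comp isotropy_composable[OF st(2)]] by (simp add: isotropy_group_def)
next
  fix \<sigma> assume "\<sigma> \<in> carrier (isotropy_group x)"
  then have s: "\<sigma> \<in> isotropy G x" by (simp add: isotropy_group_def)
  note D = isotropyD[OF s]
  show "\<one>\<^bsub>isotropy_group x\<^esub> \<otimes>\<^bsub>isotropy_group x\<^esub> \<sigma> = \<sigma>"
    using gmult_ident_left[OF G D(1)] D(3) by (simp add: isotropy_group_def)
  have "ginv G \<sigma> \<in> isotropy G x"
    using ginv_in[OF G D(1)] src_ginv[OF G D(1)] tgt_ginv[OF G D(1)] D(2,3) by (simp add: isotropy_def)
  moreover have "gmult G (ginv G \<sigma>) \<sigma> = ident G x" using gmult_ginv_left[OF G D(1)] D(2) by simp
  ultimately show "\<exists>y\<in>carrier (isotropy_group x). y \<otimes>\<^bsub>isotropy_group x\<^esub> \<sigma> = \<one>\<^bsub>isotropy_group x\<^esub>"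
    by (auto simp: isotropy_group_def)
qed

text \<open>Repeated multiplication by the section through \<open>\<sigma>\<close> composes the
  target map with itself once more, so the power on arrows becomes the iterate on
  coordinates.\<close>

lemma isotropy_power_section:
  assumes \<sigma>: "\<sigma> \<in> isotropy G x" and c: "c \<in> charts_at (Obj G) x"
    and S: "local_section G c U S" "snd c x \<in> U" "S (snd c x) = \<sigma>" "\<forall>q\<in>U. tgt G (S q) \<in> fst c"
  shows "\<exists>V R. local_section G c V R \<and> snd c x \<in> V \<and> R (snd c x) = \<sigma> [^]\<^bsub>isotropy_group x\<^esub> n \<and>
    (\<forall>q\<in>V. tgt G (R q) \<in> fst c \<and> snd c (tgt G (R q)) = ((\<lambda>q. snd c (tgt G (S q))) ^^ n) q)"
proof (induction n)
  note mO = manifold_Obj[OF G]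
  have C: "c \<in> charts (Obj G)" "x \<in> fst c" "x \<in> points (Obj G)" using charts_at_D[OF mO c] by blast+
  case 0
  have "tgt G (ident G (chart_inv c q)) \<in> fst c \<and> snd c (tgt G (ident G (chart_inv c q))) = q" if "q \<in> snd c ` fst c" for q
  proof -
    have "chart_inv c q \<in> points (Obj G)" using chart_inv_in[OF that] chart_dom_subset[OF mO C(1)] by blast
    then show ?thesis using tgt_ident[OF G] chart_inv_in[OF that] chart_chart_inv[OF that] by simp
  qed
  moreover have "ident G (chart_inv c (snd c x)) = \<sigma> [^]\<^bsub>isotropy_group x\<^esub> (0::nat)"
    using chart_inv_chart[OF chart_inj[OF mO C(1)] C(2)] by (simp add: isotropy_group_def nat_pow_def)
  ultimately show ?case
    using local_section_ident[OF G C(1)] C(2)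
    by (intro exI[of _ "snd c ` fst c"] exI[of _ "\<lambda>q. ident G (chart_inv c q)"]) simp
next
  case (Suc n)
  then obtain V R where R: "local_section G c V R" "snd c x \<in> V" "R (snd c x) = \<sigma> [^]\<^bsub>isotropy_group x\<^esub> n"
    "\<forall>q\<in>V. tgt G (R q) \<in> fst c \<and> snd c (tgt G (R q)) = ((\<lambda>q. snd c (tgt G (S q))) ^^ n) q" by blast
  note D = isotropyD[OF \<sigma>]
  have tp: "tgt G (S (snd c x)) = x" using S(3) D(3) by simp
  then have "tgt G (S (snd c x)) \<in> fst c" "snd c (tgt G (S (snd c x))) \<in> V" using S(2,4) R(2) by (blast, simp)
  from local_section_gmult[OF G S(1) R(1) S(2) this]
  obtain U'' where U'': "snd c x \<in> U''" "U'' \<subseteq> U" "\<forall>q\<in>U''. tgt G (S q) \<in> fst c \<and> snd c (tgt G (S q)) \<in> V"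
    "\<forall>q\<in>U''. (R (snd c (tgt G (S q))), S q) \<in> composable_pairs G"
    "local_section G c U'' (\<lambda>q. gmult G (R (snd c (tgt G (S q)))) (S q))" .
  have "gmult G (R (snd c (tgt G (S (snd c x))))) (S (snd c x)) = \<sigma> [^]\<^bsub>isotropy_group x\<^esub> Suc n"
    using R(3) by (simp add: S(3) D(3) isotropy_group_def nat_pow_def)
  moreover have "tgt G (gmult G (R (snd c (tgt G (S q)))) (S q)) \<in> fst c \<and>
      snd c (tgt G (gmult G (R (snd c (tgt G (S q)))) (S q))) = ((\<lambda>q. snd c (tgt G (S q))) ^^ Suc n) q"
    if "q \<in> U''" for q
    using U''(3,4) that R(4) tgt_gmult[OF G] unfolding funpow_Suc_right by simp
  ultimately show ?case using U''(1,5) by blast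
qed

text \<open>The section through the n-th power and the section of identities meet over
  \<open>x\<close>, hence agree near it; their target maps are the n-th iterate and the
  identity.\<close>

lemma isotropy_finite_order_section:
  assumes \<sigma>: "\<sigma> \<in> isotropy G x" and c: "c \<in> charts_at (Obj G) x"
    and S: "local_section G c U S" "snd c x \<in> U" "S (snd c x) = \<sigma>" "\<forall>q\<in>U. tgt G (S q) \<in> fst c"
    and n: "\<sigma> [^]\<^bsub>isotropy_group x\<^esub> n = ident G x"
  shows "\<forall>\<^sub>F q in nhds (snd c x). ((\<lambda>q. snd c (tgt G (S q))) ^^ n) q = q"
proof -
  note mO = manifold_Obj[OF G]
  have C: "c \<in> charts (Obj G)" "x \<in> fst c" "x \<in> points (Obj G)" using charts_at_D[OF mO c] by blast+
  obtain V R where R: "local_section G c V R" "snd c x \<in> V" "R (snd c x) = \<sigma> [^]\<^bsub>isotropy_group x\<^esub> n"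
    "\<forall>q\<in>V. tgt G (R q) \<in> fst c \<and> snd c (tgt G (R q)) = ((\<lambda>q. snd c (tgt G (S q))) ^^ n) q"
    using isotropy_power_section[OF \<sigma> c S] by blast
  have "R (snd c x) = ident G (chart_inv c (snd c x))"
    using R(3) n chart_inv_chart[OF chart_inj[OF mO C(1)] C(2)] by simp
  from local_section_unique[OF G R(1) local_section_ident[OF G C(1)] R(2) imageI[OF C(2)] this]
    eventually_nhds_in_open[OF local_sectionD(2)[OF G R(1)] R(2)]
  show ?thesis
  proof eventually_elim
    case (elim q)
    have q: "q \<in> snd c ` fst c" using local_sectionD(3)[OF G R(1)] elim(2) by blast
    have "chart_inv c q \<in> points (Obj G)" using chart_inv_in[OF q] chart_dom_subset[OF mO C(1)] by blast
    then have "snd c (tgt G (R q)) = q" using elim(1) tgt_ident[OF G] chart_chart_inv[OF q] by simp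
    then show ?case using R(4) elim(2) by simp
  qed
qed

text \<open>The isotropy group is a fibre of a proper map, hence compact. It is covered by open sets
  on which the source is injective, and each of these contains at most one of its elements.\<close>

lemma finite_isotropy:
  assumes proper: "proper_groupoid G" and x: "x \<in> points (Obj G)"
  shows "finite (isotropy G x)"
proof -
  let ?A = "mtop (Arr G)"
  note mA = manifold_Arr[OF G] and mO = manifold_Obj[OF G]
  have "compactin ?A {\<sigma> \<in> topspace ?A. (src G \<sigma>, tgt G \<sigma>) = (x, x)}"
    using proper x unfolding proper_groupoid_def proper_map_def
    by (simp add: manifold_topspace[OF mO] manifold_topspace[OF mA])
  moreover have "{\<sigma> \<in> topspace ?A. (src G \<sigma>, tgt G \<sigma>) = (x, x)} = isotropy G x"
    unfolding isotropy_def manifold_topspace[OF mA] by auto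
  ultimately have comp: "compactin ?A (isotropy G x)" by simp
  define \<W> where "\<W> = {W. openin ?A W \<and> inj_on (src G) W}"
  have "isotropy G x \<subseteq> \<Union>\<W>"
  proof
    fix \<sigma> assume "\<sigma> \<in> isotropy G x"
    then have "\<sigma> \<in> points (Arr G)" by (rule isotropyD(1))
    then show "\<sigma> \<in> \<Union>\<W>" by (rule src_nbhd[OF G]) (auto simp: \<W>_def)
  qed
  then obtain \<F> where \<F>: "finite \<F>" "\<F> \<subseteq> \<W>" "isotropy G x \<subseteq> \<Union>\<F>"
    using compactinD[OF comp, of \<W>] unfolding \<W>_def by blast
  have "finite (isotropy G x \<inter> W)" if "W \<in> \<F>" for W
  proof -
    have "inj_on (src G) (isotropy G x \<inter> W)" using that \<F>(2) inj_on_subset unfolding \<W>_def by blast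
    moreover have "src G ` (isotropy G x \<inter> W) \<subseteq> {x}" unfolding isotropy_def by blast
    ultimately show ?thesis using inj_on_finite by blast
  qed
  then have "finite (\<Union>W\<in>\<F>. isotropy G x \<inter> W)" using \<F>(1) by blast
  moreover have "isotropy G x \<subseteq> (\<Union>W\<in>\<F>. isotropy G x \<inter> W)" using \<F>(3) by blast
  ultimately show ?thesis by (rule rev_finite_subset)
qed

text \<open>Links the germs of the definitions with local sections: the inverse of the source on
  \<open>W\<close> and the section pass through the same arrow.\<close>

lemma germ_map_section:
  assumes \<sigma>: "\<sigma> \<in> points (Arr G)" and W: "arrow_nbhd G \<sigma> W"
    and S: "local_section G c U S" "snd c (src G \<sigma>) \<in> U" "S (snd c (src G \<sigma>)) = \<sigma>"
  shows "\<forall>\<^sub>F q in nhds (snd c (src G \<sigma>)). chart_inv c q \<in> src G ` W \<and> germ_map G W (chart_inv c q) = tgt G (S q)"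
proof -
  have W: "openin (mtop (Arr G)) W" "\<sigma> \<in> W" "inj_on (src G) W" using W unfolding arrow_nbhd_def by blast+
  have "S (snd c (src G \<sigma>)) \<in> W" using S(3) W(2) by simp
  from eventually_local_section[OF G S(1,2) W(1) this] show ?thesis
  proof eventually_elim
    case (elim q)
    then have "chart_inv c q = src G (S q)" using local_sectionD(5)[OF G S(1)] by simp
    then show ?case using elim inv_into_f_f[OF W(3)] by (simp add: germ_map_def)
  qed
qed

text \<open>If the target map along the section is the identity near \<open>x\<close>, then
  \<open>\<sigma>\<close> and the identity arrow define the same germ, and effectiveness identifies
  them.\<close>

lemma effective_imp_ident:
  assumes eff: "effective_groupoid G" and \<sigma>: "\<sigma> \<in> isotropy G x" and c: "c \<in> charts_at (Obj G) x"
    and S: "local_section G c U S" "snd c x \<in> U" "S (snd c x) = \<sigma>" "\<forall>q\<in>U. tgt G (S q) \<in> fst c"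
    and triv: "\<forall>\<^sub>F q in nhds (snd c x). snd c (tgt G (S q)) = q"
  shows "\<sigma> = ident G x"
proof -
  note mO = manifold_Obj[OF G] and D = isotropyD[OF \<sigma>]
  have C: "c \<in> charts (Obj G)" "x \<in> fst c" using charts_at_D[OF mO c] by blast+
  note i = ident_in[OF G D(4)] and sx = src_ident[OF G D(4)]
  obtain W where W: "arrow_nbhd G \<sigma> W" using src_nbhd[OF G D(1)] unfolding arrow_nbhd_def by metis
  obtain W' where W': "arrow_nbhd G (ident G x) W'" using src_nbhd[OF G i] unfolding arrow_nbhd_def by metis
  have "snd c (src G (ident G x)) \<in> snd c ` fst c" "ident G (chart_inv c (snd c (src G (ident G x)))) = ident G x"
    using sx C(2) chart_inv_chart[OF chart_inj[OF mO C(1)] C(2)] by auto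
  note e2 = germ_map_section[OF i W' local_section_ident[OF G C(1)] this, unfolded sx]
  have "snd c (src G \<sigma>) \<in> U" "S (snd c (src G \<sigma>)) = \<sigma>" using S(2,3) D(2) by simp_all
  note e1 = germ_map_section[OF D(1) W S(1) this, unfolded D(2)]
  have "\<forall>\<^sub>F q in nhds (snd c x). chart_inv c q \<in> src G ` W \<inter> src G ` W' \<and>
      germ_map G W (chart_inv c q) = germ_map G W' (chart_inv c q)"
    using e1 e2 triv eventually_nhds_in_open[OF local_sectionD(2)[OF G S(1)] S(2)]
  proof eventually_elim
    case (elim q)
    have q: "q \<in> snd c ` fst c" using elim(4) local_sectionD(3)[OF G S(1)] by blast
    have "chart_inv c q \<in> points (Obj G)" using chart_inv_in[OF q] chart_dom_subset[OF mO C(1)] by blast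
    then have "germ_map G W' (chart_inv c q) = chart_inv c q" using elim(2) tgt_ident[OF G] by simp
    moreover have "tgt G (S q) = chart_inv c q"
      using elim(3,4) S(4) chart_inv_chart[OF chart_inj[OF mO C(1)], of "tgt G (S q)"] by simp
    ultimately show ?case using elim(1,2) by simp
  qed
  then obtain Q where Q: "open Q" "snd c x \<in> Q" "\<And>q. q \<in> Q \<Longrightarrow> chart_inv c q \<in> src G ` W \<inter> src G ` W' \<and>
      germ_map G W (chart_inv c q) = germ_map G W' (chart_inv c q)"
    unfolding eventually_nhds by blast
  have N: "y \<in> src G ` W \<inter> src G ` W' \<and> germ_map G W y = germ_map G W' y" if "y \<in> fst c \<inter> snd c -` Q" for y
    using Q(3)[of "snd c y"] that chart_inv_chart[OF chart_inj[OF mO C(1)], of y] by simp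
  have "same_germ G \<sigma> (ident G x)"
    unfolding same_germ_def D(2) sx
  proof (intro conjI refl exI)
    show "openin (mtop (Obj G)) (fst c \<inter> snd c -` Q)" by (rule openin_chart_preimage[OF mO C(1) Q(1)])
    show "x \<in> fst c \<inter> snd c -` Q" using C(2) Q(2) by simp
    show "fst c \<inter> snd c -` Q \<subseteq> src G ` W \<inter> src G ` W'" using N by blast
    show "\<forall>y\<in>fst c \<inter> snd c -` Q. germ_map G W y = germ_map G W' y" using N by blast
  qed (fact W W')+
  then show ?thesis using eff D(1) i unfolding effective_groupoid_def by blast
qed

end


section \<open>Free actions on directions\<close>

lemma even_card_involution:
  assumes "finite X" "\<And>x. x \<in> X \<Longrightarrow> h x \<in> X \<and> h (h x) = x \<and> h x \<noteq> x"
  shows "even (card X)"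
  using assms
proof (induction X rule: finite_psubset_induct)
  case (psubset X)
  show ?case
  proof (cases "X = {}")
    case False
    then obtain x where x: "x \<in> X" by blast
    note hx = psubset.prems[OF x]
    have "even (card (X - {x, h x}))"
    proof (rule psubset.IH)
      show "X - {x, h x} \<subset> X" using x by blast
      fix y assume y: "y \<in> X - {x, h x}"
      then have "h y \<in> X" "h (h y) = y" "h y \<noteq> y" using psubset.prems by blast+
      moreover have "h y \<noteq> x" "h y \<noteq> h x" using y hx calculation(2) by force+
      ultimately show "h y \<in> X - {x, h x} \<and> h (h y) = y \<and> h y \<noteq> y" by blast
    qed
    moreover have "card X = card (X - {x, h x}) + 2"
    proof -
      have "card (X - {x, h x}) = card X - card {x, h x}"
        using x hx by (intro card_Diff_subset) auto
      moreover have "card {x, h x} \<le> card X"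
        using x hx psubset.hyps(1) by (intro card_mono) auto
      moreover have "card {x, h x} = 2" using hx by (auto simp: card_insert_if)
      ultimately show ?thesis by linarith
    qed
    ultimately show ?thesis by simp
  qed simp
qed

text \<open>Without an involution, inversion would pair off the nontrivial elements without fixed
  points. Their number would be even and the order of the group odd.\<close>

lemma (in group) even_order_involution:
  assumes fin: "finite (carrier G)" and even: "even (order G)"
  obtains a where "a \<in> carrier G" "a \<noteq> \<one>" "a \<otimes> a = \<one>"
proof (rule ccontr)
  assume no: "\<not> thesis"
  have "even (card (carrier G - {\<one>}))"
  proof (rule even_card_involution[of _ "\<lambda>a. inv a"])
    fix a assume a: "a \<in> carrier G - {\<one>}"
    then have "inv a \<noteq> a"
      using no that[of a] r_inv[of a] by force
    then show "inv a \<in> carrier G - {\<one>} \<and> inv (inv a) = a \<and> inv a \<noteq> a"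
      using a by (auto simp: inv_eq_1_iff)
  qed (use fin in simp)
  moreover have "card (carrier G) = Suc (card (carrier G - {\<one>}))"
    using fin by (metis card.remove one_closed)
  ultimately show False using even unfolding order_def by presburger
qed

lemma funpow_has_derivative:
  assumes "(F has_derivative A) (at p)" "F p = p"
  shows "((F ^^ n) has_derivative (A ^^ n)) (at p)"
proof (induction n)
  case 0
  then show ?case by (simp add: id_def)
next
  case (Suc n)
  have "(F ^^ n) p = p" by (induction n) (simp_all add: assms(2))
  then have "(F has_derivative A) (at ((F ^^ n) p))" using assms(1) by simp
  from diff_chain_at[OF Suc this] show ?case by (simp only: funpow.simps)
qed

text \<open>At a fixed point the derivative of an iterate is the iterate of the derivative, so
  finite order of a germ passes to its linear part.\<close>

lemma finite_order_derivative:
  fixes F :: "'e::real_normed_vector \<Rightarrow> 'e"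
  assumes "F differentiable (at p)" "F p = p" "\<forall>\<^sub>F q in nhds p. (F ^^ n) q = q"
  shows "(frechet_derivative F (at p) ^^ n) w = w"
proof -
  have "\<forall>\<^sub>F q in nhds p. (\<lambda>q. q) q = (F ^^ n) q" using assms(3) by (rule eventually_mono) simp
  then have "frechet_derivative (F ^^ n) (at p) = frechet_derivative (\<lambda>q. q) (at p)"
    by (rule differentiable_cong_nhds(2)) simp
  moreover have "frechet_derivative (F ^^ n) (at p) = frechet_derivative F (at p) ^^ n"
    using frechet_derivative_at[OF funpow_has_derivative[of F "frechet_derivative F (at p)" p n]] assms(1,2)
    by (simp add: frechet_derivative_works)
  ultimately show ?thesis by (metis frechet_derivative_ident)
qed

section \<open>Properness and freeness of the prolonged groupoid\<close>

context
  fixes T :: "real set" and G :: "('a, 'b, 'e::euclidean_space) dist_groupoid"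
  assumes T: "line_or_ray_scalars T" and G: "etale_lie_groupoid G"
    and \<xi>: "distribution (Obj G) 2 (Obj_dist G)" and \<zeta>: "distribution (Arr G) 2 (Arr_dist G)"
    and tgt: "local_diffeo (Arr G) (Obj G) (tgt G)"
    and ds: "\<forall>\<sigma>\<in>points (Arr G). differential (Arr G) (Obj G) (src G) \<sigma> ` Arr_dist G \<sigma> = Obj_dist G (src G \<sigma>)"
    and dt: "\<forall>\<sigma>\<in>points (Arr G). differential (Arr G) (Obj G) (tgt G) \<sigma> ` Arr_dist G \<sigma> = Obj_dist G (tgt G \<sigma>)"
begin

lemma mA: "manifold (Arr G)" and mO: "manifold (Obj G)"
  by (rule manifold_Arr[OF G], rule manifold_Obj[OF G])

lemma Arr_dist_subset: "\<sigma> \<in> points (Arr G) \<Longrightarrow> Arr_dist G \<sigma> \<subseteq> tangent_space (Arr G) \<sigma>"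
  by (rule distribution_subset[OF mA \<zeta>])

lemma differential_tv_zero:
  assumes "\<sigma> \<in> points (Arr G)" "smooth_map (Arr G) (Obj G) f"
  shows "differential (Arr G) (Obj G) f \<sigma> tv_zero = tv_zero"
proof -
  have "tv_scale 0 tv_zero = tv_zero" "tv_scale 0 v = tv_zero" for v :: "('a, 'e) tvec"
    by (simp_all add: tv_scale_def tv_zero_def)
  moreover have "tv_scale 0 tv_zero = (tv_zero :: ('b, 'e) tvec)" by (simp add: tv_scale_def tv_zero_def)
  ultimately show ?thesis
    using differential_scale[OF mA mO smooth_map_diff_at[OF mA mO assms(2,1)] tv_zero_in_tangent_space[OF mA], of 0] by simp
qed

lemma differential_src_inj:
  assumes "\<sigma> \<in> points (Arr G)" "v \<in> Arr_dist G \<sigma>" "w \<in> Arr_dist G \<sigma>"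
    "differential (Arr G) (Obj G) (src G) \<sigma> v = differential (Arr G) (Obj G) (src G) \<sigma> w"
  shows "v = w"
  using assms Arr_dist_subset[OF assms(1)]
  by (intro local_diffeo_differential_inj[OF mA mO smooth_src[OF G] local_diffeo_src[OF G] _ _ assms(1)]) blast+

lemma differential_tgt_inj:
  assumes "\<sigma> \<in> points (Arr G)" "v \<in> Arr_dist G \<sigma>" "w \<in> Arr_dist G \<sigma>"
    "differential (Arr G) (Obj G) (tgt G) \<sigma> v = differential (Arr G) (Obj G) (tgt G) \<sigma> w"
  shows "v = w"
  using assms Arr_dist_subset[OF assms(1)]
  by (intro local_diffeo_differential_inj[OF mA mO smooth_tgt[OF G] tgt _ _ assms(1)]) blast+

lemma tv_zero_in_Arr_dist:
  assumes "\<sigma> \<in> points (Arr G)"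
  shows "tv_zero \<in> Arr_dist G \<sigma>"
proof -
  obtain v where "v \<in> Arr_dist G \<sigma>" "v \<noteq> tv_zero" using distribution_nonzero[OF mA \<zeta> assms] .
  then have "tv_scale 0 v \<in> Arr_dist G \<sigma>" using distribution_scale[OF mA \<zeta> assms] by blast
  then show ?thesis by (simp add: tv_scale_def tv_zero_def)
qed

text \<open>Source and target are local diffeomorphisms, so their differentials kill no direction
  and the prolonged maps are continuous; the comparison of properness then applies.\<close>

lemma proper_prol_groupoid_iff: "proper_groupoid (prol_groupoid T G) \<longleftrightarrow> proper_groupoid G"
proof -
  have "\<forall>x\<in>points (Arr G). \<forall>v\<in>Arr_dist G x. differential (Arr G) (Obj G) (src G) x v = tv_zero \<longrightarrow> v = tv_zero"
    using differential_src_inj tv_zero_in_Arr_dist differential_tv_zero smooth_src[OF G] by metis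
  then have s: "continuous_map (mtop (prolongation T (Arr G) (Arr_dist G))) (mtop (prolongation T (Obj G) (Obj_dist G)))
      (prol_map (Arr G) (Obj G) (src G))"
    using ds by (intro continuous_map_prol_map[OF T mA mO \<zeta> \<xi> smooth_src[OF G]]) blast+
  have "\<forall>x\<in>points (Arr G). \<forall>v\<in>Arr_dist G x. differential (Arr G) (Obj G) (tgt G) x v = tv_zero \<longrightarrow> v = tv_zero"
    using differential_tgt_inj tv_zero_in_Arr_dist differential_tv_zero smooth_tgt[OF G] by metis
  then have t: "continuous_map (mtop (prolongation T (Arr G) (Arr_dist G))) (mtop (prolongation T (Obj G) (Obj_dist G)))
      (prol_map (Arr G) (Obj G) (tgt G))"
    using dt by (intro continuous_map_prol_map[OF T mA mO \<zeta> \<xi> smooth_tgt[OF G]]) blast+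
  show ?thesis
    unfolding proper_groupoid_def prol_groupoid_def groupoid.select_convs
    by (rule proper_map_prolongation_iff[OF T mA mO \<zeta> \<xi> s t])
qed

text \<open>Every vector of the plane at the source is the image of a vector \<open>z\<close> of the
  plane at the arrow; the action sends it to the image of \<open>z\<close> under the differential of
  the target, which is again injective.\<close>

lemma arrow_deriv_dist:
  assumes \<sigma>: "\<sigma> \<in> points (Arr G)" and c: "c \<in> charts_at (Obj G) (src G \<sigma>)" and d: "d \<in> charts_at (Obj G) (tgt G \<sigma>)"
    and u: "u \<in> (\<lambda>v. v c) ` Obj_dist G (src G \<sigma>)"
  shows "arrow_deriv G c d \<sigma> u \<in> (\<lambda>v. v d) ` Obj_dist G (tgt G \<sigma>)"
    and "arrow_deriv G c d \<sigma> u = 0 \<Longrightarrow> u = 0"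
proof -
  obtain z where z: "z \<in> Arr_dist G \<sigma>" "u = differential (Arr G) (Obj G) (src G) \<sigma> z c"
  proof -
    obtain y where y: "y \<in> Obj_dist G (src G \<sigma>)" "u = y c" using u by blast
    then have "y \<in> differential (Arr G) (Obj G) (src G) \<sigma> ` Arr_dist G \<sigma>" using ds \<sigma> by simp
    then show thesis using that y(2) by blast
  qed
  have zt: "z \<in> tangent_space (Arr G) \<sigma>" using z(1) Arr_dist_subset[OF \<sigma>] by blast
  have e: "arrow_deriv G c d \<sigma> u = differential (Arr G) (Obj G) (tgt G) \<sigma> z d"
    unfolding z(2) by (rule arrow_deriv_differential(2)[OF G \<sigma> c d zt])
  have tz: "differential (Arr G) (Obj G) (tgt G) \<sigma> z \<in> Obj_dist G (tgt G \<sigma>)" using dt \<sigma> z(1) by blast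
  then show "arrow_deriv G c d \<sigma> u \<in> (\<lambda>v. v d) ` Obj_dist G (tgt G \<sigma>)" unfolding e by blast
  assume "arrow_deriv G c d \<sigma> u = 0"
  then have "differential (Arr G) (Obj G) (tgt G) \<sigma> z = tv_zero"
    using distribution_eq_zero_iff[OF mO \<xi> d tz] e by simp
  then have "z = tv_zero"
    using differential_tgt_inj[OF \<sigma> z(1) tv_zero_in_Arr_dist[OF \<sigma>]] differential_tv_zero[OF \<sigma> smooth_tgt[OF G]] by simp
  then show "u = 0" unfolding z(2) using differential_tv_zero[OF \<sigma> smooth_src[OF G]] by (simp add: tv_zero_def)
qed

text \<open>A fixed line or ray is an eigenvector whose eigenvalue is a nonzero element of
  \<open>T\<close>, so freeness becomes a statement about the linear maps
  \<open>arrow_deriv\<close>.\<close>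

definition acts_freely_on_directions :: bool where
  "acts_freely_on_directions \<longleftrightarrow> (\<forall>x\<in>points (Obj G). \<forall>c\<in>charts_at (Obj G) x. \<forall>\<sigma>\<in>isotropy G x.
     \<forall>u\<in>(\<lambda>v. v c) ` Obj_dist G x. \<forall>a\<in>T. u \<noteq> 0 \<longrightarrow> a \<noteq> 0 \<longrightarrow> arrow_deriv G c c \<sigma> u = a *\<^sub>R u \<longrightarrow> \<sigma> = ident G x)"

lemma prol_map_orbit:
  assumes "\<sigma> \<in> points (Arr G)" "v \<in> Arr_dist G \<sigma>" "smooth_map (Arr G) (Obj G) f"
  shows "prol_map (Arr G) (Obj G) f (\<sigma>, tv_orbit T v) = (f \<sigma>, tv_orbit T (differential (Arr G) (Obj G) f \<sigma> v))"
  unfolding prol_map_def split_conv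
  using differential_orbit[OF mA mO smooth_map_diff_at[OF mA mO assms(3,1)]] Arr_dist_subset[OF assms(1)] assms(2) by blast

lemma free_prol_groupoid_iff:
  "free_groupoid (prol_groupoid T G) \<longleftrightarrow>
    inj_on (\<lambda>p. (prol_map (Arr G) (Obj G) (src G) p, prol_map (Arr G) (Obj G) (tgt G) p)) (prol_points T (Arr G) (Arr_dist G))"
  unfolding free_groupoid_def prol_groupoid_def groupoid.select_convs points_prolongation ..

text \<open>A direction \<open>y\<close> fixed by \<open>\<sigma>\<close> is lifted along the source
  to \<open>\<sigma>\<close> and to the identity arrow. The two prolonged arrows obtained share
  source and target, so freeness makes them equal.\<close>

lemma free_imp_acts_freely:
  assumes free: "free_groupoid (prol_groupoid T G)"
  shows acts_freely_on_directions
  unfolding acts_freely_on_directions_def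
proof (intro ballI impI)
  fix x c \<sigma> u a assume x: "x \<in> points (Obj G)" and c: "c \<in> charts_at (Obj G) x" and iso: "\<sigma> \<in> isotropy G x"
    and u: "u \<in> (\<lambda>v. v c) ` Obj_dist G x" and a: "a \<in> T" "a \<noteq> 0" and u0: "u \<noteq> 0"
    and fixed: "arrow_deriv G c c \<sigma> u = a *\<^sub>R u"
  note \<sigma> = isotropyD[OF G iso]
  note i = ident_in[OF G x] and six = src_ident[OF G x] and tix = tgt_ident[OF G x]
  obtain y where y: "y \<in> Obj_dist G x" "u = y c" using u by blast
  have y0: "y \<noteq> tv_zero" using y(2) u0 by (auto simp: tv_zero_def)
  have c1: "c \<in> charts_at (Obj G) (src G \<sigma>)" "c \<in> charts_at (Obj G) (tgt G \<sigma>)" using c \<sigma> by simp_all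
  have c2: "c \<in> charts_at (Obj G) (src G (ident G x))" "c \<in> charts_at (Obj G) (tgt G (ident G x))" using c six tix by simp_all
  have "y \<in> differential (Arr G) (Obj G) (src G) \<sigma> ` Arr_dist G \<sigma>" using ds \<sigma>(1,2) y(1) by simp
  then obtain v where v: "v \<in> Arr_dist G \<sigma>" "differential (Arr G) (Obj G) (src G) \<sigma> v = y" by blast
  have "y \<in> differential (Arr G) (Obj G) (src G) (ident G x) ` Arr_dist G (ident G x)" using ds i six y(1) by simp
  then obtain w where w: "w \<in> Arr_dist G (ident G x)" "differential (Arr G) (Obj G) (src G) (ident G x) w = y" by blast
  have nz: "v \<noteq> tv_zero" "w \<noteq> tv_zero"
    using y0 v(2) w(2) differential_tv_zero[OF _ smooth_src[OF G]] \<sigma>(1) i by auto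
  let ?y = "differential (Arr G) (Obj G) (tgt G) \<sigma> v" and ?y' = "differential (Arr G) (Obj G) (tgt G) (ident G x) w"
  have yD: "?y \<in> Obj_dist G x" "?y' \<in> Obj_dist G x" using dt \<sigma>(1,3) v(1) i tix w(1) by (metis imageI)+
  have vt: "v \<in> tangent_space (Arr G) \<sigma>" using v(1) Arr_dist_subset[OF \<sigma>(1)] by blast
  have wt: "w \<in> tangent_space (Arr G) (ident G x)" using w(1) Arr_dist_subset[OF i] by blast
  have "?y c = arrow_deriv G c c \<sigma> (y c)"
    using arrow_deriv_differential(2)[OF G \<sigma>(1) c1 vt] v(2) by simp
  then have "?y c = (tv_scale a y) c" using fixed y(2) by (simp add: tv_scale_def)
  then have ya: "?y = tv_scale a y"
    using distribution_inj[OF mO \<xi> c yD(1) distribution_scale[OF mO \<xi> x y(1)]] by blast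
  have "?y' c = arrow_deriv G c c (ident G x) (y c)"
    using arrow_deriv_differential(2)[OF G i c2 wt] w(2) by simp
  then have "?y' c = y c" using arrow_deriv_ident[OF G c] by simp
  then have yb: "?y' = y" by (rule distribution_inj[OF mO \<xi> c yD(2) y(1)])
  have "(\<sigma>, tv_orbit T v) = (ident G x, tv_orbit T w)"
  proof (rule inj_onD[OF free[unfolded free_prol_groupoid_iff]])
    show "(\<sigma>, tv_orbit T v) \<in> prol_points T (Arr G) (Arr_dist G)" "(ident G x, tv_orbit T w) \<in> prol_points T (Arr G) (Arr_dist G)"
      using \<sigma>(1) v(1) i w(1) nz unfolding prol_points_def by blast+
    show "(prol_map (Arr G) (Obj G) (src G) (\<sigma>, tv_orbit T v), prol_map (Arr G) (Obj G) (tgt G) (\<sigma>, tv_orbit T v)) =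
        (prol_map (Arr G) (Obj G) (src G) (ident G x, tv_orbit T w), prol_map (Arr G) (Obj G) (tgt G) (ident G x, tv_orbit T w))"
      unfolding prol_map_orbit[OF \<sigma>(1) v(1) smooth_src[OF G]] prol_map_orbit[OF \<sigma>(1) v(1) smooth_tgt[OF G]]
        prol_map_orbit[OF i w(1) smooth_src[OF G]] prol_map_orbit[OF i w(1) smooth_tgt[OF G]]
        v(2) w(2) ya yb tv_orbit_scale[OF T a] \<sigma>(2,3) six tix ..
  qed
  then show "\<sigma> = ident G x" by simp
qed

text \<open>For two prolonged arrows over \<open>\<sigma>\<close> and \<open>\<tau>\<close> with the
  same ends, the quotient \<open>\<rho>\<close> of \<open>\<sigma>\<close> by \<open>\<tau>\<close>
  is an isotropy element fixing the direction at the source. It is therefore trivial, and then the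
  directions agree because the differential of the source is injective.\<close>

lemma acts_freely_imp_free:
  assumes af: acts_freely_on_directions
  shows "free_groupoid (prol_groupoid T G)"
  unfolding free_prol_groupoid_iff
proof (rule inj_onI)
  fix p p' assume p: "p \<in> prol_points T (Arr G) (Arr_dist G)" "p' \<in> prol_points T (Arr G) (Arr_dist G)"
    and eq: "(prol_map (Arr G) (Obj G) (src G) p, prol_map (Arr G) (Obj G) (tgt G) p) =
      (prol_map (Arr G) (Obj G) (src G) p', prol_map (Arr G) (Obj G) (tgt G) p')"
  obtain \<sigma> v where v: "p = (\<sigma>, tv_orbit T v)" "\<sigma> \<in> points (Arr G)" "v \<in> Arr_dist G \<sigma>" "v \<noteq> tv_zero"
    using p(1) unfolding prol_points_def by blast
  obtain \<tau> w where w: "p' = (\<tau>, tv_orbit T w)" "\<tau> \<in> points (Arr G)" "w \<in> Arr_dist G \<tau>" "w \<noteq> tv_zero"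
    using p(2) unfolding prol_points_def by blast
  let ?s = "differential (Arr G) (Obj G) (src G)" and ?t = "differential (Arr G) (Obj G) (tgt G)"
  note pm = prol_map_orbit[OF v(2,3)] prol_map_orbit[OF w(2,3)]
  have e: "src G \<sigma> = src G \<tau>" "tv_orbit T (?s \<sigma> v) = tv_orbit T (?s \<tau> w)"
    "tgt G \<sigma> = tgt G \<tau>" "tv_orbit T (?t \<sigma> v) = tv_orbit T (?t \<tau> w)"
    using eq unfolding v(1) w(1) pm[OF smooth_src[OF G]] pm[OF smooth_tgt[OF G]] by simp_all
  have "?s \<tau> w \<noteq> tv_zero"
    using differential_src_inj[OF w(2,3) tv_zero_in_Arr_dist[OF w(2)]] differential_tv_zero[OF w(2) smooth_src[OF G]] w(4) by metis
  then obtain a where a: "a \<in> T" "a \<noteq> 0" "?s \<tau> w = tv_scale a (?s \<sigma> v)"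
    by (rule tv_orbit_eqD[OF T e(2)])
  have "?t \<tau> w \<noteq> tv_zero"
    using differential_tgt_inj[OF w(2,3) tv_zero_in_Arr_dist[OF w(2)]] differential_tv_zero[OF w(2) smooth_tgt[OF G]] w(4) by metis
  then obtain b where b: "b \<in> T" "b \<noteq> 0" "?t \<tau> w = tv_scale b (?t \<sigma> v)"
    by (rule tv_orbit_eqD[OF T e(4)])
  define x where "x = src G \<tau>"
  define \<rho> where "\<rho> = gmult G (ginv G \<tau>) \<sigma>"
  have c1: "(ginv G \<tau>, \<sigma>) \<in> composable_pairs G" "(\<tau>, ginv G \<tau>) \<in> composable_pairs G"
    using ginv_in[OF G w(2)] src_ginv[OF G w(2)] tgt_ginv[OF G w(2)] v(2) w(2) e(3) unfolding composable_pairs_def by auto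
  have \<rho>: "\<rho> \<in> isotropy G x"
    using gmult_in[OF G c1(1)] src_gmult[OF G c1(1)] tgt_gmult[OF G c1(1)] tgt_ginv[OF G w(2)] e(1)
    unfolding \<rho>_def x_def isotropy_def by simp
  note R = isotropyD[OF G \<rho>]
  have \<tau>\<rho>: "(\<tau>, \<rho>) \<in> composable_pairs G" using w(2) R unfolding composable_pairs_def x_def by simp
  have "gmult G \<tau> \<rho> = gmult G (gmult G \<tau> (ginv G \<tau>)) \<sigma>" unfolding \<rho>_def by (rule gmult_assoc[OF G c1(2,1), symmetric])
  then have prod: "gmult G \<tau> \<rho> = \<sigma>"
    using gmult_ginv_right[OF G w(2)] gmult_ident_left[OF G v(2)] e(3) by simp
  obtain c where c: "c \<in> charts_at (Obj G) x" using charts_at_ex[OF mO R(4)] by blast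
  obtain d where d: "d \<in> charts_at (Obj G) (tgt G \<tau>)" using charts_at_ex[OF mO tgt_in[OF G w(2)]] by blast
  have c\<tau>: "c \<in> charts_at (Obj G) (src G \<tau>)" and c\<sigma>: "c \<in> charts_at (Obj G) (src G \<sigma>)" and d\<sigma>: "d \<in> charts_at (Obj G) (tgt G \<sigma>)"
    and c\<rho>: "c \<in> charts_at (Obj G) (src G \<rho>)" "c \<in> charts_at (Obj G) (tgt G \<rho>)"
    using c d e R unfolding x_def by simp_all
  let ?B = "arrow_deriv G c d \<tau>" and ?A = "arrow_deriv G c c \<rho>"
  define u where "u = ?s \<sigma> v c"
  have sv: "?s \<sigma> v \<in> Obj_dist G x" using ds v(2,3) e(1) unfolding x_def by (metis imageI)
  have uP: "u \<in> (\<lambda>v. v c) ` Obj_dist G x" unfolding u_def using sv by blast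
  have "?s \<sigma> v \<noteq> tv_zero"
    using differential_src_inj[OF v(2,3) tv_zero_in_Arr_dist[OF v(2)]] differential_tv_zero[OF v(2) smooth_src[OF G]] v(4) by metis
  then have u0: "u \<noteq> 0" unfolding u_def using distribution_eq_zero_iff[OF mO \<xi> c sv] by blast
  have vt: "v \<in> tangent_space (Arr G) \<sigma>" using v(3) Arr_dist_subset[OF v(2)] by blast
  have wt: "w \<in> tangent_space (Arr G) \<tau>" using w(3) Arr_dist_subset[OF w(2)] by blast
  have BA: "?B (?A u) = ?t \<sigma> v d"
    using arrow_deriv_gmult[OF G \<tau>\<rho> c\<rho> d, of u] arrow_deriv_differential(2)[OF G v(2) c\<sigma> d\<sigma> vt]
    unfolding prod u_def by simp
  have sw: "?s \<tau> w c = a *\<^sub>R u" unfolding a(3) u_def by (simp add: tv_scale_def)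
  have tw: "?t \<tau> w d = b *\<^sub>R ?t \<sigma> v d" unfolding b(3) by (simp add: tv_scale_def)
  have "?B (?s \<tau> w c) = ?t \<tau> w d" by (rule arrow_deriv_differential(2)[OF G w(2) c\<tau> d wt])
  then have Ba: "?B (a *\<^sub>R u) = b *\<^sub>R ?B (?A u)"
    unfolding sw tw BA .
  have lin: "linear ?B" by (rule arrow_deriv_differential(1)[OF G w(2) c\<tau> d])
  have AP: "?A u \<in> (\<lambda>v. v c) ` Obj_dist G x"
    using arrow_deriv_dist(1)[OF R(1) c\<rho>, of u] uP unfolding R(2,3) by blast
  have "a *\<^sub>R u - b *\<^sub>R ?A u \<in> (\<lambda>v. v c) ` Obj_dist G (src G \<tau>)"
    using uP AP coord_plane(1)[OF mO \<xi> c] unfolding x_def[symmetric] by (intro subspace_diff subspace_scale)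
  moreover have "?B (a *\<^sub>R u - b *\<^sub>R ?A u) = 0"
    using Ba lin by (simp add: linear_diff linear_scale)
  ultimately have "a *\<^sub>R u - b *\<^sub>R ?A u = 0" by (rule arrow_deriv_dist(2)[OF w(2) c\<tau> d])
  then have "a *\<^sub>R u = b *\<^sub>R ?A u" by simp
  \<comment> \<open>The eigenvalue compares two rescalings: \<open>a\<close> between the vectors
    seen at the source, and \<open>b\<close> between those at the target. The quotient is admissible
    because nonzero scalars in \<open>T\<close> are closed under division.\<close>
  from scaleR_solve[OF b(2) this] have fixed: "?A u = (a / b) *\<^sub>R u" by simp
  have abT: "a / b \<in> T" "a / b \<noteq> 0" using a b T by (auto simp: line_or_ray_scalars_def)
  have "\<rho> = ident G x"
    using af[unfolded acts_freely_on_directions_def, rule_format, OF R(4) c \<rho> uP abT(1) u0 abT(2) fixed] .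
  then have st: "\<sigma> = \<tau>" using prod gmult_ident_right[OF G w(2)] unfolding x_def by simp
  have "?s \<tau> w = ?s \<tau> (tv_scale a v)"
    using a(3) differential_scale[OF mA mO smooth_map_diff_at[OF mA mO smooth_src[OF G] v(2)] vt, of a] st by simp
  then have "w = tv_scale a v"
    using differential_src_inj[OF w(2,3)] distribution_scale[OF mA \<zeta> v(2,3), of a] st by blast
  then show "p = p'" unfolding v(1) w(1) st by (simp add: tv_orbit_scale[OF T a(1,2)])
qed

text \<open>Moves the orientation condition from the germ of an arbitrary neighbourhood
  \<open>W\<close> to the coordinate map of a section. In particular it does not depend on
  \<open>W\<close>, and linear algebra in Euclidean space becomes applicable.\<close>

lemma preserves_orientation_iff:
  assumes iso: "\<sigma> \<in> isotropy G x" and W: "arrow_nbhd G \<sigma> W" and c: "c \<in> charts_at (Obj G) x"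
  shows "preserves_orientation (Obj_dist G x) (differential (Obj G) (Obj G) (germ_map G W) x) \<longleftrightarrow>
    (\<forall>u\<in>(\<lambda>v. v c) ` Obj_dist G x. \<forall>v\<in>(\<lambda>v. v c) ` Obj_dist G x. lin_indep2 u v \<longrightarrow>
      (\<exists>\<alpha> \<beta> \<gamma> \<delta>. arrow_deriv G c c \<sigma> u = \<alpha> *\<^sub>R u + \<beta> *\<^sub>R v \<and>
        arrow_deriv G c c \<sigma> v = \<gamma> *\<^sub>R u + \<delta> *\<^sub>R v \<and> \<alpha> * \<delta> - \<beta> * \<gamma> > 0))"
proof -
  note \<sigma> = isotropyD[OF G iso]
  let ?g = "germ_map G W" and ?A = "arrow_deriv G c c \<sigma>"
  have C: "c \<in> charts (Obj G)" "x \<in> fst c" using charts_at_D[OF mO c] by blast+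
  have c': "c \<in> charts_at (Obj G) (src G \<sigma>)" "c \<in> charts_at (Obj G) (tgt G \<sigma>)" using c \<sigma> by simp_all
  obtain U S where S: "local_section G c U S" "snd c (src G \<sigma>) \<in> U" "S (snd c (src G \<sigma>)) = \<sigma>"
    "\<forall>q\<in>U. tgt G (S q) \<in> fst c" "C2_on U (\<lambda>q. snd c (tgt G (S q)))"
    "\<forall>q\<in>U. \<forall>z\<in>tangent_space (Arr G) (S q). frechet_derivative (\<lambda>q. snd c (tgt G (S q))) (at q)
       (differential (Arr G) (Obj G) (src G) (S q) z c) = differential (Arr G) (Obj G) (tgt G) (S q) z c"
    using arrow_section[OF G \<sigma>(1) c'] .
  have dF: "(\<lambda>q. snd c (tgt G (S q))) differentiable (at (snd c (src G \<sigma>)))"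
    using S(2,5) unfolding C2_on_def by blast
  have inj: "inj_on (src G) W" "\<sigma> \<in> W" using W unfolding arrow_nbhd_def by blast+
  have gx: "?g x = x" using inv_into_f_f[OF inj] \<sigma>(2,3) by (simp add: germ_map_def)
  note germ = germ_map_section[OF G \<sigma>(1) W S(1-3), unfolded \<sigma>(2)]
  have near: "\<forall>\<^sub>F q in nhds (snd c x). q \<in> U"
    using eventually_nhds_in_open[OF local_sectionD(2)[OF G S(1)] S(2)] unfolding \<sigma>(2) .
  have eq: "\<forall>\<^sub>F q in nhds (snd c x). snd c (tgt G (S q)) = (snd c \<circ> ?g \<circ> chart_inv c) q"
    using germ by eventually_elim simp
  note dF' = dF[unfolded \<sigma>(2)]
  have "\<forall>\<^sub>F q in nhds (snd c x). ?g (chart_inv c q) \<in> fst c"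
    using germ near by eventually_elim (use S(4) in simp)
  then have dg: "diff_at (Obj G) (Obj G) ?g x"
    unfolding diff_at_def gx using c differentiable_cong_nhds(1)[OF eq dF'] by blast
  have cg: "c \<in> charts_at (Obj G) (?g x)" using c gx by simp
  have sub: "Obj_dist G x \<subseteq> tangent_space (Obj G) x" by (rule distribution_subset[OF mO \<xi> \<sigma>(4)])
  have Ac: "differential (Obj G) (Obj G) ?g x v c = ?A (v c)" if "v \<in> Obj_dist G x" for v
    unfolding differential_eq[OF mO mO dg subsetD[OF sub that] c cg] differentiable_cong_nhds(2)[OF eq dF']
      arrow_deriv_section[OF G S(1-3) dF] \<sigma>(2) ..
  have At: "differential (Obj G) (Obj G) ?g x v \<in> tangent_space (Obj G) x" if "v \<in> Obj_dist G x" for v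
    using differential_in_tangent_space[OF mO mO dg subsetD[OF sub that]] unfolding gx .
  have li: "(\<forall>a b. tv_add (tv_scale a u) (tv_scale b v) = tv_zero \<longrightarrow> a = 0 \<and> b = 0) \<longleftrightarrow> lin_indep2 (u c) (v c)"
    if "u \<in> Obj_dist G x" "v \<in> Obj_dist G x" for u v
    unfolding lin_indep2_def distribution_eq_zero_iff[OF mO \<xi> c distribution_lin_comb[OF mO \<xi> \<sigma>(4) that]]
    by (simp add: tv_add_def tv_scale_def)
  have co: "differential (Obj G) (Obj G) ?g x w = tv_add (tv_scale a u) (tv_scale b v) \<longleftrightarrow> ?A (w c) = a *\<^sub>R u c + b *\<^sub>R v c"
    if "w \<in> Obj_dist G x" "u \<in> Obj_dist G x" "v \<in> Obj_dist G x" for w u v a b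
  proof
    assume "differential (Obj G) (Obj G) ?g x w = tv_add (tv_scale a u) (tv_scale b v)"
    then show "?A (w c) = a *\<^sub>R u c + b *\<^sub>R v c" unfolding Ac[OF that(1), symmetric] by (simp add: tv_add_def tv_scale_def)
  next
    assume "?A (w c) = a *\<^sub>R u c + b *\<^sub>R v c"
    then have "differential (Obj G) (Obj G) ?g x w c = tv_add (tv_scale a u) (tv_scale b v) c"
      unfolding Ac[OF that(1)] by (simp add: tv_add_def tv_scale_def)
    then show "differential (Obj G) (Obj G) ?g x w = tv_add (tv_scale a u) (tv_scale b v)"
      by (rule tangent_space_eqI[OF mO At[OF that(1)] tangent_space_lin_comb[OF mO subsetD[OF sub that(2)] subsetD[OF sub that(3)]] c])
  qed
  show ?thesis
    unfolding preserves_orientation_def ball_simps(9)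
    by (intro ball_cong refl imp_cong) (simp_all only: li co)
qed

end


section \<open>Contact groupoids\<close>

lemma cross3_kernel:
  assumes "lin_indep2 x y"
  shows "{v. (cross3 x y) \<bullet> v = 0} = span {x, y}"
proof -
  have "cross3 x y \<noteq> 0"
  proof
    assume "cross3 x y = 0"
    then have "collinear {0, x, y}" by (simp add: cross_eq_0)
    then consider "x = 0" | "y = 0" | c where "y = c *\<^sub>R x" unfolding collinear_lemma by blast
    then show False
    proof cases
      case 1
      then have "1 *\<^sub>R x + 0 *\<^sub>R y = 0" by simp
      then show ?thesis using assms unfolding lin_indep2_def by (metis zero_neq_one)
    next
      case 2
      then have "0 *\<^sub>R x + 1 *\<^sub>R y = 0" by simp
      then show ?thesis using assms unfolding lin_indep2_def by (metis zero_neq_one)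
    next
      case (3 c)
      then have "(- c) *\<^sub>R x + 1 *\<^sub>R y = 0" by simp
      then show ?thesis using assms unfolding lin_indep2_def by (metis zero_neq_one)
    qed
  qed
  then have "dim {v. (cross3 x y) \<bullet> v = 0} = 2" by (simp add: dim_hyperplane)
  moreover have "dim (span {x, y}) = 2"
    using assms unfolding lin_indep2_iff by (simp add: dim_eq_card_independent)
  moreover have "span {x, y} \<subseteq> {v. (cross3 x y) \<bullet> v = 0}"
    by (rule span_minimal) (auto simp: dot_cross_self subspace_hyperplane)
  ultimately have "span {x, y} = {v. (cross3 x y) \<bullet> v = 0}"
    by (intro subspace_dim_equal subspace_span subspace_hyperplane) simp_all
  then show ?thesis by simp
qed

text \<open>In dimension three the cross product of a local frame gives the coefficients of a
  one-form whose kernel is the plane. This provides the form to which the contact condition is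
  applied.\<close>

lemma contact_structure_form:
  assumes M: "manifold M" and contact: "contact_structure M \<xi>" and c: "c \<in> charts M" "p \<in> snd c ` fst c"
  obtains V \<alpha> where "open V" "p \<in> V" "V \<subseteq> snd c ` fst c" "one_form_on V \<alpha>"
    "\<forall>q\<in>V. coord_distrib c \<xi> q = {v. \<alpha> q v = 0}"
    "\<exists>u v w. wedge12 (\<alpha> p) (ext_deriv \<alpha> p) u v w \<noteq> 0"
proof -
  have \<xi>: "distribution M 2 \<xi>" using contact unfolding contact_structure_def by blast
  obtain V X Y where *: "open V" "p \<in> V" "V \<subseteq> snd c ` fst c" "smooth_on V X" "smooth_on V Y"
    "\<forall>q\<in>V. coord_distrib c \<xi> q = span {X q, Y q} \<and> dim (coord_distrib c \<xi> q) = 2"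
    using local_frame[OF M \<xi> c] .
  define \<alpha> where "\<alpha> q u = (cross3 (X q) (Y q)) \<bullet> u" for q u
  have "bounded_bilinear cross3" using bilinear_cross bilinear_conv_bounded_bilinear by blast
  from smooth_on_bilinear[OF this *(1,4,5)] have X: "smooth_on V (\<lambda>q. cross3 (X q) (Y q))" .
  have "smooth_on V (\<lambda>q. \<alpha> q u)" for u
    unfolding \<alpha>_def by (rule smooth_on_bilinear[OF bounded_bilinear_inner *(1) X smooth_on_const])
  then have form: "one_form_on V \<alpha>"
    unfolding one_form_on_def \<alpha>_def by (auto simp: linear_iff inner_add_right)
  have ker: "\<forall>q\<in>V. coord_distrib c \<xi> q = {v. \<alpha> q v = 0}"
  proof
    fix q assume "q \<in> V"
    then have "coord_distrib c \<xi> q = span {X q, Y q}" "dim (coord_distrib c \<xi> q) = 2" using *(6) by blast+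
    moreover then have "lin_indep2 (X q) (Y q)" using span_pair_lin_indep2 by metis
    ultimately show "coord_distrib c \<xi> q = {v. \<alpha> q v = 0}" unfolding \<alpha>_def using cross3_kernel by simp
  qed
  have "\<forall>q\<in>V. \<exists>u v w. wedge12 (\<alpha> q) (ext_deriv \<alpha> q) u v w \<noteq> 0"
    using contact *(1,3) form ker c(1) unfolding contact_structure_def by blast
  then show thesis using that[OF *(1-3) form ker] *(2) by blast
qed

lemma contact_etale_lie_groupoidD:
  assumes "contact_etale_lie_groupoid G"
  shows "etale_lie_groupoid G" "contact_structure (Obj G) (Obj_dist G)" "contact_structure (Arr G) (Arr_dist G)"
    "distribution (Obj G) 2 (Obj_dist G)" "distribution (Arr G) 2 (Arr_dist G)" "local_diffeo (Arr G) (Obj G) (tgt G)"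
    "\<forall>\<sigma>\<in>points (Arr G). differential (Arr G) (Obj G) (src G) \<sigma> ` Arr_dist G \<sigma> = Obj_dist G (src G \<sigma>)"
    "\<forall>\<sigma>\<in>points (Arr G). differential (Arr G) (Obj G) (tgt G) \<sigma> ` Arr_dist G \<sigma> = Obj_dist G (tgt G \<sigma>)"
proof -
  note D = assms[unfolded contact_etale_lie_groupoid_def local_contactomorphism_def]
  show "etale_lie_groupoid G" using D by (elim conjE)
  show c: "contact_structure (Obj G) (Obj_dist G)" using D by (elim conjE)
  show c': "contact_structure (Arr G) (Arr_dist G)" using D by (elim conjE)
  show "distribution (Obj G) 2 (Obj_dist G)" using c unfolding contact_structure_def by (elim conjE)
  show "distribution (Arr G) 2 (Arr_dist G)" using c' unfolding contact_structure_def by (elim conjE)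
  show "local_diffeo (Arr G) (Obj G) (tgt G)" using D by (elim conjE)
  show "\<forall>\<sigma>\<in>points (Arr G). differential (Arr G) (Obj G) (src G) \<sigma> ` Arr_dist G \<sigma> = Obj_dist G (src G \<sigma>)"
    using D by (elim conjE)
  show "\<forall>\<sigma>\<in>points (Arr G). differential (Arr G) (Obj G) (tgt G) \<sigma> ` Arr_dist G \<sigma> = Obj_dist G (tgt G \<sigma>)"
    using D by (elim conjE)
qed

text \<open>From the identity on the plane to the identity arrow. The transverse direction is
  controlled by the multiplier of the contact form, higher orders by finiteness of the order, and
  the arrow itself by effectiveness.\<close>

lemma isotropy_eq_ident:
  fixes G :: "('a, 'b, real^3) dist_groupoid" and n :: nat
  assumes G: "contact_etale_lie_groupoid G" and eff: "effective_groupoid G"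
    and iso: "\<sigma> \<in> isotropy G x" and c: "c \<in> charts_at (Obj G) x"
    and n: "n > 0" "\<sigma> [^]\<^bsub>isotropy_group G x\<^esub> n = ident G x"
    and id_plane: "\<And>w. w \<in> (\<lambda>v. v c) ` Obj_dist G x \<Longrightarrow> arrow_deriv G c c \<sigma> w = w"
  shows "\<sigma> = ident G x"
proof -
  note E = contact_etale_lie_groupoidD(1)[OF G] and contact = contact_etale_lie_groupoidD(2)[OF G]
    and \<xi> = contact_etale_lie_groupoidD(4)[OF G] and \<zeta> = contact_etale_lie_groupoidD(5)[OF G]
    and ds = contact_etale_lie_groupoidD(7)[OF G] and dt = contact_etale_lie_groupoidD(8)[OF G]
  note mO = manifold_Obj[OF E] and mA = manifold_Arr[OF E] and \<sigma> = isotropyD[OF E iso]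
  have C: "c \<in> charts (Obj G)" "x \<in> fst c" using charts_at_D[OF mO c] by blast+
  have c': "c \<in> charts_at (Obj G) (src G \<sigma>)" "c \<in> charts_at (Obj G) (tgt G \<sigma>)" using c \<sigma> by simp_all
  obtain U S where S: "local_section G c U S" "snd c (src G \<sigma>) \<in> U" "S (snd c (src G \<sigma>)) = \<sigma>"
    "\<forall>q\<in>U. tgt G (S q) \<in> fst c" "C2_on U (\<lambda>q. snd c (tgt G (S q)))"
    "\<forall>q\<in>U. \<forall>z\<in>tangent_space (Arr G) (S q). frechet_derivative (\<lambda>q. snd c (tgt G (S q))) (at q)
       (differential (Arr G) (Obj G) (src G) (S q) z c) = differential (Arr G) (Obj G) (tgt G) (S q) z c"
    using arrow_section[OF E \<sigma>(1) c'] .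
  define F where "F = (\<lambda>q. snd c (tgt G (S q)))"
  define p where "p = snd c x"
  note S = S[folded F_def, unfolded \<sigma>(2), folded p_def]
  have dF: "F differentiable (at p)" using S(2,5) unfolding C2_on_def by blast
  have Fp: "F p = p" using S(3) \<sigma>(3) by (simp add: F_def p_def)
  have A: "arrow_deriv G c c \<sigma> = frechet_derivative F (at p)"
    using arrow_deriv_section[OF E S(1), of \<sigma> c] S(2,3) dF unfolding F_def p_def \<sigma>(2) by blast
  have Fn: "\<forall>\<^sub>F q in nhds p. (F ^^ n) q = q"
    using isotropy_finite_order_section[OF E iso c S(1) _ _ S(4) n(2)] S(2,3) unfolding F_def p_def by blast
  obtain V \<alpha> where V: "open V" "p \<in> V" "V \<subseteq> snd c ` fst c" "one_form_on V \<alpha>"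
    "\<forall>q\<in>V. coord_distrib c (Obj_dist G) q = {v. \<alpha> q v = 0}"
    "\<exists>u v w. wedge12 (\<alpha> p) (ext_deriv \<alpha> p) u v w \<noteq> 0"
    using contact_structure_form[OF mO contact C(1) imageI[OF C(2)], folded p_def] .
  obtain x1 x2 x3 where nz: "wedge12 (\<alpha> p) (ext_deriv \<alpha> p) x1 x2 x3 \<noteq> 0" using V(6) by blast
  obtain u v where uv: "\<alpha> p u = 0" "\<alpha> p v = 0" "ext_deriv \<alpha> p u v \<noteq> 0"
    using exists_nonzero_ext_deriv[OF V(4,1,2) nz] .
  have "\<exists>w. \<alpha> p w \<noteq> 0"
  proof (rule ccontr)
    assume "\<not> ?thesis"
    then have "\<alpha> p y = 0" for y by blast
    then show False using nz by (simp add: wedge12_def)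
  qed
  then obtain w where w: "\<alpha> p w \<noteq> 0" by blast
  have plane: "(\<lambda>v. v c) ` Obj_dist G x = {v. \<alpha> p v = 0}"
    using V(5) V(2) coord_distrib_chart[OF mO \<xi> c] unfolding p_def by blast
  have id_ker: "frechet_derivative F (at p) y = y" if "\<alpha> p y = 0" for y
    using id_plane[of y] that unfolding plane A by blast
  \<comment> \<open>A plane vector at \<open>q\<close> is the image of some \<open>z\<close> under
    the differential of the source. The derivative of \<open>F\<close> sends it to the image of
    \<open>z\<close> under the differential of the target, which lies in the plane at
    \<open>F q\<close>.\<close>
  have pres: "\<forall>\<^sub>F q in nhds p. \<forall>y. \<alpha> q y = 0 \<longrightarrow> \<alpha> (F q) (frechet_derivative F (at q) y) = 0"
  proof -
    have "isCont F p" using dF by (rule differentiable_imp_continuous_within)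
    then have "(F \<longlongrightarrow> F p) (nhds p)" by (rule isCont_tendsto_nhds)
    from topological_tendstoD[OF this V(1)] have "\<forall>\<^sub>F q in nhds p. F q \<in> V" using V(2) Fp by simp
    then show ?thesis
      using eventually_nhds_in_open[OF V(1,2)] eventually_nhds_in_open[OF local_sectionD(2)[OF E S(1)] S(2)]
    proof eventually_elim
      case (elim q)
      show ?case
      proof (intro allI impI)
        fix y assume "\<alpha> q y = 0"
        then have "y \<in> coord_distrib c (Obj_dist G) q" using V(5) elim(2) by blast
        then obtain y' where y': "y' \<in> Obj_dist G (chart_inv c q)" "y = y' c" unfolding coord_distrib_def by blast
        note Sq = local_sectionD(5,6)[OF E S(1) elim(3)]
        have "y' \<in> differential (Arr G) (Obj G) (src G) (S q) ` Arr_dist G (S q)" using ds Sq y'(1) by simp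
        then obtain z where z: "z \<in> Arr_dist G (S q)" "y' = differential (Arr G) (Obj G) (src G) (S q) z" by blast
        have "z \<in> tangent_space (Arr G) (S q)" using distribution_subset[OF mA \<zeta> Sq(2)] z(1) by blast
        then have "frechet_derivative F (at q) y = differential (Arr G) (Obj G) (tgt G) (S q) z c"
          using S(6) elim(3) unfolding y'(2) z(2) by blast
        moreover have "differential (Arr G) (Obj G) (tgt G) (S q) z \<in> Obj_dist G (tgt G (S q))"
          using dt Sq(2) z(1) by blast
        moreover have "chart_inv c (F q) = tgt G (S q)"
          unfolding F_def using chart_inv_chart[OF chart_inj[OF mO C(1)]] S(4) elim(3) by blast
        ultimately have "frechet_derivative F (at q) y \<in> coord_distrib c (Obj_dist G) (F q)"
          unfolding coord_distrib_def by simp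
        then show "\<alpha> (F q) (frechet_derivative F (at q) y) = 0" using V(5) elim(1) by blast
      qed
    qed
  qed
  have mult: "\<alpha> p (frechet_derivative F (at p) w) = \<alpha> p w"
    by (rule contact_multiplier_eq_1[OF V(4,1,2) S(5,2) Fp pres id_ker uv w])
  have lin: "linear (frechet_derivative F (at p))" by (rule C2_on_linear[OF S(5,2)])
  have lin\<alpha>: "linear (\<alpha> p)" by (rule one_form_on_linear[OF V(4,2)])
  have "frechet_derivative F (at p) w = w"
  \<comment> \<open>Since the multiplier is 1, the displacement of \<open>w\<close> lies in the
    kernel of the form, where the derivative is already the identity. So the derivative is unipotent
    on \<open>w\<close>, and finite order makes it fix \<open>w\<close>.\<close>
  proof (rule finite_order_unipotent[OF lin _ n(1) finite_order_derivative[OF dF Fp Fn]])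
    show "frechet_derivative F (at p) (frechet_derivative F (at p) w - w) = frechet_derivative F (at p) w - w"
      by (rule id_ker) (simp add: linear_diff[OF lin\<alpha>] mult)
  qed
  then have "frechet_derivative F (at p) y = y" for y
  proof -
    \<comment> \<open>Every vector is a kernel vector plus a multiple of \<open>w\<close>, and both
      parts are fixed.\<close>
    have "\<alpha> p (y - (\<alpha> p y / \<alpha> p w) *\<^sub>R w) = 0"
      using w by (simp add: linear_diff[OF lin\<alpha>] linear_scale[OF lin\<alpha>])
    from id_ker[OF this] show ?thesis
      using \<open>frechet_derivative F (at p) w = w\<close> by (simp add: linear_diff[OF lin] linear_scale[OF lin])
  qed
  from finite_order_germ_eq_id[OF S(5,2) Fp this n(1) Fn]
  have "\<forall>\<^sub>F q in nhds (snd c x). snd c (tgt G (S q)) = q" unfolding F_def p_def .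
  then show ?thesis
    using effective_imp_ident[OF E eff iso c S(1) _ _ S(4)] S(2,3) unfolding p_def by blast
qed

lemma is_manifold_prol_groupoid_iff:
  fixes G :: "('a, 'b, real^3) dist_groupoid"
  assumes T: "line_or_ray_scalars T" and G: "contact_etale_lie_groupoid G" and eff: "effective_groupoid G"
  shows "is_manifold (prol_groupoid T G) \<longleftrightarrow> proper_groupoid G \<and> positive_groupoid G \<and>
    (T = UNIV \<longrightarrow> (\<forall>x\<in>points (Obj G). odd (card (isotropy G x))))"
proof -
  note E = contact_etale_lie_groupoidD(1)[OF G] and \<xi> = contact_etale_lie_groupoidD(4)[OF G]
  note mO = manifold_Obj[OF E]
  note ctx = T E \<xi> contact_etale_lie_groupoidD(5-8)[OF G]
  let ?P = "\<lambda>c x. (\<lambda>v. v c) ` Obj_dist G x"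
  have lin: "linear (arrow_deriv G c c \<sigma>)" and inv: "\<And>u. u \<in> ?P c x \<Longrightarrow> arrow_deriv G c c \<sigma> u \<in> ?P c x"
    and inj: "\<And>u. u \<in> ?P c x \<Longrightarrow> arrow_deriv G c c \<sigma> u = 0 \<Longrightarrow> u = 0"
    if "\<sigma> \<in> isotropy G x" "c \<in> charts_at (Obj G) x" for \<sigma> x c
  proof -
    note \<sigma> = isotropyD[OF E that(1)]
    have c: "c \<in> charts_at (Obj G) (src G \<sigma>)" "c \<in> charts_at (Obj G) (tgt G \<sigma>)" using that(2) \<sigma> by simp_all
    show "linear (arrow_deriv G c c \<sigma>)" by (rule arrow_deriv_differential(1)[OF E \<sigma>(1) c])
    show "arrow_deriv G c c \<sigma> u \<in> ?P c x" if "u \<in> ?P c x" for u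
      using arrow_deriv_dist(1)[OF ctx \<sigma>(1) c, of u] that unfolding \<sigma>(2,3) by blast
    show "u = 0" if "u \<in> ?P c x" "arrow_deriv G c c \<sigma> u = 0" for u
      using arrow_deriv_dist(2)[OF ctx \<sigma>(1) c, of u] that unfolding \<sigma>(2) by blast
  qed
  have pos_iff: "positive_groupoid G \<longleftrightarrow> (\<forall>x\<in>points (Obj G). \<forall>c\<in>charts_at (Obj G) x. \<forall>\<sigma>\<in>isotropy G x.
      \<forall>u\<in>?P c x. \<forall>v\<in>?P c x. lin_indep2 u v \<longrightarrow>
      (\<exists>\<alpha> \<beta> \<gamma> \<delta>. arrow_deriv G c c \<sigma> u = \<alpha> *\<^sub>R u + \<beta> *\<^sub>R v \<and> arrow_deriv G c c \<sigma> v = \<gamma> *\<^sub>R u + \<delta> *\<^sub>R v \<and> \<alpha> * \<delta> - \<beta> * \<gamma> > 0))"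
    (is "_ \<longleftrightarrow> (\<forall>x\<in>points (Obj G). \<forall>c\<in>charts_at (Obj G) x. \<forall>\<sigma>\<in>isotropy G x. ?Q x c \<sigma>)")
  proof
    assume pos: "positive_groupoid G"
    show "\<forall>x\<in>points (Obj G). \<forall>c\<in>charts_at (Obj G) x. \<forall>\<sigma>\<in>isotropy G x. ?Q x c \<sigma>"
    proof (rule ballI, rule ballI, rule ballI)
      fix x c \<sigma> assume x: "x \<in> points (Obj G)" and c: "c \<in> charts_at (Obj G) x" and iso: "\<sigma> \<in> isotropy G x"
      obtain W where W: "arrow_nbhd G \<sigma> W" using src_nbhd[OF E isotropyD(1)[OF E iso]] unfolding arrow_nbhd_def by metis
      have "preserves_orientation (Obj_dist G x) (differential (Obj G) (Obj G) (germ_map G W) x)"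
        using pos x iso W unfolding positive_groupoid_def by blast
      then show "?Q x c \<sigma>" unfolding preserves_orientation_iff[OF ctx iso W c] .
    qed
  next
    assume Q: "\<forall>x\<in>points (Obj G). \<forall>c\<in>charts_at (Obj G) x. \<forall>\<sigma>\<in>isotropy G x. ?Q x c \<sigma>"
    show "positive_groupoid G"
      unfolding positive_groupoid_def
    proof (intro ballI allI impI)
      fix x \<sigma> W assume x: "x \<in> points (Obj G)" and iso: "\<sigma> \<in> isotropy G x" and W: "arrow_nbhd G \<sigma> W"
      obtain c where c: "c \<in> charts_at (Obj G) x" using charts_at_ex[OF mO x] by blast
      show "preserves_orientation (Obj_dist G x) (differential (Obj G) (Obj G) (germ_map G W) x)"
        unfolding preserves_orientation_iff[OF ctx iso W c] using Q[rule_format, OF x c iso] by blast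
    qed
  qed
  have free_iff: "free_groupoid (prol_groupoid T G) \<longleftrightarrow> acts_freely_on_directions T G"
    using free_imp_acts_freely[OF ctx] acts_freely_imp_free[OF ctx] by blast
  \<comment> \<open>The equivalence is shown under properness, which makes the isotropy groups
    finite and so gives a meaning to parity and to the order of elements.\<close>
  have "acts_freely_on_directions T G \<longleftrightarrow> positive_groupoid G \<and> (T = UNIV \<longrightarrow> (\<forall>x\<in>points (Obj G). odd (card (isotropy G x))))"
    if proper: "proper_groupoid G"
  proof
    assume "acts_freely_on_directions T G"
    note af = this[unfolded acts_freely_on_directions_def[OF ctx], rule_format]
    have "positive_groupoid G"
      unfolding pos_iff
    proof (intro ballI impI)
      fix x c \<sigma> u v assume x: "x \<in> points (Obj G)" and c: "c \<in> charts_at (Obj G) x" and iso: "\<sigma> \<in> isotropy G x"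
        and uv: "u \<in> ?P c x" "v \<in> ?P c x" "lin_indep2 u v"
      show "\<exists>\<alpha> \<beta> \<gamma> \<delta>. arrow_deriv G c c \<sigma> u = \<alpha> *\<^sub>R u + \<beta> *\<^sub>R v \<and> arrow_deriv G c c \<sigma> v = \<gamma> *\<^sub>R u + \<delta> *\<^sub>R v \<and> \<alpha> * \<delta> - \<beta> * \<gamma> > 0"
      proof (cases "\<sigma> = ident G x")
        case True
        then show ?thesis
          using arrow_deriv_ident[OF E c] by (intro exI[of _ 1] exI[of _ 0]) simp
      next
        case False
        have no_eig: "w = 0" if w: "w \<in> ?P c x" "m > 0" "arrow_deriv G c c \<sigma> w = m *\<^sub>R w" for w m
        proof (rule ccontr)
          assume "w \<noteq> 0"
          from af[OF x c iso w(1) line_or_ray_scalars_pos[OF T w(2)] this _ w(3)] show False using w(2) False by simp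
        qed
        show ?thesis
          by (rule orientation_preserving_if_no_positive_eigenvalue[OF lin[OF iso c] coord_plane[OF mO \<xi> c]
                inv[OF iso c] inj[OF iso c] no_eig uv])
      qed
    qed
    moreover have "odd (card (isotropy G x))" if TU: "T = UNIV" and x: "x \<in> points (Obj G)" for x
    proof
      assume "even (card (isotropy G x))"
      interpret group "isotropy_group G x" by (rule group_isotropy[OF E x])
      have carr: "carrier (isotropy_group G x) = isotropy G x" by (simp add: isotropy_group_def[OF E])
      obtain \<sigma> where \<sigma>: "\<sigma> \<in> isotropy G x" "\<sigma> \<noteq> ident G x" "gmult G \<sigma> \<sigma> = ident G x"
        using even_order_involution finite_isotropy[OF E proper x] \<open>even (card (isotropy G x))\<close>
        unfolding order_def carr by (auto simp: isotropy_group_def[OF E])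
      obtain c where c: "c \<in> charts_at (Obj G) x" using charts_at_ex[OF mO x] by blast
      note D = isotropyD[OF E \<sigma>(1)]
      have cc: "c \<in> charts_at (Obj G) (src G \<sigma>)" "c \<in> charts_at (Obj G) (tgt G \<sigma>)" using c D by simp_all
      \<comment> \<open>The square of \<open>\<sigma>\<close> is the identity arrow, and the linear
        action is functorial.\<close>
      have invol: "arrow_deriv G c c \<sigma> (arrow_deriv G c c \<sigma> w) = w" for w
        using arrow_deriv_gmult[OF E isotropy_composable[OF E \<sigma>(1,1)] cc cc(2), of w] arrow_deriv_ident[OF E c] \<sigma>(3) by simp
      obtain w where w: "w \<in> ?P c x" "w \<noteq> 0" "arrow_deriv G c c \<sigma> w = w \<or> arrow_deriv G c c \<sigma> w = - w"
        by (rule involution_has_eigenvector[OF lin[OF \<sigma>(1) c] coord_plane[OF mO \<xi> c] inv[OF \<sigma>(1) c]]) (assumption, rule invol)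
      from w(3) obtain a :: real where a: "a \<noteq> 0" "arrow_deriv G c c \<sigma> w = a *\<^sub>R w"
      proof
        assume "arrow_deriv G c c \<sigma> w = w"
        then show thesis using that[of 1] by simp
      next
        assume "arrow_deriv G c c \<sigma> w = - w"
        then show thesis using that[of "-1"] by simp
      qed
      \<comment> \<open>The eigenvalue may be -1, which is admissible for lines only.\<close>
      have "a \<in> T" using TU by simp
      from af[OF x c \<sigma>(1) w(1) this w(2) a] show False using \<sigma>(2) by blast
    qed
    ultimately show "positive_groupoid G \<and> (T = UNIV \<longrightarrow> (\<forall>x\<in>points (Obj G). odd (card (isotropy G x))))" by blast
  next
    assume R: "positive_groupoid G \<and> (T = UNIV \<longrightarrow> (\<forall>x\<in>points (Obj G). odd (card (isotropy G x))))"
    show "acts_freely_on_directions T G"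
      unfolding acts_freely_on_directions_def[OF ctx]
    proof (intro ballI impI)
      fix x c \<sigma> u a assume x: "x \<in> points (Obj G)" and c: "c \<in> charts_at (Obj G) x" and iso: "\<sigma> \<in> isotropy G x"
        and u: "u \<in> ?P c x" "u \<noteq> 0" and a: "a \<in> T" "a \<noteq> 0" "arrow_deriv G c c \<sigma> u = a *\<^sub>R u"
      interpret group "isotropy_group G x" by (rule group_isotropy[OF E x])
      have carr: "carrier (isotropy_group G x) = isotropy G x" by (simp add: isotropy_group_def[OF E])
      \<comment> \<open>The exponent is the order of the whole isotropy group rather than of
        \<open>\<sigma>\<close>: its power is trivial as well, and its parity is the one in the
        hypothesis.\<close>
      define n where "n = card (isotropy G x)"
      have "n > 0" using finite_isotropy[OF E proper x] iso unfolding n_def by (auto simp: card_gt_0_iff)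
      have pow: "\<sigma> [^]\<^bsub>isotropy_group G x\<^esub> n = ident G x"
        using pow_order_eq_1[of \<sigma>] iso unfolding order_def carr n_def by (simp add: isotropy_group_def[OF E])
      \<comment> \<open>Rays supply the first alternative and lines the second; either one forces
        the eigenvalue of an element of finite order to be 1.\<close>
      have an: "a > 0 \<or> odd n" using a(1) T R x unfolding n_def line_or_ray_scalars_def by auto
      note \<sigma> = isotropyD[OF E iso]
      have cc: "c \<in> charts_at (Obj G) (src G \<sigma>)" "c \<in> charts_at (Obj G) (tgt G \<sigma>)" using c \<sigma> by simp_all
      obtain U S where S: "local_section G c U S" "snd c (src G \<sigma>) \<in> U" "S (snd c (src G \<sigma>)) = \<sigma>"
        "\<forall>q\<in>U. tgt G (S q) \<in> fst c" "C2_on U (\<lambda>q. snd c (tgt G (S q)))"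
        "\<forall>q\<in>U. \<forall>z\<in>tangent_space (Arr G) (S q). frechet_derivative (\<lambda>q. snd c (tgt G (S q))) (at q)
           (differential (Arr G) (Obj G) (src G) (S q) z c) = differential (Arr G) (Obj G) (tgt G) (S q) z c"
        using arrow_section[OF E \<sigma>(1) cc] .
      have dF: "(\<lambda>q. snd c (tgt G (S q))) differentiable (at (snd c (src G \<sigma>)))" using S(2,5) unfolding C2_on_def by blast
      note A = arrow_deriv_section[OF E S(1-3) dF]
      have ord: "(arrow_deriv G c c \<sigma> ^^ n) w = w" for w
        unfolding A
      proof (rule finite_order_derivative[OF dF])
        show "snd c (tgt G (S (snd c (src G \<sigma>)))) = snd c (src G \<sigma>)" using S(3) \<sigma>(2,3) by simp
        show "\<forall>\<^sub>F q in nhds (snd c (src G \<sigma>)). ((\<lambda>q. snd c (tgt G (S q))) ^^ n) q = q"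
          using isotropy_finite_order_section[OF E iso c S(1) _ _ S(4) pow] S(2,3) unfolding \<sigma>(2) by blast
      qed
      have pos: "\<exists>\<alpha> \<beta> \<gamma> \<delta>. arrow_deriv G c c \<sigma> u = \<alpha> *\<^sub>R u + \<beta> *\<^sub>R v \<and> arrow_deriv G c c \<sigma> v = \<gamma> *\<^sub>R u + \<delta> *\<^sub>R v \<and> \<alpha> * \<delta> - \<beta> * \<gamma> > 0"
        if "u \<in> ?P c x" "v \<in> ?P c x" "lin_indep2 u v" for u v
        using conjunct1[OF R, unfolded pos_iff, rule_format, OF x c iso that] .
      have "arrow_deriv G c c \<sigma> w = w" if "w \<in> ?P c x" for w
        by (rule finite_order_eigenvector_imp_id[OF lin[OF iso c] coord_plane[OF mO \<xi> c] pos u a(3) \<open>n > 0\<close> an ord that])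
      then show "\<sigma> = ident G x" by (rule isotropy_eq_ident[OF G eff iso c \<open>n > 0\<close> pow])
    qed
  qed
  then show ?thesis
    unfolding is_manifold_def proper_prol_groupoid_iff[OF ctx] free_iff by blast
qed

theorem corollary4p5:
  fixes G :: "('a, 'b, real^3) dist_groupoid"
  assumes "contact_etale_lie_groupoid G"
    and "effective_groupoid G"
  shows "(is_manifold (cartan_prolongation G) \<longleftrightarrow>
            proper_groupoid G \<and> positive_groupoid G \<and>
            (\<forall>x\<in>points (Obj G). odd (card (isotropy G x)))) \<and>
         (is_manifold (oriented_cartan_prolongation G) \<longleftrightarrow>
            proper_groupoid G \<and> positive_groupoid G)"
proof -
  have "line_or_ray_scalars UNIV" "line_or_ray_scalars {0<..}" by (simp_all add: line_or_ray_scalars_def)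
  moreover have "{0<..} \<noteq> (UNIV :: real set)" by (metis UNIV_I greaterThan_iff less_irrefl)
  ultimately show ?thesis
    unfolding cartan_prolongation_def oriented_cartan_prolongation_def
    using is_manifold_prol_groupoid_iff[OF _ assms] by simp
qed

end
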